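(* Let $T,\mathfrak{c},p\in(0,\infty)$, $\alpha,\beta\in\mathbb{R}$, let $\mathbf{a}\in C(\mathbb{R},\mathbb{R})$ be the activation function, and let $\mathcal{N}$, $\mathcal{P}\colon\mathcal{N}\to\mathbb{N}$ and $\mathcal{R}\colon\mathcal{N}\to\bigcup_{d=1}^\infty C(\mathbb{R}^d,\mathbb{R})$ be the set of neural networks, the parameter-count function and the realization function (with respect to $\mathbf{a}$) defined in the context. Let $\varphi_d\in C(\mathbb{R}^d,\mathbb{R})$, $d\in\mathbb{N}$, and let $(\phi_{d,\delta})_{d\in\mathbb{N},\,\delta\in(0,1]}\subseteq\mathcal{N}$ satisfy for all $d\in\mathbb{N}$, $\delta\in(0,1]$, $x\in\mathbb{R}^d$ that $\mathcal{P}(\phi_{d,\delta})\le\mathfrak{c}\,d^{\mathfrak{c}}\delta^{-\mathfrak{c}}$, $\mathcal{R}(\phi_{d,\delta})\in C(\mathbb{R}^d,\mathbb{R})$, $|(\mathcal{R}(\phi_{d,\delta}))(x)|\le\mathfrak{c}\,d^{\mathfrak{c}}(1+\|x\|^{\mathfrak{c}})$, and $$|\varphi_d(x)-(\mathcal{R}(\phi_{d,\delta}))(x)|\le\mathfrak{c}\,d^{\mathfrak{c}}\,\delta\,(1+\|x\|^{\mathfrak{c}}).$$ Then: (i) There exist unique continuous functions $u_d\colon[0,T]\times\mathbb{R}^d\to\mathbb{R}$, $d\in\mathbb{N}$, which satisfy for all $d\in\mathbb{N}$, $x\in\mathbb{R}^d$ that $u_d(T,x)=\varphi_d(x)$, which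 satisfy for all $d\in\mathbb{N}$ that $\inf_{q\in(0,\infty)}\sup_{(t,x)\in[0,T]\times\mathbb{R}^d}\frac{|u_d(t,x)|}{1+\|x\|^q}<\infty$, and which satisfy for all $d\in\mathbb{N}$ that $u_d$ is a viscosity solution of $$\Big(\tfrac{\partial u_d}{\partial t}\Big)(t,x)+\sum_{i=1}^d\tfrac{\beta^2|x_i|^2}{2}\Big(\tfrac{\partial^2u_d}{\partial x_i^2}\Big)(t,x)+\sum_{i=1}^d\alpha x_i\Big(\tfrac{\partial u_d}{\partial x_i}\Big)(t,x)=0$$ for $(t,x)=(t,x_1,\dots,x_d)\in(0,T)\times\mathbb{R}^d$. (ii) There exist $\mathfrak{C}\in(0,\infty)$ and $(\psi_{d,\varepsilon})_{d\in\mathbb{N},\,\varepsilon\in(0,1]}\subseteq\mathcal{N}$ such that for all $d\in\mathbb{N}$, $\varepsilon\in(0,1]$ it holds that $\mathcal{P}(\psi_{d,\varepsilon})\le\mathfrak{C}\,d^{\mathfrak{C}}\varepsilon^{-\mathfrak{C}}$, $\mathcal{R}(\psi_{d,\varepsilon})\in C(\mathbb{R}^d,\mathbb{R})$, and $$\Big[\int_{[0,1]^d}|u_d(0,x)-(\mathcal{R}(\psi_{d,\varepsilon}))(x)|^p\,dx\Big]^{1/p}\le\varepsilon.$$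
   Context: $\mathbb{N}=\{1,2,3,\dots\}$; $\|\cdot\|$ is the Euclidean norm on $\mathbb{R}^d$. Neural networks: for $d\in\mathbb{N}$ let $\mathbf{A}_d\colon\mathbb{R}^d\to\mathbb{R}^d$, $\mathbf{A}_d(x_1,\dots,x_d)=(\mathbf{a}(x_1),\dots,\mathbf{a}(x_d))$. Let $$\mathcal{N}=\bigcup_{\mathcal{L}\in\{2,3,\dots\}}\ \bigcup_{(l_0,\dots,l_{\mathcal{L}})\in\mathbb{N}^{\mathcal{L}}\times\{1\}}\ \prod_{k=1}^{\mathcal{L}}\big(\mathbb{R}^{l_k\times l_{k-1}}\times\mathbb{R}^{l_k}\big).$$ For $\Phi=((W_1,B_1),\dots,(W_{\mathcal{L}},B_{\mathcal{L}}))\in\prod_{k=1}^{\mathcal{L}}(\mathbb{R}^{l_k\times l_{k-1}}\times\mathbb{R}^{l_k})$ set $\mathcal{P}(\Phi)=\sum_{k=1}^{\mathcal{L}}l_k(l_{k-1}+1)$, and let $\mathcal{R}(\Phi)\in C(\mathbb{R}^{l_0},\mathbb{R})$ be given by $(\mathcal{R}(\Phi))(x_0)=W_{\mathcal{L}}x_{\mathcal{L}-1}+B_{\mathcal{L}}$, where $x_k=\mathbf{A}_{l_k}(W_kx_{k-1}+B_k)$ for $0<k<\mathcal{L}$. Viscosity solutions: $u_d$ is a viscosity solution of the displayed equation (written $\partial_tu+Gu=0$ with $G=\sum_i\frac{\beta^2|x_i|^2}{2}\partial_{x_i}^2+\sum_i\alpha x_i\partial_{x_i}$) on $(0,T)\times\mathbb{R}^d$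 if for every $(s,y)\in(0,T)\times\mathbb{R}^d$: for every $h\in C^2((0,T)\times\mathbb{R}^d,\mathbb{R})$ with $h\ge u_d$ and $h(s,y)=u_d(s,y)$ one has $(\partial_th+Gh)(s,y)\ge0$, and for every $h\in C^2((0,T)\times\mathbb{R}^d,\mathbb{R})$ with $h\le u_d$ and $h(s,y)=u_d(s,y)$ one has $(\partial_th+Gh)(s,y)\le0$. *)

theory Defs
  imports "HOL-Analysis.Analysis" "Jordan_Normal_Form.Matrix"
begin

section \<open>Euclidean spaces of variable dimension\<close>

text \<open>
  The dimension is quantified inside the theorem, so a point of R^d is a function on nat that is
  extensional on \<open>{..<d}\<close>; the coordinates \<open>x_1, ..., x_d\<close> are \<open>x 0, ..., x (d - 1)\<close>. This set is
  also the space of the product measure below, and the product topology on \<open>nat \<Rightarrow> real\<close> induces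
  the Euclidean topology on it. Only continuous functions are integrated, over the compact
  \<open>unit_cube d\<close>, so the value 0 of the Bochner integral for non-integrable functions plays no role.
\<close>

definition Rn :: "nat \<Rightarrow> (nat \<Rightarrow> real) set" where
  "Rn d = {..<d} \<rightarrow>\<^sub>E UNIV"

definition norm_Rn :: "nat \<Rightarrow> (nat \<Rightarrow> real) \<Rightarrow> real" where
  "norm_Rn d x = L2_set x {..<d}"

definition lebesgue_Rn :: "nat \<Rightarrow> (nat \<Rightarrow> real) measure" where
  "lebesgue_Rn d = PiM {..<d} (\<lambda>_. lborel)"

definition unit_cube :: "nat \<Rightarrow> (nat \<Rightarrow> real) set" where
  "unit_cube d = {..<d} \<rightarrow>\<^sub>E {0..1}"

text \<open>
  The space C(A, R). Extensionality makes equality in it the equality of functions with domain A.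
\<close>

definition cfun :: "'a::topological_space set \<Rightarrow> ('a \<Rightarrow> real) set" where
  "cfun A = {f \<in> A \<rightarrow>\<^sub>E UNIV. continuous_on A f}"


section \<open>Neural networks\<close>

type_synonym network = "(real mat \<times> real vec) list"

definition networks :: "network set" where
  "networks = {\<Phi>. \<exists>L l. L \<ge> 2 \<and> (\<forall>k\<le>L. l k \<ge> (1::nat)) \<and> l L = 1 \<and> length \<Phi> = L \<and>
     (\<forall>k<L. \<Phi> ! k \<in> carrier_mat (l (Suc k)) (l k) \<times> carrier_vec (l (Suc k)))}"

definition param_count :: "network \<Rightarrow> nat" where
  "param_count \<Phi> = (\<Sum>(W, B)\<leftarrow>\<Phi>. dim_row W * (dim_col W + 1))"

definition input_dim :: "network \<Rightarrow> nat" where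
  "input_dim \<Phi> = dim_col (fst (hd \<Phi>))"

text \<open>The activation is applied after every layer except the last.\<close>

fun eval_layers :: "(real \<Rightarrow> real) \<Rightarrow> network \<Rightarrow> real vec \<Rightarrow> real vec" where
  "eval_layers a [] x = x"
| "eval_layers a [(W, B)] x = W *\<^sub>v x + B"
| "eval_layers a ((W, B) # \<Phi>) x = eval_layers a \<Phi> (map_vec a (W *\<^sub>v x + B))"

definition realization :: "(real \<Rightarrow> real) \<Rightarrow> network \<Rightarrow> (nat \<Rightarrow> real) \<Rightarrow> real" where
  "realization a \<Phi> =
     (\<lambda>x\<in>Rn (input_dim \<Phi>). vec_index (eval_layers a \<Phi> (Matrix.vec (input_dim \<Phi>) x)) 0)"

text \<open>
  Membership of a realization in C(R^d, R) contains the requirement that its domain is R^d. Since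
  \<open>undefined\<close> is a real number, the sets \<open>Rn d\<close> are nested rather than disjoint, so equality of the
  dimensions is required explicitly.
\<close>

definition realizes_on :: "(real \<Rightarrow> real) \<Rightarrow> network \<Rightarrow> nat \<Rightarrow> bool" where
  "realizes_on a \<Phi> d \<longleftrightarrow> input_dim \<Phi> = d \<and> realization a \<Phi> \<in> cfun (Rn d)"


section \<open>Partial derivatives in time and space\<close>

text \<open>The coordinate \<open>None\<close> is the time variable, \<open>Some i\<close> the space variable \<open>x i\<close>.\<close>

fun coord :: "nat option \<Rightarrow> real \<times> (nat \<Rightarrow> real) \<Rightarrow> real" where
  "coord None (t, x) = t"
| "coord (Some i) (t, x) = x i"

fun coord_upd :: "nat option \<Rightarrow> real \<times> (nat \<Rightarrow> real) \<Rightarrow> real \<Rightarrow> real \<times> (nat \<Rightarrow> real)" where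
  "coord_upd None (t, x) r = (r, x)"
| "coord_upd (Some i) (t, x) r = (t, x(i := r))"

definition coords :: "nat \<Rightarrow> nat option set" where
  "coords d = insert None (Some ` {..<d})"

definition partial_deriv ::
  "nat option \<Rightarrow> (real \<times> (nat \<Rightarrow> real) \<Rightarrow> real) \<Rightarrow> real \<times> (nat \<Rightarrow> real) \<Rightarrow> real" where
  "partial_deriv k h z = deriv (\<lambda>r. h (coord_upd k z r)) (coord k z)"

text \<open>
  \<open>Ck_on n d D h\<close>: all partial derivatives of h of order at most n, mixed ones included, exist and
  are continuous on D. It is used for D open in R x R^d, where the derivatives at points of D depend
  only on the values of h on D.
\<close>

primrec Ck_on :: "nat \<Rightarrow> nat \<Rightarrow> (real \<times> (nat \<Rightarrow> real)) set \<Rightarrow>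
    (real \<times> (nat \<Rightarrow> real) \<Rightarrow> real) \<Rightarrow> bool" where
  "Ck_on 0 d D h \<longleftrightarrow> continuous_on D h"
| "Ck_on (Suc n) d D h \<longleftrightarrow> continuous_on D h \<and>
     (\<forall>k\<in>coords d. (\<forall>z\<in>D. (\<lambda>r. h (coord_upd k z r)) differentiable at (coord k z)) \<and>
        Ck_on n d D (partial_deriv k h))"


section \<open>Viscosity solutions\<close>

definition G_op :: "real \<Rightarrow> real \<Rightarrow> nat \<Rightarrow> (real \<times> (nat \<Rightarrow> real) \<Rightarrow> real) \<Rightarrow>
    real \<times> (nat \<Rightarrow> real) \<Rightarrow> real" where
  "G_op \<alpha> \<beta> d h z =
     (\<Sum>i<d. \<beta>\<^sup>2 * \<bar>snd z i\<bar>\<^sup>2 / 2 * partial_deriv (Some i) (partial_deriv (Some i) h) z) +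
     (\<Sum>i<d. \<alpha> * snd z i * partial_deriv (Some i) h z)"

definition viscosity_solution ::
  "real \<Rightarrow> real \<Rightarrow> real \<Rightarrow> nat \<Rightarrow> (real \<times> (nat \<Rightarrow> real) \<Rightarrow> real) \<Rightarrow> bool" where
  "viscosity_solution T \<alpha> \<beta> d u \<longleftrightarrow>
     (let D = {0<..<T} \<times> Rn d in
      \<forall>z\<in>D.
        (\<forall>h. Ck_on 2 d D h \<and> (\<forall>w\<in>D. h w \<ge> u w) \<and> h z = u z \<longrightarrow>
             partial_deriv None h z + G_op \<alpha> \<beta> d h z \<ge> 0) \<and>
        (\<forall>h. Ck_on 2 d D h \<and> (\<forall>w\<in>D. h w \<le> u w) \<and> h z = u z \<longrightarrow>
             partial_deriv None h z + G_op \<alpha> \<beta> d h z \<le> 0))"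

definition poly_growth :: "real \<Rightarrow> nat \<Rightarrow> (real \<times> (nat \<Rightarrow> real) \<Rightarrow> real) \<Rightarrow> bool" where
  "poly_growth T d u \<longleftrightarrow>
     (INF q\<in>{0<..}. SUP (t, x)\<in>{0..T} \<times> Rn d. ereal (\<bar>u (t, x)\<bar> / (1 + norm_Rn d x powr q))) < \<infinity>"

definition solution_family ::
  "real \<Rightarrow> real \<Rightarrow> real \<Rightarrow> (nat \<Rightarrow> (nat \<Rightarrow> real) \<Rightarrow> real) \<Rightarrow>
    (nat \<Rightarrow> real \<times> (nat \<Rightarrow> real) \<Rightarrow> real) \<Rightarrow> bool" where
  "solution_family T \<alpha> \<beta> \<phi> u \<longleftrightarrow>
     u \<in> (\<Pi>\<^sub>E d\<in>{1..}. cfun ({0..T} \<times> Rn d)) \<and>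
     (\<forall>d\<ge>1. \<forall>x\<in>Rn d. u d (T, x) = \<phi> d x) \<and>
     (\<forall>d\<ge>1. poly_growth T d (u d)) \<and>
     (\<forall>d\<ge>1. viscosity_solution T \<alpha> \<beta> d (u d))"

end

theory Submission
  imports Defs "HOL-Probability.Probability"
begin

text \<open>The solution is $u_d(t,x) = E[\varphi_d(x_1 Y^1_{T-t}, \dots, x_d Y^d_{T-t})]$ with independent geometric
  Brownian factors $Y^i$. Terminal data that are finite sums of tensor products of smooth functions give classical
  solutions, and by Stone-Weierstrass such data are dense in a weighted supremum norm. Comparing a viscosity solution
  with these classical solutions needs no doubling of variables and yields uniqueness; existence follows by stability.
  For the approximation, the expectation at time $0$ is replaced by the mean of $M$ copies of the given network with
  rescaled inputs. Sampling good rescalings costs a factor of order $M^{-1/2}$ in $L^2$ with constants polynomial in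
  $d$, and control of a high moment carries the bound over to $L^p$.\<close>

section \<open>Gaussian expectations\<close>

text \<open>The equation degenerates where a coordinate vanishes, so it does not smooth: for
  \<open>d = 1\<close> the data |x| lead to exp(\<alpha>(T - t)) |x|, with a kink at 0 for all
  times. Regularity must therefore come from the data, and statements about continuous data are
  limits of statements about smooth ones. Three demands fix the class of data: all derivatives grow
  polynomially, so that Gaussian expectations can be differentiated under the integral; polynomials
  belong to it, so that a weight dominating any given growth is propagated by the equation itself;
  and it contains bounded functions separating points, for Stone-Weierstrass. The flow multiplies
  each coordinate by a factor that does not depend on the starting point. A sample of the flow is
  therefore absorbed by the first weight matrix, and the mean over \<open>M\<close> samples is again
  a network, of at most M^2 times the size. Constants play two parts. Existence and uniqueness
  tolerate growth like 2^d; the approximation does not, which is why it uses moments of the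
  Euclidean norm and never the product weight.\<close>

definition gauss :: "real measure" where
  "gauss = density lborel (\<lambda>x. ennreal (std_normal_density x))"

lemma prob_space_gauss: "prob_space gauss"
  unfolding gauss_def by (rule prob_space_normal_density) simp

lemma sets_gauss [simp, measurable_cong]: "sets gauss = sets borel"
  by (simp add: gauss_def)

lemma space_gauss [simp]: "space gauss = UNIV"
  by (simp add: gauss_def)

lemma measure_gauss_UNIV [simp]: "measure gauss UNIV = 1"
  using prob_space.prob_space [OF prob_space_gauss] by simp

lemma integrable_gauss_iff:
  assumes [measurable]: "f \<in> borel_measurable borel"
  shows "integrable gauss f \<longleftrightarrow> integrable lborel (\<lambda>x. std_normal_density x * f x)"
  unfolding gauss_def by (subst integrable_real_density) (auto simp: normal_density_nonneg)

lemma integral_gauss: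
  fixes f :: "real \<Rightarrow> real"
  assumes [measurable]: "f \<in> borel_measurable borel"
  shows "integral\<^sup>L gauss f = (\<integral>x. std_normal_density x * f x \<partial>lborel)"
  unfolding gauss_def by (subst integral_real_density) (auto simp: normal_density_nonneg)

text \<open>Completing the square; the exponential is the Cameron-Martin density of the shift by
  \<open>h\<close>.\<close>

lemma std_normal_density_shift:
  "std_normal_density (-h + z) = std_normal_density z * exp (h * z - h\<^sup>2 / 2)"
  unfolding std_normal_density_def
  by (simp add: exp_add [symmetric] power2_eq_square field_simps)

lemma gauss_shift_integrable:
  fixes f :: "real \<Rightarrow> real"
  assumes [measurable]: "f \<in> borel_measurable borel"
  shows "integrable gauss (\<lambda>z. f (z + h)) \<longleftrightarrow> integrable gauss (\<lambda>z. f z * exp (h * z - h\<^sup>2 / 2))"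
proof -
  \<comment> \<open>The form \<open>-h + 1 * z\<close> is that of the affine substitution rule for
    Lebesgue measure applied next.\<close>
  have *: "std_normal_density (-h + 1 * z) * f ((-h + 1 * z) + h) = std_normal_density z * (f z * exp (h * z - h\<^sup>2 / 2))" for z
    using std_normal_density_shift [of h z] by simp
  have "integrable lborel (\<lambda>z. std_normal_density z * f (z + h)) \<longleftrightarrow>
        integrable lborel (\<lambda>z. std_normal_density (-h + 1 * z) * f ((-h + 1 * z) + h))"
    by (rule lborel_integrable_real_affine_iff [symmetric]) simp
  then show ?thesis unfolding * by (simp add: integrable_gauss_iff)
qed

lemma gauss_shift_integral:
  fixes f :: "real \<Rightarrow> real"
  assumes [measurable]: "f \<in> borel_measurable borel"
  shows "(\<integral>z. f (z + h) \<partial>gauss) = (\<integral>z. f z * exp (h * z - h\<^sup>2 / 2) \<partial>gauss)"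
proof -
  have *: "std_normal_density (-h + 1 * z) * f ((-h + 1 * z) + h) = std_normal_density z * (f z * exp (h * z - h\<^sup>2 / 2))" for z
    using std_normal_density_shift [of h z] by simp
  have "(\<integral>z. std_normal_density z * f (z + h) \<partial>lborel) =
        \<bar>1\<bar> *\<^sub>R (\<integral>z. std_normal_density (-h + 1 * z) * f ((-h + 1 * z) + h) \<partial>lborel)"
    by (rule lborel_integral_real_affine) simp
  then show ?thesis unfolding * by (simp add: integral_gauss)
qed

text \<open>The shift identity for the constant function 1 makes the Cameron-Martin density
  integrable, and \<open>exp (h * z)\<close> differs from it by a constant factor.\<close>

lemma gauss_exp_integrable: "integrable gauss (\<lambda>z. exp (h * z))"
proof -
  interpret prob_space gauss by (rule prob_space_gauss)
  have "integrable gauss (\<lambda>z. 1 * exp (h * z - h\<^sup>2 / 2))"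
    by (subst gauss_shift_integrable [symmetric]) auto
  then have "integrable gauss (\<lambda>z. exp (h\<^sup>2 / 2) * (1 * exp (h * z - h\<^sup>2 / 2)))" by (rule integrable_mult_right)
  then show ?thesis by (simp add: exp_add [symmetric])
qed

text \<open>The Cameron-Martin density has total mass 1, so no Gaussian integral has to be
  evaluated.\<close>

lemma gauss_exp_integral: "(\<integral>z. exp (h * z) \<partial>gauss) = exp (h\<^sup>2 / 2)"
proof -
  interpret prob_space gauss by (rule prob_space_gauss)
  have "(\<integral>z. 1 * exp (h * z - h\<^sup>2 / 2) \<partial>gauss) = 1"
    by (subst gauss_shift_integral [symmetric]) auto
  moreover have "exp (h * z) = exp (h\<^sup>2 / 2) * (1 * exp (h * z - h\<^sup>2 / 2))" for z
    by (simp add: exp_add [symmetric])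
  ultimately show ?thesis by simp
qed

lemma gauss_exp_abs_integrable: "integrable gauss (\<lambda>z. exp (h * \<bar>z\<bar>))"
proof (rule Bochner_Integration.integrable_bound)
  show "integrable gauss (\<lambda>z. exp (h * z) + exp (-h * z))"
    by (intro Bochner_Integration.integrable_add gauss_exp_integrable)
  show "AE z in gauss. norm (exp (h * \<bar>z\<bar>)) \<le> norm (exp (h * z) + exp (-h * z))"
  proof (intro AE_I2)
    fix z
    have "exp (h * \<bar>z\<bar>) \<le> exp (h * z) + exp (-h * z)" by (cases "z \<ge> 0") auto
    then show "norm (exp (h * \<bar>z\<bar>)) \<le> norm (exp (h * z) + exp (-h * z))" by simp
  qed
qed simp

section \<open>Functions of at most exponential growth\<close>

definition exp_bounded :: "(real \<Rightarrow> real) \<Rightarrow> bool" where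
  "exp_bounded g \<longleftrightarrow> g \<in> borel_measurable borel \<and> (\<exists>C\<ge>0. \<exists>K\<ge>0. \<forall>z. \<bar>g z\<bar> \<le> C * exp (K * \<bar>z\<bar>))"

lemma exp_boundedI:
  assumes "g \<in> borel_measurable borel" "\<And>z. \<bar>g z\<bar> \<le> C * exp (K * \<bar>z\<bar>)"
  shows "exp_bounded g"
proof -
  have "\<bar>g z\<bar> \<le> \<bar>C\<bar> * exp (\<bar>K\<bar> * \<bar>z\<bar>)" for z
  proof -
    have "C * exp (K * \<bar>z\<bar>) \<le> \<bar>C\<bar> * exp (\<bar>K\<bar> * \<bar>z\<bar>)"
      by (intro mult_mono) (auto intro!: mult_right_mono)
    then show ?thesis using assms(2) [of z] by linarith
  qed
  then show ?thesis unfolding exp_bounded_def using assms(1) abs_ge_zero by blast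
qed

text \<open>The purpose of the class: integrability against \<open>gauss\<close> reduces to the
  closure rules collected in \<open>exp_bounded_intros\<close>.\<close>

lemma exp_bounded_integrable:
  assumes "exp_bounded g" shows "integrable gauss g"
proof -
  obtain C K where g: "g \<in> borel_measurable borel" "C \<ge> 0" "\<And>z. \<bar>g z\<bar> \<le> C * exp (K * \<bar>z\<bar>)"
    using assms unfolding exp_bounded_def by blast
  show ?thesis
  proof (rule Bochner_Integration.integrable_bound)
    show "integrable gauss (\<lambda>z. C * exp (K * \<bar>z\<bar>))"
      by (intro integrable_mult_right gauss_exp_abs_integrable)
    show "AE z in gauss. norm (g z) \<le> norm (C * exp (K * \<bar>z\<bar>))" using g by (auto simp: abs_mult)
  qed (use g in simp)
qed

lemma exp_bounded_const: "exp_bounded (\<lambda>_. c)"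
  by (rule exp_boundedI [where C = "\<bar>c\<bar>" and K = 0]) auto

lemma exp_bounded_ident: "exp_bounded (\<lambda>z. z)"
proof (rule exp_boundedI [where C = 1 and K = 1])
  fix z :: real
  have "\<bar>z\<bar> \<le> exp \<bar>z\<bar>" using exp_ge_add_one_self [of "\<bar>z\<bar>"] by linarith
  then show "\<bar>z\<bar> \<le> 1 * exp (1 * \<bar>z\<bar>)" by simp
qed simp

lemma exp_bounded_abs: "exp_bounded g \<Longrightarrow> exp_bounded (\<lambda>z. \<bar>g z\<bar>)"
  unfolding exp_bounded_def by auto

lemma exp_bounded_exp: "exp_bounded (\<lambda>z. exp (h * \<bar>z\<bar>))"
  by (rule exp_boundedI [where C = 1 and K = h]) auto

lemma exp_bounded_exp': "exp_bounded (\<lambda>z. exp (h * z))"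
proof (rule exp_boundedI [where C = 1 and K = "\<bar>h\<bar>"])
  fix z :: real
  have "h * z \<le> \<bar>h\<bar> * \<bar>z\<bar>" by (metis abs_ge_self abs_mult)
  then show "\<bar>exp (h * z)\<bar> \<le> 1 * exp (\<bar>h\<bar> * \<bar>z\<bar>)" by simp
qed simp

lemma exp_bounded_mult:
  assumes "exp_bounded f" "exp_bounded g" shows "exp_bounded (\<lambda>z. f z * g z)"
proof -
  obtain C K where f: "f \<in> borel_measurable borel" "C \<ge> 0" "\<And>z. \<bar>f z\<bar> \<le> C * exp (K * \<bar>z\<bar>)"
    using assms(1) unfolding exp_bounded_def by blast
  obtain C' K' where g: "g \<in> borel_measurable borel" "C' \<ge> 0" "\<And>z. \<bar>g z\<bar> \<le> C' * exp (K' * \<bar>z\<bar>)"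
    using assms(2) unfolding exp_bounded_def by blast
  show ?thesis
  proof (rule exp_boundedI)
    show "(\<lambda>z. f z * g z) \<in> borel_measurable borel" using f g by simp
    fix z
    have "\<bar>f z * g z\<bar> \<le> (C * exp (K * \<bar>z\<bar>)) * (C' * exp (K' * \<bar>z\<bar>))"
      unfolding abs_mult using f g by (intro mult_mono) auto
    also have "\<dots> = (C * C') * exp ((K + K') * \<bar>z\<bar>)" by (simp add: exp_add algebra_simps)
    finally show "\<bar>f z * g z\<bar> \<le> (C * C') * exp ((K + K') * \<bar>z\<bar>)" .
  qed
qed

lemma exp_bounded_add:
  assumes "exp_bounded f" "exp_bounded g" shows "exp_bounded (\<lambda>z. f z + g z)"
proof -
  obtain C K where f: "f \<in> borel_measurable borel" "C \<ge> 0" "K \<ge> 0" "\<And>z. \<bar>f z\<bar> \<le> C * exp (K * \<bar>z\<bar>)"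
    using assms(1) unfolding exp_bounded_def by blast
  obtain C' K' where g: "g \<in> borel_measurable borel" "C' \<ge> 0" "K' \<ge> 0" "\<And>z. \<bar>g z\<bar> \<le> C' * exp (K' * \<bar>z\<bar>)"
    using assms(2) unfolding exp_bounded_def by blast
  show ?thesis
  proof (rule exp_boundedI)
    show "(\<lambda>z. f z + g z) \<in> borel_measurable borel" using f g by simp
    fix z
    have "C * exp (K * \<bar>z\<bar>) \<le> C * exp ((K + K') * \<bar>z\<bar>)"
      "C' * exp (K' * \<bar>z\<bar>) \<le> C' * exp ((K + K') * \<bar>z\<bar>)"
      using f g by (auto intro!: mult_left_mono mult_right_mono)
    then show "\<bar>f z + g z\<bar> \<le> (C + C') * exp ((K + K') * \<bar>z\<bar>)"
      using f(4) [of z] g(4) [of z] abs_triangle_ineq [of "f z" "g z"]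
      by (simp only: distrib_right)
  qed
qed

lemma exp_bounded_power: "exp_bounded f \<Longrightarrow> exp_bounded (\<lambda>z. f z ^ n)"
  by (induction n) (auto intro: exp_bounded_const exp_bounded_mult)

lemma exp_bounded_mono:
  assumes "exp_bounded g" "f \<in> borel_measurable borel" "\<And>z. \<bar>f z\<bar> \<le> g z"
  shows "exp_bounded f"
proof -
  obtain C K where *: "\<And>z. \<bar>g z\<bar> \<le> C * exp (K * \<bar>z\<bar>)"
    using assms(1) unfolding exp_bounded_def by blast
  have "\<bar>f z\<bar> \<le> C * exp (K * \<bar>z\<bar>)" for z using assms(3) [of z] * [of z] by linarith
  then show ?thesis using assms(2) by (rule exp_boundedI [rotated])
qed

lemmas exp_bounded_intros = exp_bounded_const exp_bounded_ident exp_bounded_abs exp_bounded_exp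
  exp_bounded_exp' exp_bounded_mult exp_bounded_add exp_bounded_power

section \<open>Differentiation and continuity under the integral sign\<close>

lemma has_derivative_under_integral:
  fixes F F' :: "real \<Rightarrow> 'a \<Rightarrow> real"
  assumes r: "r > 0"
    and d: "\<And>s z. s \<in> ball s0 r \<Longrightarrow> z \<in> space M \<Longrightarrow> ((\<lambda>s. F s z) has_real_derivative F' s z) (at s)"
    and int: "\<And>s. s \<in> ball s0 r \<Longrightarrow> integrable M (F s)"
    and meas: "F' s0 \<in> borel_measurable M"
    and bd: "\<And>s z. s \<in> ball s0 r \<Longrightarrow> z \<in> space M \<Longrightarrow> \<bar>F' s z\<bar> \<le> w z"
    and w: "integrable M w"
  shows "((\<lambda>s. \<integral>z. F s z \<partial>M) has_real_derivative (\<integral>z. F' s0 z \<partial>M)) (at s0)"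
  unfolding has_field_derivative_iff tendsto_at_iff_sequentially comp_def
proof (intro allI impI)
  fix X :: "nat \<Rightarrow> real" assume X: "\<forall>i. X i \<in> UNIV - {s0}" "X \<longlonglongrightarrow> s0"
  \<comment> \<open>Finitely many terms may lie outside the ball; dropping the first
    \<open>N\<close> keeps the whole sequence inside, and \<open>LIMSEQ_offset\<close> restores them
    at the end.\<close>
  obtain N where N: "\<And>n. n \<ge> N \<Longrightarrow> X n \<in> ball s0 r"
    using X(2) r unfolding LIMSEQ_def by (metis dist_commute mem_ball)
  define Y where "Y n = X (n + N)" for n
  have Y: "Y n \<in> ball s0 r" "Y n \<noteq> s0" for n using N X(1) by (auto simp: Y_def)
  have Yl: "Y \<longlonglongrightarrow> s0" unfolding Y_def using X(2) by (rule LIMSEQ_ignore_initial_segment)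
  have s0: "s0 \<in> ball s0 r" using r by simp
  have "(\<lambda>n. \<integral>z. (F (Y n) z - F s0 z) / (Y n - s0) \<partial>M) \<longlonglongrightarrow> (\<integral>z. F' s0 z \<partial>M)"
  proof (rule integral_dominated_convergence [where w = w])
    show "(\<lambda>z. (F (Y n) z - F s0 z) / (Y n - s0)) \<in> borel_measurable M" for n
      using int [OF Y(1)] int [OF s0] by (intro borel_measurable_divide borel_measurable_diff) auto
    show "AE z in M. (\<lambda>n. (F (Y n) z - F s0 z) / (Y n - s0)) \<longlonglongrightarrow> F' s0 z"
    proof (intro AE_I2)
      fix z assume "z \<in> space M"
      from d [OF s0 this] have "((\<lambda>y. (F y z - F s0 z) / (y - s0)) \<longlongrightarrow> F' s0 z) (at s0)"
        unfolding has_field_derivative_iff .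
      then show "(\<lambda>n. (F (Y n) z - F s0 z) / (Y n - s0)) \<longlonglongrightarrow> F' s0 z"
        using Y Yl unfolding tendsto_at_iff_sequentially comp_def by auto
    qed
    show "AE z in M. norm ((F (Y n) z - F s0 z) / (Y n - s0)) \<le> w z" for n
    proof (intro AE_I2)
      fix z assume z: "z \<in> space M"
      \<comment> \<open>The mean value inequality turns the bound on \<open>F'\<close> into one on
        the difference quotients, which is what dominated convergence needs.\<close>
      have "norm (F (Y n) z - F s0 z) \<le> w z * norm (Y n - s0)"
      proof (rule field_differentiable_bound [where f' = "\<lambda>s. F' s z" and S = "ball s0 r"])
        show "\<And>s. s \<in> ball s0 r \<Longrightarrow> ((\<lambda>s. F s z) has_field_derivative F' s z) (at s within ball s0 r)"
          using d z by (auto intro: DERIV_subset)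
        show "\<And>s. s \<in> ball s0 r \<Longrightarrow> norm (F' s z) \<le> w z" using bd z by simp
      qed (use Y s0 in auto)
      then show "norm ((F (Y n) z - F s0 z) / (Y n - s0)) \<le> w z"
        using Y(2) [of n] by (simp add: divide_simps abs_divide)
    qed
  qed (use meas w in auto)
  moreover have "(\<integral>z. (F (Y n) z - F s0 z) / (Y n - s0) \<partial>M) =
      ((\<integral>z. F (Y n) z \<partial>M) - (\<integral>z. F s0 z \<partial>M)) / (Y n - s0)" for n
    by (simp only: integral_divide_zero Bochner_Integration.integral_diff [OF int [OF Y(1)] int [OF s0]])
  ultimately have "(\<lambda>n. ((\<integral>z. F (Y n) z \<partial>M) - (\<integral>z. F s0 z \<partial>M)) / (Y n - s0))
      \<longlonglongrightarrow> (\<integral>z. F' s0 z \<partial>M)" by (simp only:)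
  then have "(\<lambda>n. ((\<integral>z. F (X (n + N)) z \<partial>M) - (\<integral>z. F s0 z \<partial>M)) / (X (n + N) - s0))
      \<longlonglongrightarrow> (\<integral>z. F' s0 z \<partial>M)" by (simp only: Y_def)
  then show "(\<lambda>n. ((\<integral>z. F (X n) z \<partial>M) - (\<integral>z. F s0 z \<partial>M)) / (X n - s0)) \<longlonglongrightarrow> (\<integral>z. F' s0 z \<partial>M)"
    by (rule LIMSEQ_offset)
qed

lemma continuous_on_under_integral:
  fixes F :: "'s::metric_space \<Rightarrow> 'a \<Rightarrow> real"
  assumes c: "\<And>z. z \<in> space M \<Longrightarrow> continuous_on S (\<lambda>s. F s z)"
    and meas: "\<And>s. s \<in> S \<Longrightarrow> F s \<in> borel_measurable M"
    and bd: "\<And>s z. s \<in> S \<Longrightarrow> z \<in> space M \<Longrightarrow> \<bar>F s z\<bar> \<le> w z"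
    and w: "integrable M w"
  shows "continuous_on S (\<lambda>s. \<integral>z. F s z \<partial>M)"
  unfolding continuous_on_sequentially comp_def
proof (intro allI ballI impI)
  fix X s assume s: "s \<in> S" and X: "(\<forall>n. X n \<in> S) \<and> X \<longlonglongrightarrow> s"
  show "(\<lambda>n. \<integral>z. F (X n) z \<partial>M) \<longlonglongrightarrow> (\<integral>z. F s z \<partial>M)"
  proof (rule integral_dominated_convergence [where w = w])
    show "AE z in M. (\<lambda>n. F (X n) z) \<longlonglongrightarrow> F s z"
      using c X s unfolding continuous_on_sequentially comp_def by (intro AE_I2) blast
    show "AE z in M. norm (F (X n) z) \<le> w z" for n using bd X by (intro AE_I2) auto
  qed (use X s meas w in auto)
qed

text \<open>Obtained by differentiating the shift identity at \<open>h = 0\<close>.\<close>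

lemma gauss_by_parts:
  fixes g g' :: "real \<Rightarrow> real"
  assumes d: "\<And>z. (g has_real_derivative g' z) (at z)"
    and g: "exp_bounded g" and g': "exp_bounded g'"
  shows "(\<integral>z. z * g z \<partial>gauss) = (\<integral>z. g' z \<partial>gauss)"
proof -
  have [measurable]: "g \<in> borel_measurable borel" "g' \<in> borel_measurable borel"
    using g g' unfolding exp_bounded_def by auto
  obtain C K where C: "C \<ge> 0" "K \<ge> 0" "\<And>z. \<bar>g z\<bar> \<le> C * exp (K * \<bar>z\<bar>)"
    using g unfolding exp_bounded_def by blast
  obtain C' K' where C': "C' \<ge> 0" "K' \<ge> 0" "\<And>z. \<bar>g' z\<bar> \<le> C' * exp (K' * \<bar>z\<bar>)"
    using g' unfolding exp_bounded_def by blast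
  \<comment> \<open>Shifts of size below 1 cost only the constant factor \<open>exp B\<close>, so
    one dominating function serves for all of them.\<close>
  have shift: "\<bar>f (z + s)\<bar> \<le> A * exp (B * \<bar>z\<bar> + B)"
    if "s \<in> ball 0 1" "A \<ge> 0" "B \<ge> 0" "\<And>z. \<bar>f z\<bar> \<le> A * exp (B * \<bar>z\<bar>)" for f :: "real \<Rightarrow> real" and A B s z
  proof -
    have "B * \<bar>z + s\<bar> \<le> B * (\<bar>z\<bar> + 1)" using that by (intro mult_left_mono) auto
    then have "A * exp (B * \<bar>z + s\<bar>) \<le> A * exp (B * \<bar>z\<bar> + B)"
      using that by (intro mult_left_mono) (auto simp: algebra_simps)
    then show ?thesis using that(4) [of "z + s"] by linarith
  qed
  have int_shift: "integrable gauss (\<lambda>z. g (z + s))" if "s \<in> ball 0 1" for s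
  proof (rule exp_bounded_integrable, rule exp_boundedI)
    fix z show "\<bar>g (z + s)\<bar> \<le> (C * exp K) * exp (K * \<bar>z\<bar>)"
      using shift [OF that C, of z] by (simp add: exp_add mult_ac)
  qed simp
  have 1: "((\<lambda>s. \<integral>z. g (z + s) \<partial>gauss) has_real_derivative (\<integral>z. g' (z + 0) \<partial>gauss)) (at 0)"
  proof (rule has_derivative_under_integral [where r = 1 and w = "\<lambda>z. C' * exp K' * exp (K' * \<bar>z\<bar>)"])
    fix s z :: real assume s: "s \<in> ball 0 1"
    show "((\<lambda>s. g (z + s)) has_real_derivative g' (z + s)) (at s)"
      using DERIV_shift [of g "g' (z + s)" s z] d [of "z + s"] by (simp add: add.commute)
    show "\<bar>g' (z + s)\<bar> \<le> C' * exp K' * exp (K' * \<bar>z\<bar>)"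
      using shift [OF s C', of z] by (simp add: exp_add mult_ac)
  next
    show "integrable gauss (\<lambda>z. C' * exp K' * exp (K' * \<bar>z\<bar>))"
      by (intro integrable_mult_right gauss_exp_abs_integrable)
  qed (use int_shift in simp_all)
  have ebd: "\<bar>exp (s * z - s\<^sup>2 / 2)\<bar> \<le> exp \<bar>z\<bar>" if "s \<in> ball 0 1" for s z :: real
  proof -
    have "s * z \<le> \<bar>s\<bar> * \<bar>z\<bar>" by (metis abs_ge_self abs_mult)
    also have "\<dots> \<le> 1 * \<bar>z\<bar>" using that by (intro mult_right_mono) auto
    finally have "s * z - s\<^sup>2 / 2 \<le> \<bar>z\<bar>" using zero_le_power2 [of s] by linarith
    then show ?thesis by simp
  qed
  have 2: "((\<lambda>s. \<integral>z. g z * exp (s * z - s\<^sup>2 / 2) \<partial>gauss) has_real_derivative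
      (\<integral>z. g z * (exp (0 * z - 0\<^sup>2 / 2) * (z - 0)) \<partial>gauss)) (at 0)"
  proof (rule has_derivative_under_integral [where r = 1 and w = "\<lambda>z. \<bar>g z\<bar> * (exp (1 * \<bar>z\<bar>) * (\<bar>z\<bar> + 1))"])
    fix s z :: real assume s: "s \<in> ball 0 1"
    show "((\<lambda>s. g z * exp (s * z - s\<^sup>2 / 2)) has_real_derivative g z * (exp (s * z - s\<^sup>2 / 2) * (z - s))) (at s)"
      by (auto intro!: derivative_eq_intros)
    have "\<bar>z - s\<bar> \<le> \<bar>z\<bar> + 1" using s by auto
    then show "\<bar>g z * (exp (s * z - s\<^sup>2 / 2) * (z - s))\<bar> \<le> \<bar>g z\<bar> * (exp (1 * \<bar>z\<bar>) * (\<bar>z\<bar> + 1))"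
      unfolding abs_mult using ebd [OF s, of z] by (intro mult_mono) auto
  next
    fix s :: real assume "s \<in> ball 0 1"
    then show "integrable gauss (\<lambda>z. g z * exp (s * z - s\<^sup>2 / 2))"
      using gauss_shift_integrable [of g s] int_shift by simp
  next
    show "integrable gauss (\<lambda>z. \<bar>g z\<bar> * (exp (1 * \<bar>z\<bar>) * (\<bar>z\<bar> + 1)))"
      by (intro exp_bounded_integrable exp_bounded_intros g)
  qed simp_all
  have eq: "(\<lambda>s. \<integral>z. g (z + s) \<partial>gauss) = (\<lambda>s. \<integral>z. g z * exp (s * z - s\<^sup>2 / 2) \<partial>gauss)"
    by (intro ext gauss_shift_integral) simp
  show ?thesis using DERIV_unique [OF 1 [unfolded eq] 2] by (simp add: mult.commute)
qed

section \<open>Geometric Brownian motion\<close>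

definition poly_bounded :: "(real \<Rightarrow> real) \<Rightarrow> bool" where
  "poly_bounded f \<longleftrightarrow> (\<exists>C\<ge>0. \<exists>N. \<forall>x. \<bar>f x\<bar> \<le> C * (1 + \<bar>x\<bar>) ^ N)"

text \<open>Recursion on the order through \<open>deriv\<close> makes closure under sums and
  products an induction. Bounding every derivative, and not just the function, provides the
  dominating functions for differentiation under the Gaussian integral.\<close>

primrec tame_upto :: "nat \<Rightarrow> (real \<Rightarrow> real) \<Rightarrow> bool" where
  "tame_upto 0 f \<longleftrightarrow> poly_bounded f"
| "tame_upto (Suc n) f \<longleftrightarrow> poly_bounded f \<and> (\<forall>x. f differentiable at x) \<and> tame_upto n (deriv f)"

definition tame :: "(real \<Rightarrow> real) \<Rightarrow> bool" where
  "tame f \<longleftrightarrow> (\<forall>n. tame_upto n f)"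

text \<open>Nonnegativity of \<open>C\<close> follows from the bound at
  \<open>x = 0\<close>.\<close>

lemma poly_boundedI: "(\<And>x. \<bar>f x\<bar> \<le> C * (1 + \<bar>x\<bar>) ^ N) \<Longrightarrow> poly_bounded f"
proof -
  assume *: "\<And>x. \<bar>f x\<bar> \<le> C * (1 + \<bar>x\<bar>) ^ N"
  have "\<bar>f 0\<bar> \<le> C" using * [of 0] by simp
  then show ?thesis using * unfolding poly_bounded_def by (intro exI [of _ C]) auto
qed

lemma poly_bounded_add:
  assumes "poly_bounded f" "poly_bounded g" shows "poly_bounded (\<lambda>x. f x + g x)"
proof -
  obtain C N C' N' where C: "C \<ge> 0" "C' \<ge> 0"
    and *: "\<And>x. \<bar>f x\<bar> \<le> C * (1 + \<bar>x\<bar>) ^ N" "\<And>x. \<bar>g x\<bar> \<le> C' * (1 + \<bar>x\<bar>) ^ N'"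
    using assms unfolding poly_bounded_def by metis
  show ?thesis
  proof (rule poly_boundedI)
    fix x :: real
    have "C * (1 + \<bar>x\<bar>) ^ N \<le> C * (1 + \<bar>x\<bar>) ^ (N + N')" "C' * (1 + \<bar>x\<bar>) ^ N' \<le> C' * (1 + \<bar>x\<bar>) ^ (N + N')"
      using C by (auto intro!: mult_left_mono power_increasing)
    then show "\<bar>f x + g x\<bar> \<le> (C + C') * (1 + \<bar>x\<bar>) ^ (N + N')"
      using *(1) [of x] *(2) [of x] abs_triangle_ineq [of "f x" "g x"] by (simp only: distrib_right)
  qed
qed

lemma poly_bounded_mult:
  assumes "poly_bounded f" "poly_bounded g" shows "poly_bounded (\<lambda>x. f x * g x)"
proof -
  obtain C N C' N' where C: "C \<ge> 0" "C' \<ge> 0"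
    and *: "\<And>x. \<bar>f x\<bar> \<le> C * (1 + \<bar>x\<bar>) ^ N" "\<And>x. \<bar>g x\<bar> \<le> C' * (1 + \<bar>x\<bar>) ^ N'"
    using assms unfolding poly_bounded_def by metis
  show ?thesis
  proof (rule poly_boundedI)
    fix x :: real
    have "\<bar>f x * g x\<bar> \<le> (C * (1 + \<bar>x\<bar>) ^ N) * (C' * (1 + \<bar>x\<bar>) ^ N')"
      unfolding abs_mult using * C by (intro mult_mono) auto
    then show "\<bar>f x * g x\<bar> \<le> (C * C') * (1 + \<bar>x\<bar>) ^ (N + N')" by (simp add: power_add mult_ac)
  qed
qed

lemma poly_bounded_bounded: "(\<And>x. \<bar>f x\<bar> \<le> C) \<Longrightarrow> poly_bounded f"
  by (rule poly_boundedI [where C = C and N = 0]) auto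

lemma poly_bounded_ident: "poly_bounded (\<lambda>x. x)"
  by (rule poly_boundedI [where C = 1 and N = 1]) auto

lemma tame_upto_poly_bounded: "tame_upto n f \<Longrightarrow> poly_bounded f"
  by (cases n) auto

lemma tame_upto_Suc: "tame_upto (Suc n) f \<Longrightarrow> tame_upto n f"
  by (induction n arbitrary: f) auto

lemma tame_upto_const: "tame_upto n (\<lambda>_. c)"
  by (induction n arbitrary: c) (auto intro: poly_bounded_bounded [where C = "\<bar>c\<bar>" for c])

lemma tame_upto_ident: "tame_upto n (\<lambda>x. x)"
proof (cases n)
  case (Suc m)
  have "deriv (\<lambda>x::real. x) = (\<lambda>_. 1)" by auto
  then show ?thesis using Suc tame_upto_const by (auto simp: poly_bounded_ident)
qed (auto simp: poly_bounded_ident)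

lemma tame_upto_add: "tame_upto n f \<Longrightarrow> tame_upto n g \<Longrightarrow> tame_upto n (\<lambda>x. f x + g x)"
proof (induction n arbitrary: f g)
  case (Suc n)
  have "deriv (\<lambda>x. f x + g x) = (\<lambda>x. deriv f x + deriv g x)"
    using Suc.prems by (auto simp: fun_eq_iff field_differentiable_def real_differentiable_def intro!: deriv_add)
  then show ?case using Suc by (auto simp: poly_bounded_add)
qed (auto simp: poly_bounded_add)

lemma tame_upto_mult: "tame_upto n f \<Longrightarrow> tame_upto n g \<Longrightarrow> tame_upto n (\<lambda>x. f x * g x)"
proof (induction n arbitrary: f g)
  case (Suc n)
  have "deriv (\<lambda>x. f x * g x) = (\<lambda>x. f x * deriv g x + deriv f x * g x)"
    using Suc.prems by (auto simp: fun_eq_iff field_differentiable_def real_differentiable_def intro!: deriv_mult)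
  moreover have "tame_upto n (\<lambda>x. f x * deriv g x + deriv f x * g x)"
    using Suc tame_upto_Suc by (intro tame_upto_add Suc.IH) auto
  ultimately show ?case using Suc.prems by (auto simp: poly_bounded_mult)
qed (auto simp: poly_bounded_mult)

lemma tame_poly_bounded: "tame f \<Longrightarrow> poly_bounded f"
  unfolding tame_def using tame_upto_poly_bounded by blast

lemma tame_deriv: "tame f \<Longrightarrow> tame (deriv f)"
  unfolding tame_def using tame_upto.simps(2) by blast

lemma tame_DERIV: "tame f \<Longrightarrow> (f has_real_derivative deriv f x) (at x)"
proof -
  assume "tame f"
  then have "tame_upto 1 f" unfolding tame_def by blast
  then show ?thesis
    by (auto simp: real_differentiable_def dest!: spec [of _ x] dest: DERIV_imp_deriv)
qed

lemma tame_continuous: "tame f \<Longrightarrow> continuous_on S f"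
  by (rule continuous_at_imp_continuous_on) (use tame_DERIV DERIV_isCont in blast)

lemma tame_measurable: "tame f \<Longrightarrow> f \<in> borel_measurable borel"
  by (intro borel_measurable_continuous_onI tame_continuous)

lemma tame_const: "tame (\<lambda>_. c)"
  and tame_ident: "tame (\<lambda>x. x)"
  and tame_add: "tame f \<Longrightarrow> tame g \<Longrightarrow> tame (\<lambda>x. f x + g x)"
  and tame_mult: "tame f \<Longrightarrow> tame g \<Longrightarrow> tame (\<lambda>x. f x * g x)"
  unfolding tame_def by (auto intro: tame_upto_const tame_upto_ident tame_upto_add tame_upto_mult)

lemma tame_power: "tame f \<Longrightarrow> tame (\<lambda>x. f x ^ n)"
  by (induction n) (auto intro: tame_const tame_mult)

text \<open>The derivative is a polynomial in x and the function itself, so the induction on the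
  order closes.\<close>

lemma tame_upto_inverse_quadratic: "tame_upto n (\<lambda>x. inverse (1 + x\<^sup>2))"
proof (induction n)
  case 0
  show ?case by (auto intro!: poly_bounded_bounded [where C = 1] simp: inverse_le_1_iff)
next
  case (Suc n)
  have D: "((\<lambda>x. inverse (1 + x\<^sup>2)) has_real_derivative - 2 * (x * (inverse (1 + x\<^sup>2) * inverse (1 + x\<^sup>2)))) (at x)" for x :: real
  proof -
    have "1 + x\<^sup>2 \<noteq> 0" by (metis add.commute power_one sum_power2_eq_zero_iff zero_neq_one)
    then show ?thesis by (auto intro!: derivative_eq_intros)
  qed
  then have "deriv (\<lambda>x::real. inverse (1 + x\<^sup>2)) = (\<lambda>x. - 2 * (x * (inverse (1 + x\<^sup>2) * inverse (1 + x\<^sup>2))))"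
    by (auto simp: fun_eq_iff intro!: DERIV_imp_deriv)
  moreover have "tame_upto n (\<lambda>x. - 2 * (x * (inverse (1 + x\<^sup>2) * inverse (1 + x\<^sup>2))))"
    by (intro tame_upto_mult tame_upto_const tame_upto_ident Suc)
  moreover have "(\<lambda>x::real. inverse (1 + x\<^sup>2)) differentiable at x" for x
    using D real_differentiable_def by blast
  ultimately show ?case
    using tame_upto_poly_bounded [OF Suc] by simp
qed

text \<open>Supplies the bounded injective function of one coordinate by which R^d is mapped into a
  compact cube.\<close>

lemma tame_arctan: "tame arctan"
  unfolding tame_def
proof
  fix n
  have 0: "poly_bounded arctan"
  proof (rule poly_bounded_bounded)
    show "\<bar>arctan x\<bar> \<le> pi / 2" for x using arctan_bounded [of x] by auto
  qed
  show "tame_upto n arctan"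
  proof (cases n)
    case (Suc m)
    have "deriv arctan = (\<lambda>x. inverse (1 + x\<^sup>2))"
      by (auto simp: fun_eq_iff intro!: DERIV_imp_deriv DERIV_arctan)
    moreover have "arctan differentiable at x" for x
      using DERIV_arctan real_differentiable_def by blast
    ultimately show ?thesis using 0 tame_upto_inverse_quadratic Suc by auto
  qed (use 0 in simp)
qed

lemma exp_bounded_affine:
  assumes "exp_bounded G" shows "exp_bounded (\<lambda>z. G (c + k * z))"
proof -
  obtain C K where [measurable]: "G \<in> borel_measurable borel" and C: "C \<ge> 0" "K \<ge> 0" "\<And>z. \<bar>G z\<bar> \<le> C * exp (K * \<bar>z\<bar>)"
    using assms unfolding exp_bounded_def by blast
  show ?thesis
  proof (rule exp_boundedI)
    fix z
    have "\<bar>c + k * z\<bar> \<le> \<bar>c\<bar> + \<bar>k\<bar> * \<bar>z\<bar>" by (metis abs_mult abs_triangle_ineq)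
    then have "K * \<bar>c + k * z\<bar> \<le> K * (\<bar>c\<bar> + \<bar>k\<bar> * \<bar>z\<bar>)" by (intro mult_left_mono C)
    then have "C * exp (K * \<bar>c + k * z\<bar>) \<le> C * exp (K * (\<bar>c\<bar> + \<bar>k\<bar> * \<bar>z\<bar>))"
      by (intro mult_left_mono C) simp
    also have "\<dots> = (C * exp (K * \<bar>c\<bar>)) * exp ((K * \<bar>k\<bar>) * \<bar>z\<bar>)"
      by (simp add: exp_add algebra_simps)
    finally show "\<bar>G (c + k * z)\<bar> \<le> (C * exp (K * \<bar>c\<bar>)) * exp ((K * \<bar>k\<bar>) * \<bar>z\<bar>)"
      using C(3) [of "c + k * z"] by linarith
  qed simp
qed

text \<open>Polynomial growth in the state becomes exponential growth in its logarithm, where the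
  noise is Gaussian.\<close>

lemma exp_bounded_poly_bounded_exp:
  assumes "poly_bounded f" and [measurable]: "f \<in> borel_measurable borel"
  shows "exp_bounded (\<lambda>s. f (x * exp s))"
proof -
  obtain C N where C: "C \<ge> 0" "\<And>x. \<bar>f x\<bar> \<le> C * (1 + \<bar>x\<bar>) ^ N"
    using assms unfolding poly_bounded_def by blast
  have "exp_bounded (\<lambda>s. C * (1 + \<bar>x\<bar> * exp (1 * s)) ^ N)" by (intro exp_bounded_intros)
  then show ?thesis
  proof (rule exp_bounded_mono)
    show "\<bar>f (x * exp z)\<bar> \<le> C * (1 + \<bar>x\<bar> * exp (1 * z)) ^ N" for z
      using C(2) [of "x * exp z"] by (simp add: abs_mult)
  qed simp
qed

lemma exp_bounded_measurable: "exp_bounded g \<Longrightarrow> g \<in> borel_measurable gauss"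
  unfolding exp_bounded_def by (simp add: measurable_cong_sets [OF sets_gauss refl])

text \<open>The time derivative of \<open>sqrt \<tau>\<close> brings in
  \<open>\<beta> * z / (2 * sqrt \<tau>)\<close> times \<open>G1\<close>. Integration by parts
  trades the factor \<open>z\<close> for \<open>\<beta> * sqrt \<tau>\<close> times
  \<open>G2\<close>; the roots cancel, and the generator of Brownian motion with drift
  remains.\<close>

lemma heat_derivative:
  fixes G G1 G2 :: "real \<Rightarrow> real"
  assumes D: "\<And>s. (G has_real_derivative G1 s) (at s)" "\<And>s. (G1 has_real_derivative G2 s) (at s)"
    and E: "exp_bounded G" "exp_bounded G1" "exp_bounded G2" and \<tau>: "\<tau> > 0"
  shows "((\<lambda>\<tau>. \<integral>z. G (b * \<tau> + \<beta> * sqrt \<tau> * z) \<partial>gauss) has_real_derivative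
    b * (\<integral>z. G1 (b * \<tau> + \<beta> * sqrt \<tau> * z) \<partial>gauss) + \<beta>\<^sup>2 / 2 * (\<integral>z. G2 (b * \<tau> + \<beta> * sqrt \<tau> * z) \<partial>gauss)) (at \<tau>)"
proof -
  obtain C K where C: "C \<ge> 0" "K \<ge> 0" "\<And>z. \<bar>G1 z\<bar> \<le> C * exp (K * \<bar>z\<bar>)"
    using E(2) unfolding exp_bounded_def by blast
  note aff = exp_bounded_affine [OF E(1)] exp_bounded_affine [OF E(2)] exp_bounded_affine [OF E(3)]
  \<comment> \<open>On the ball of radius \<open>\<tau> / 2\<close> one has \<tau>/2 < s < 2\<tau>:
    the upper end bounds \<open>sqrt s\<close> in the exponent, the lower end bounds
    \<open>1 / sqrt s\<close>.\<close>
  let ?w = "\<lambda>z. C * (exp (K * (\<bar>b\<bar> * (2 * \<tau>))) * exp (K * (\<bar>\<beta>\<bar> * sqrt (2 * \<tau>)) * \<bar>z\<bar>)) * (\<bar>b\<bar> + \<bar>\<beta>\<bar> * \<bar>z\<bar> * (1 / (2 * sqrt (\<tau> / 2))))"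
  have ball: "\<tau> / 2 < s" "s < 2 * \<tau>" if "s \<in> ball \<tau> (\<tau> / 2)" for s
  proof -
    have "\<bar>\<tau> - s\<bar> < \<tau> / 2" using that by (simp only: mem_ball dist_real_def)
    then show "\<tau> / 2 < s" "s < 2 * \<tau>" using \<tau> by linarith+
  qed
  have main: "((\<lambda>\<tau>. \<integral>z. G (b * \<tau> + \<beta> * sqrt \<tau> * z) \<partial>gauss) has_real_derivative
    (\<integral>z. G1 (b * \<tau> + \<beta> * sqrt \<tau> * z) * (b + \<beta> * z * (1 / (2 * sqrt \<tau>))) \<partial>gauss)) (at \<tau>)"
  proof (rule has_derivative_under_integral [where r = "\<tau> / 2" and w = ?w])
    fix s z assume s: "s \<in> ball \<tau> (\<tau> / 2)"
    note s2 = ball [OF s]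
    have "((\<lambda>s. b * s + \<beta> * sqrt s * z) has_real_derivative (b + \<beta> * z * (1 / (2 * sqrt s)))) (at s)"
      using s2 \<tau> by (auto intro!: derivative_eq_intros simp: field_simps)
    from DERIV_chain2 [OF D(1) this]
    show "((\<lambda>s. G (b * s + \<beta> * sqrt s * z)) has_real_derivative G1 (b * s + \<beta> * sqrt s * z) * (b + \<beta> * z * (1 / (2 * sqrt s)))) (at s)" .
    have 1: "\<bar>b * s + \<beta> * sqrt s * z\<bar> \<le> \<bar>b\<bar> * (2 * \<tau>) + \<bar>\<beta>\<bar> * sqrt (2 * \<tau>) * \<bar>z\<bar>"
    proof -
      have "\<bar>b * s + \<beta> * sqrt s * z\<bar> \<le> \<bar>b\<bar> * \<bar>s\<bar> + \<bar>\<beta>\<bar> * \<bar>sqrt s\<bar> * \<bar>z\<bar>" by (metis abs_mult abs_triangle_ineq)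
      also have "\<dots> \<le> \<bar>b\<bar> * (2 * \<tau>) + \<bar>\<beta>\<bar> * sqrt (2 * \<tau>) * \<bar>z\<bar>"
        using s2 \<tau> by (intro add_mono mult_left_mono mult_right_mono) auto
      finally show ?thesis .
    qed
    have "\<bar>G1 (b * s + \<beta> * sqrt s * z)\<bar> \<le> C * exp (K * \<bar>b * s + \<beta> * sqrt s * z\<bar>)" by (rule C)
    also have "\<dots> \<le> C * exp (K * (\<bar>b\<bar> * (2 * \<tau>) + \<bar>\<beta>\<bar> * sqrt (2 * \<tau>) * \<bar>z\<bar>))"
      using mult_left_mono [OF 1 C(2)] by (intro mult_left_mono C) simp
    also have "\<dots> = C * (exp (K * (\<bar>b\<bar> * (2 * \<tau>))) * exp (K * (\<bar>\<beta>\<bar> * sqrt (2 * \<tau>)) * \<bar>z\<bar>))"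
      by (simp add: exp_add [symmetric] algebra_simps)
    finally have 2: "\<bar>G1 (b * s + \<beta> * sqrt s * z)\<bar> \<le> \<dots>" .
    have "\<bar>\<beta> * z * (1 / (2 * sqrt s))\<bar> = \<bar>\<beta>\<bar> * \<bar>z\<bar> * (1 / (2 * sqrt s))" using s2 \<tau> by (simp add: abs_mult)
    also have "\<dots> \<le> \<bar>\<beta>\<bar> * \<bar>z\<bar> * (1 / (2 * sqrt (\<tau> / 2)))"
      using s2 \<tau> by (intro mult_left_mono divide_left_mono) (auto intro!: mult_pos_pos)
    finally have 3: "\<bar>b + \<beta> * z * (1 / (2 * sqrt s))\<bar> \<le> \<bar>b\<bar> + \<bar>\<beta>\<bar> * \<bar>z\<bar> * (1 / (2 * sqrt (\<tau> / 2)))" by linarith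
    show "\<bar>G1 (b * s + \<beta> * sqrt s * z) * (b + \<beta> * z * (1 / (2 * sqrt s)))\<bar> \<le> ?w z"
      unfolding abs_mult by (rule mult_mono [OF 2 3]) (use C in auto)
  next
    show "integrable gauss ?w" by (intro exp_bounded_integrable exp_bounded_intros)
  next
    show "integrable gauss (\<lambda>z. G (b * s + \<beta> * sqrt s * z))" for s
      by (intro exp_bounded_integrable aff)
  next
    have "exp_bounded (\<lambda>z. G1 (b * \<tau> + \<beta> * sqrt \<tau> * z) * (b + \<beta> * z * (1 / (2 * sqrt \<tau>))))"
      by (intro exp_bounded_intros aff)
    then show "(\<lambda>z. G1 (b * \<tau> + \<beta> * sqrt \<tau> * z) * (b + \<beta> * z * (1 / (2 * sqrt \<tau>)))) \<in> borel_measurable gauss"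
      by (rule exp_bounded_measurable)
  qed (use \<tau> in auto)
  have parts: "(\<integral>z. z * G1 (b * \<tau> + \<beta> * sqrt \<tau> * z) \<partial>gauss) = (\<integral>z. G2 (b * \<tau> + \<beta> * sqrt \<tau> * z) * (\<beta> * sqrt \<tau>) \<partial>gauss)"
  proof (rule gauss_by_parts)
    fix z
    have "((\<lambda>z. b * \<tau> + \<beta> * sqrt \<tau> * z) has_real_derivative \<beta> * sqrt \<tau>) (at z)"
      by (auto intro!: derivative_eq_intros)
    from DERIV_chain2 [OF D(2) this]
    show "((\<lambda>z. G1 (b * \<tau> + \<beta> * sqrt \<tau> * z)) has_real_derivative G2 (b * \<tau> + \<beta> * sqrt \<tau> * z) * (\<beta> * sqrt \<tau>)) (at z)" .
  qed (intro exp_bounded_intros aff)+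
  have "(\<integral>z. G1 (b * \<tau> + \<beta> * sqrt \<tau> * z) * (b + \<beta> * z * (1 / (2 * sqrt \<tau>))) \<partial>gauss) =
    (\<integral>z. b * G1 (b * \<tau> + \<beta> * sqrt \<tau> * z) + (\<beta> / (2 * sqrt \<tau>)) * (z * G1 (b * \<tau> + \<beta> * sqrt \<tau> * z)) \<partial>gauss)"
    by (intro Bochner_Integration.integral_cong refl) (simp add: algebra_simps)
  also have "\<dots> = b * (\<integral>z. G1 (b * \<tau> + \<beta> * sqrt \<tau> * z) \<partial>gauss) + (\<beta> / (2 * sqrt \<tau>)) * (\<integral>z. z * G1 (b * \<tau> + \<beta> * sqrt \<tau> * z) \<partial>gauss)"
    by (subst Bochner_Integration.integral_add, intro integrable_mult_right exp_bounded_integrable aff,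
      intro integrable_mult_right exp_bounded_integrable exp_bounded_intros aff, simp)
  also have "\<dots> = b * (\<integral>z. G1 (b * \<tau> + \<beta> * sqrt \<tau> * z) \<partial>gauss) + \<beta>\<^sup>2 / 2 * (\<integral>z. G2 (b * \<tau> + \<beta> * sqrt \<tau> * z) \<partial>gauss)"
    unfolding parts using \<tau> by (simp add: power2_eq_square field_simps)
  finally show ?thesis using main by simp
qed

section \<open>The lognormal factor and its expectations\<close>

definition geo :: "real \<Rightarrow> real \<Rightarrow> real \<Rightarrow> real \<Rightarrow> real" where
  "geo \<alpha> \<beta> \<tau> z = exp ((\<alpha> - \<beta>\<^sup>2 / 2) * \<tau> + \<beta> * sqrt \<tau> * z)"

text \<open>The power \<open>m\<close> closes the family under differentiation: each derivative in x
  of \<open>f (x * geo \<alpha> \<beta> \<tau> z)\<close> releases one more factor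
  \<open>geo\<close>.\<close>

definition geo_mean :: "real \<Rightarrow> real \<Rightarrow> (real \<Rightarrow> real) \<Rightarrow> nat \<Rightarrow> real \<Rightarrow> real \<Rightarrow> real" where
  "geo_mean \<alpha> \<beta> f m \<tau> x = (\<integral>z. f (x * geo \<alpha> \<beta> \<tau> z) * geo \<alpha> \<beta> \<tau> z ^ m \<partial>gauss)"

lemma geo_pos [simp]: "geo \<alpha> \<beta> \<tau> z > 0" "geo \<alpha> \<beta> \<tau> z \<ge> 0"
  by (simp_all add: geo_def)

lemma geo_measurable [measurable]: "geo \<alpha> \<beta> \<tau> \<in> borel_measurable borel"
  unfolding geo_def by measurable

lemma exp_bounded_geo:
  assumes "tame f"
  shows "exp_bounded (\<lambda>z. f (x * geo \<alpha> \<beta> \<tau> z) * geo \<alpha> \<beta> \<tau> z ^ m)"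
proof -
  have "exp_bounded (\<lambda>s. f (x * exp s) * exp (1 * s) ^ m)"
    by (intro exp_bounded_intros exp_bounded_poly_bounded_exp tame_poly_bounded tame_measurable assms)
  from exp_bounded_affine [OF this] show ?thesis unfolding geo_def by simp
qed

text \<open>\<open>heat_derivative\<close> in the logarithmic variable, with the Ito-corrected drift
  \<open>\<alpha> - \<beta>\<^sup>2 / 2\<close>. The right side consists of \<open>geo_mean\<close>
  terms again, so time derivatives can be iterated.\<close>

lemma geo_mean_time_derivative:
  assumes f: "tame f" and \<tau>: "\<tau> > 0"
  shows "((\<lambda>\<tau>. geo_mean \<alpha> \<beta> f m \<tau> x) has_real_derivative
    (\<alpha> - \<beta>\<^sup>2 / 2) * (x * geo_mean \<alpha> \<beta> (deriv f) (m + 1) \<tau> x + m * geo_mean \<alpha> \<beta> f m \<tau> x) +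
    \<beta>\<^sup>2 / 2 * (x\<^sup>2 * geo_mean \<alpha> \<beta> (deriv (deriv f)) (m + 2) \<tau> x + (2 * m + 1) * x * geo_mean \<alpha> \<beta> (deriv f) (m + 1) \<tau> x
      + m\<^sup>2 * geo_mean \<alpha> \<beta> f m \<tau> x)) (at \<tau>)"
proof -
  let ?f1 = "deriv f" and ?f2 = "deriv (deriv f)"
  \<comment> \<open>The factor \<open>1 * s\<close> keeps the exponential in the shape
    \<open>exp (h * z)\<close> of the closure rule \<open>exp_bounded_exp'\<close>.\<close>
  define G where "G s = f (x * exp s) * exp (1 * s) ^ m" for s
  define G1 where "G1 s = x * (?f1 (x * exp s) * exp (1 * s) ^ (m + 1)) + m * (f (x * exp s) * exp (1 * s) ^ m)" for s
  define G2 where "G2 s = x\<^sup>2 * (?f2 (x * exp s) * exp (1 * s) ^ (m + 2)) + (2 * m + 1) * x * (?f1 (x * exp s) * exp (1 * s) ^ (m + 1))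
      + m\<^sup>2 * (f (x * exp s) * exp (1 * s) ^ m)" for s
  have t: "tame ?f1" "tame ?f2" using f tame_deriv by auto
  note eb = exp_bounded_poly_bounded_exp [OF tame_poly_bounded tame_measurable]
  have E: "exp_bounded G" "exp_bounded G1" "exp_bounded G2"
    unfolding G_def G1_def G2_def by (intro exp_bounded_intros eb f t)+
  have ch: "((\<lambda>s. g (x * exp s)) has_real_derivative deriv g (x * exp s) * (x * exp s)) (at s)" if "tame g" for g s
  proof -
    have "((\<lambda>s. x * exp s) has_real_derivative x * exp s) (at s)" by (auto intro!: derivative_eq_intros)
    from DERIV_chain2 [OF tame_DERIV [OF that] this] show ?thesis .
  qed
  have ex: "((\<lambda>s. exp (1 * s) ^ k) has_real_derivative k * exp (1 * s) ^ k) (at s)" for k :: nat and s :: real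
    by (auto intro!: derivative_eq_intros simp: exp_of_nat_mult [symmetric])
  have D1: "(G has_real_derivative G1 s) (at s)" for s
    unfolding G_def [abs_def]
    by (rule DERIV_cong [OF DERIV_mult [OF ch [OF f] ex]]) (simp add: G1_def algebra_simps)
  have D2: "(G1 has_real_derivative G2 s) (at s)" for s
    unfolding G1_def [abs_def]
    by (rule DERIV_cong [OF DERIV_add [OF DERIV_cmult [OF DERIV_mult [OF ch [OF t(1)] ex]] DERIV_cmult [OF DERIV_mult [OF ch [OF f] ex]]]])
      (simp add: G2_def algebra_simps power2_eq_square)
  let ?s = "\<lambda>\<tau> z. (\<alpha> - \<beta>\<^sup>2 / 2) * \<tau> + \<beta> * sqrt \<tau> * z"
  note int = exp_bounded_integrable [OF exp_bounded_geo [OF f, of x \<alpha> \<beta> \<tau>]]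
    exp_bounded_integrable [OF exp_bounded_geo [OF t(1), of x \<alpha> \<beta> \<tau>]] exp_bounded_integrable [OF exp_bounded_geo [OF t(2), of x \<alpha> \<beta> \<tau>]]
  have I0: "(\<integral>z. G (?s \<tau> z) \<partial>gauss) = geo_mean \<alpha> \<beta> f m \<tau> x" for \<tau>
    by (simp add: G_def geo_mean_def geo_def)
  have "(\<integral>z. G1 (?s \<tau> z) \<partial>gauss) = (\<integral>z. x * (?f1 (x * geo \<alpha> \<beta> \<tau> z) * geo \<alpha> \<beta> \<tau> z ^ (m + 1)) + m * (f (x * geo \<alpha> \<beta> \<tau> z) * geo \<alpha> \<beta> \<tau> z ^ m) \<partial>gauss)"
    by (simp add: G1_def geo_def)
  also have "\<dots> = x * geo_mean \<alpha> \<beta> ?f1 (m + 1) \<tau> x + m * geo_mean \<alpha> \<beta> f m \<tau> x"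
    unfolding geo_mean_def by (subst Bochner_Integration.integral_add) (intro integrable_mult_right int | simp)+
  finally have I1: "(\<integral>z. G1 (?s \<tau> z) \<partial>gauss) = \<dots>" .
  have "(\<integral>z. G2 (?s \<tau> z) \<partial>gauss) = (\<integral>z. x\<^sup>2 * (?f2 (x * geo \<alpha> \<beta> \<tau> z) * geo \<alpha> \<beta> \<tau> z ^ (m + 2)) + (2 * m + 1) * x * (?f1 (x * geo \<alpha> \<beta> \<tau> z) * geo \<alpha> \<beta> \<tau> z ^ (m + 1)) + m\<^sup>2 * (f (x * geo \<alpha> \<beta> \<tau> z) * geo \<alpha> \<beta> \<tau> z ^ m) \<partial>gauss)"
    by (simp add: G2_def geo_def)
  also have "\<dots> = x\<^sup>2 * geo_mean \<alpha> \<beta> ?f2 (m + 2) \<tau> x + (2 * m + 1) * x * geo_mean \<alpha> \<beta> ?f1 (m + 1) \<tau> x + m\<^sup>2 * geo_mean \<alpha> \<beta> f m \<tau> x"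
    unfolding geo_mean_def
    by (subst Bochner_Integration.integral_add, intro Bochner_Integration.integrable_add integrable_mult_right int, intro integrable_mult_right int)
      (subst Bochner_Integration.integral_add, intro integrable_mult_right int, intro integrable_mult_right int, simp)
  finally have I2: "(\<integral>z. G2 (?s \<tau> z) \<partial>gauss) = \<dots>" .
  show ?thesis using heat_derivative [OF D1 D2 E \<tau>, of "\<alpha> - \<beta>\<^sup>2 / 2" \<beta>] unfolding I0 I1 I2 by (simp add: add.commute)
qed

text \<open>A majorant of \<open>1 + geo\<close> uniform in times up to \<open>T\<close>. Its powers
  remain integrable, and being at least 1 it can be raised to higher powers freely.\<close>

definition geo_bound :: "real \<Rightarrow> real \<Rightarrow> real \<Rightarrow> real \<Rightarrow> real" where
  "geo_bound \<alpha> \<beta> T z = 1 + exp (\<bar>\<alpha> - \<beta>\<^sup>2 / 2\<bar> * T) * exp (\<bar>\<beta>\<bar> * sqrt T * \<bar>z\<bar>)"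

lemma geo_le_geo_bound:
  assumes "0 \<le> \<tau>" "\<tau> \<le> T" shows "1 + geo \<alpha> \<beta> \<tau> z \<le> geo_bound \<alpha> \<beta> T z"
proof -
  have "(\<alpha> - \<beta>\<^sup>2 / 2) * \<tau> \<le> \<bar>\<alpha> - \<beta>\<^sup>2 / 2\<bar> * T"
    using assms by (intro mult_mono) auto
  moreover have "\<beta> * sqrt \<tau> * z \<le> \<bar>\<beta>\<bar> * sqrt T * \<bar>z\<bar>"
  proof -
    have "\<beta> * sqrt \<tau> * z \<le> \<bar>\<beta> * sqrt \<tau> * z\<bar>" by simp
    also have "\<dots> = \<bar>\<beta>\<bar> * sqrt \<tau> * \<bar>z\<bar>" using assms by (simp add: abs_mult)
    also have "\<dots> \<le> \<bar>\<beta>\<bar> * sqrt T * \<bar>z\<bar>" using assms by (intro mult_right_mono mult_left_mono) auto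
    finally show ?thesis .
  qed
  ultimately show ?thesis by (simp add: geo_def geo_bound_def exp_add [symmetric])
qed

lemma geo_bound_ge_1: "geo_bound \<alpha> \<beta> T z \<ge> 1"
  by (simp add: geo_bound_def)

lemma geo_bound_integrable: "integrable gauss (\<lambda>z. C * geo_bound \<alpha> \<beta> T z ^ n)"
  unfolding geo_bound_def by (intro exp_bounded_integrable exp_bounded_intros)

text \<open>1 + |x g| is at most (1 + |x|)(1 + g), which separates the starting point from the
  noise.\<close>

lemma geo_integrand_bound:
  assumes f: "C \<ge> 0" "\<And>x. \<bar>f x\<bar> \<le> C * (1 + \<bar>x\<bar>) ^ N" and "0 \<le> \<tau>" "\<tau> \<le> T"
  shows "\<bar>f (x * geo \<alpha> \<beta> \<tau> z) * geo \<alpha> \<beta> \<tau> z ^ m\<bar> \<le> C * (1 + \<bar>x\<bar>) ^ N * geo_bound \<alpha> \<beta> T z ^ (N + m)"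
proof -
  let ?g = "geo \<alpha> \<beta> \<tau> z" and ?E = "geo_bound \<alpha> \<beta> T z"
  have g: "?g \<ge> 0" "?g \<le> ?E" "1 + ?g \<le> ?E" using geo_le_geo_bound [OF assms(3,4), of \<alpha> \<beta> z] by auto
  have "1 + \<bar>x * ?g\<bar> \<le> (1 + \<bar>x\<bar>) * (1 + ?g)" using g by (simp add: abs_mult algebra_simps)
  also have "\<dots> \<le> (1 + \<bar>x\<bar>) * ?E" using g by (intro mult_left_mono) auto
  finally have "(1 + \<bar>x * ?g\<bar>) ^ N \<le> ((1 + \<bar>x\<bar>) * ?E) ^ N" by (intro power_mono) auto
  then have "\<bar>f (x * ?g)\<bar> \<le> C * ((1 + \<bar>x\<bar>) * ?E) ^ N"
    using f(2) [of "x * ?g"] mult_left_mono [OF _ f(1)] order_trans by blast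
  then have "\<bar>f (x * ?g) * ?g ^ m\<bar> \<le> (C * ((1 + \<bar>x\<bar>) * ?E) ^ N) * ?E ^ m"
    unfolding abs_mult using g by (intro mult_mono) (auto intro!: power_mono)
  then show ?thesis by (simp add: power_mult_distrib power_add mult_ac)
qed

lemma geo_mean_poly_bounded:
  assumes "tame f"
  obtains C N where "C \<ge> 0" "\<And>\<tau> x. 0 \<le> \<tau> \<Longrightarrow> \<tau> \<le> T \<Longrightarrow> \<bar>geo_mean \<alpha> \<beta> f m \<tau> x\<bar> \<le> C * (1 + \<bar>x\<bar>) ^ N"
proof -
  obtain C N where C: "C \<ge> 0" "\<And>x. \<bar>f x\<bar> \<le> C * (1 + \<bar>x\<bar>) ^ N"
    using tame_poly_bounded [OF assms] unfolding poly_bounded_def by blast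
  let ?I = "\<integral>z. geo_bound \<alpha> \<beta> T z ^ (N + m) \<partial>gauss"
  have I: "?I \<ge> 0" using geo_bound_ge_1 order_trans zero_le_one by (intro Bochner_Integration.integral_nonneg zero_le_power) blast
  show thesis
  proof (rule that [of "C * ?I" N])
    show "C * ?I \<ge> 0" using C I by simp
    fix \<tau> x :: real assume \<tau>: "0 \<le> \<tau>" "\<tau> \<le> T"
    have "\<bar>geo_mean \<alpha> \<beta> f m \<tau> x\<bar> \<le> (\<integral>z. \<bar>f (x * geo \<alpha> \<beta> \<tau> z) * geo \<alpha> \<beta> \<tau> z ^ m\<bar> \<partial>gauss)"
      unfolding geo_mean_def by (rule integral_abs_bound)
    also have "\<dots> \<le> (\<integral>z. C * (1 + \<bar>x\<bar>) ^ N * geo_bound \<alpha> \<beta> T z ^ (N + m) \<partial>gauss)"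
      by (intro integral_mono geo_bound_integrable integrable_abs exp_bounded_integrable exp_bounded_geo assms geo_integrand_bound C \<tau>)
    finally show "\<bar>geo_mean \<alpha> \<beta> f m \<tau> x\<bar> \<le> C * ?I * (1 + \<bar>x\<bar>) ^ N" by (simp add: mult_ac)
  qed
qed

text \<open>Dividing by \<open>(1 + \<bar>x\<bar>) ^ N\<close> makes the integrand dominated
  uniformly in all x, so joint continuity holds on the whole strip at once, including \<tau> =
  0.\<close>

lemma geo_mean_continuous:
  assumes f: "tame f"
  shows "continuous_on ({0..T} \<times> UNIV) (\<lambda>(\<tau>, x). geo_mean \<alpha> \<beta> f m \<tau> x)"
proof -
  obtain C N where C: "C \<ge> 0" "\<And>x. \<bar>f x\<bar> \<le> C * (1 + \<bar>x\<bar>) ^ N"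
    using tame_poly_bounded [OF assms] unfolding poly_bounded_def by blast
  let ?w = "\<lambda>z. C * geo_bound \<alpha> \<beta> T z ^ (N + m)"
  have nz: "(1 + \<bar>x\<bar>) ^ N \<noteq> 0" for x :: real by (simp add: add_nonneg_eq_0_iff)
  have "continuous_on ({0..T} \<times> UNIV) (\<lambda>p. \<integral>z. f (snd p * geo \<alpha> \<beta> (fst p) z) * geo \<alpha> \<beta> (fst p) z ^ m / (1 + \<bar>snd p\<bar>) ^ N \<partial>gauss)"
  proof (rule continuous_on_under_integral [where w = ?w])
    show "integrable gauss ?w" by (rule geo_bound_integrable)
    show "(\<lambda>z. f (snd p * geo \<alpha> \<beta> (fst p) z) * geo \<alpha> \<beta> (fst p) z ^ m / (1 + \<bar>snd p\<bar>) ^ N) \<in> borel_measurable gauss" for p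
      by (rule borel_measurable_divide [OF exp_bounded_measurable [OF exp_bounded_geo [OF f]]]) simp
    fix p z assume p: "p \<in> {0..T} \<times> (UNIV :: real set)"
    then have "\<bar>f (snd p * geo \<alpha> \<beta> (fst p) z) * geo \<alpha> \<beta> (fst p) z ^ m\<bar> \<le> C * (1 + \<bar>snd p\<bar>) ^ N * geo_bound \<alpha> \<beta> T z ^ (N + m)"
      by (intro geo_integrand_bound C) auto
    then show "\<bar>f (snd p * geo \<alpha> \<beta> (fst p) z) * geo \<alpha> \<beta> (fst p) z ^ m / (1 + \<bar>snd p\<bar>) ^ N\<bar> \<le> ?w z"
      by (simp add: abs_divide divide_simps mult_ac)
  next
    fix z
    have "continuous_on ({0..T} \<times> UNIV) (\<lambda>p. f (snd p * geo \<alpha> \<beta> (fst p) z))"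
      unfolding geo_def
      by (rule continuous_on_compose2 [OF tame_continuous [OF f, of UNIV]]) (auto intro!: continuous_intros)
    then show "continuous_on ({0..T} \<times> UNIV) (\<lambda>p. f (snd p * geo \<alpha> \<beta> (fst p) z) * geo \<alpha> \<beta> (fst p) z ^ m / (1 + \<bar>snd p\<bar>) ^ N)"
      using nz by (intro continuous_intros) (auto simp: geo_def intro!: continuous_intros)
  qed
  then have "continuous_on ({0..T} \<times> UNIV) (\<lambda>p. (1 + \<bar>snd p\<bar>) ^ N * (\<integral>z. f (snd p * geo \<alpha> \<beta> (fst p) z) * geo \<alpha> \<beta> (fst p) z ^ m / (1 + \<bar>snd p\<bar>) ^ N \<partial>gauss))"
    by (intro continuous_intros)
  moreover have "(1 + \<bar>snd p\<bar>) ^ N * (\<integral>z. f (snd p * geo \<alpha> \<beta> (fst p) z) * geo \<alpha> \<beta> (fst p) z ^ m / (1 + \<bar>snd p\<bar>) ^ N \<partial>gauss)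
      = (\<lambda>(\<tau>, x). geo_mean \<alpha> \<beta> f m \<tau> x) p" for p
    using nz [of "snd p"] by (simp add: geo_mean_def case_prod_beta integral_divide_zero)
  ultimately show ?thesis by simp
qed

lemma geo_mean_space_derivative:
  assumes f: "tame f" and \<tau>: "\<tau> \<ge> 0"
  shows "((\<lambda>x. geo_mean \<alpha> \<beta> f m \<tau> x) has_real_derivative geo_mean \<alpha> \<beta> (deriv f) (Suc m) \<tau> x) (at x)"
proof -
  have t: "tame (deriv f)" using f by (rule tame_deriv)
  obtain C N where C: "C \<ge> 0" "\<And>x. \<bar>deriv f x\<bar> \<le> C * (1 + \<bar>x\<bar>) ^ N"
    using tame_poly_bounded [OF t] unfolding poly_bounded_def by blast
  show ?thesis unfolding geo_mean_def
  proof (rule has_derivative_under_integral [where r = 1 and w = "\<lambda>z. C * (2 + \<bar>x\<bar>) ^ N * geo_bound \<alpha> \<beta> \<tau> z ^ (N + Suc m)"])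
    fix y z assume y: "y \<in> ball x 1"
    let ?g = "geo \<alpha> \<beta> \<tau> z"
    have "((\<lambda>y. y * ?g) has_real_derivative ?g) (at y)" by (auto intro!: derivative_eq_intros)
    from DERIV_cmult_right [OF DERIV_chain2 [OF tame_DERIV [OF f] this], of "?g ^ m"]
    show "((\<lambda>y. f (y * ?g) * ?g ^ m) has_real_derivative deriv f (y * ?g) * ?g ^ Suc m) (at y)"
      by (simp add: mult_ac)
    have "\<bar>deriv f (y * ?g) * ?g ^ Suc m\<bar> \<le> C * (1 + \<bar>y\<bar>) ^ N * geo_bound \<alpha> \<beta> \<tau> z ^ (N + Suc m)"
      by (rule geo_integrand_bound) (use C \<tau> in auto)
    also have "\<dots> \<le> C * (2 + \<bar>x\<bar>) ^ N * geo_bound \<alpha> \<beta> \<tau> z ^ (N + Suc m)"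
      using y C geo_bound_ge_1 [of \<alpha> \<beta> \<tau> z] by (intro mult_right_mono mult_left_mono power_mono) (auto simp: dist_real_def)
    finally show "\<bar>deriv f (y * ?g) * ?g ^ Suc m\<bar> \<le> \<dots>" .
  next
    show "integrable gauss (\<lambda>z. f (y * geo \<alpha> \<beta> \<tau> z) * geo \<alpha> \<beta> \<tau> z ^ m)" for y
      by (intro exp_bounded_integrable exp_bounded_geo f)
    show "(\<lambda>z. deriv f (x * geo \<alpha> \<beta> \<tau> z) * geo \<alpha> \<beta> \<tau> z ^ Suc m) \<in> borel_measurable gauss"
      by (intro exp_bounded_measurable exp_bounded_geo t)
  next
    show "integrable gauss (\<lambda>z. C * (2 + \<bar>x\<bar>) ^ N * geo_bound \<alpha> \<beta> \<tau> z ^ (N + Suc m))" by (rule geo_bound_integrable)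
  qed simp
qed

text \<open>Exact moments are wanted because the barrier of the comparison principle needs a lower
  bound.\<close>

lemma geo_moment: "0 \<le> \<tau> \<Longrightarrow> (\<integral>z. geo \<alpha> \<beta> \<tau> z ^ m \<partial>gauss) = exp ((m * \<alpha> + m * (real m - 1) * \<beta>\<^sup>2 / 2) * \<tau>)"
proof -
  assume \<tau>: "0 \<le> \<tau>"
  have "(\<integral>z. geo \<alpha> \<beta> \<tau> z ^ m \<partial>gauss) = (\<integral>z. exp (m * (\<alpha> - \<beta>\<^sup>2 / 2) * \<tau>) * exp ((m * \<beta> * sqrt \<tau>) * z) \<partial>gauss)"
    by (intro Bochner_Integration.integral_cong refl) (simp add: geo_def exp_of_nat_mult [symmetric] exp_add [symmetric] algebra_simps)
  also have "\<dots> = exp (m * (\<alpha> - \<beta>\<^sup>2 / 2) * \<tau>) * exp ((m * \<beta> * sqrt \<tau>)\<^sup>2 / 2)"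
    by (simp add: gauss_exp_integral)
  also have "\<dots> = exp ((m * \<alpha> + m * (real m - 1) * \<beta>\<^sup>2 / 2) * \<tau>)"
    using \<tau> by (simp add: exp_add [symmetric] power_mult_distrib power2_eq_square field_simps)
  finally show ?thesis .
qed

section \<open>Partial derivatives and the parabolic operator\<close>

text \<open>The defining equations match explicit pairs only; these forms rewrite for a variable
  point \<open>z\<close>.\<close>

lemma coord_simps [simp]:
  "coord None z = fst z" "coord (Some i) z = snd z i"
  "coord_upd None z r = (r, snd z)" "coord_upd (Some i) z r = (fst z, (snd z)(i := r))"
  by (cases z; simp)+

declare coord.simps [simp del] coord_upd.simps [simp del]

lemma coord_upd_same: "coord k (coord_upd k z r) = r" "coord_upd k z (coord k z) = z"
  "coord_upd k (coord_upd k z r) s = coord_upd k z s"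
  by (cases k; simp)+

text \<open>\<open>Rn d\<close> is not open in \<open>nat \<Rightarrow> real\<close>, since
  coordinates from \<open>d\<close> on are pinned to \<open>undefined\<close>. What partial
  derivatives need is only that a small move of one relevant coordinate stays inside
  \<open>D\<close>.\<close>

definition slicewise_open :: "nat \<Rightarrow> (real \<times> (nat \<Rightarrow> real)) set \<Rightarrow> bool" where
  "slicewise_open d D \<longleftrightarrow> (\<forall>z\<in>D. \<forall>k\<in>coords d. \<forall>\<^sub>F r in nhds (coord k z). coord_upd k z r \<in> D)"

text \<open>A relation in place of the operator \<open>partial_deriv\<close>: a candidate derivative
  can be built by the usual rules and has to be right on \<open>D\<close> alone.\<close>

definition has_partial_on ::
  "nat option \<Rightarrow> (real \<times> (nat \<Rightarrow> real)) set \<Rightarrow> (real \<times> (nat \<Rightarrow> real) \<Rightarrow> real) \<Rightarrow> (real \<times> (nat \<Rightarrow> real) \<Rightarrow> real) \<Rightarrow> bool" where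
  "has_partial_on k D h h' \<longleftrightarrow> (\<forall>z\<in>D. ((\<lambda>r. h (coord_upd k z r)) has_real_derivative h' z) (at (coord k z)))"

lemma has_partial_on_imp_partial_deriv: "has_partial_on k D h h' \<Longrightarrow> z \<in> D \<Longrightarrow> partial_deriv k h z = h' z"
  unfolding has_partial_on_def partial_deriv_def by (blast intro: DERIV_imp_deriv)

lemma has_partial_on_cong:
  assumes D: "slicewise_open d D" and k: "k \<in> coords d" and fg: "\<And>w. w \<in> D \<Longrightarrow> f w = g w"
    and f: "has_partial_on k D f f'"
  shows "has_partial_on k D g f'"
  unfolding has_partial_on_def
proof
  fix z assume z: "z \<in> D"
  have "\<forall>\<^sub>F r in nhds (coord k z). coord_upd k z r \<in> D"
    using D z k unfolding slicewise_open_def by blast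
  then have "\<forall>\<^sub>F r in nhds (coord k z). f (coord_upd k z r) = g (coord_upd k z r)"
    by (rule eventually_mono) (rule fg)
  from DERIV_cong_ev [OF refl this refl] f z
  show "((\<lambda>r. g (coord_upd k z r)) has_real_derivative f' z) (at (coord k z))"
    unfolding has_partial_on_def by auto
qed

lemma Ck_on_continuous: "Ck_on n d D h \<Longrightarrow> continuous_on D h"
  by (cases n) auto

lemma Ck_on_SucD:
  assumes "Ck_on (Suc n) d D h" "k \<in> coords d"
  shows "has_partial_on k D h (partial_deriv k h)" "Ck_on n d D (partial_deriv k h)"
proof -
  have *: "(\<lambda>r. h (coord_upd k z r)) differentiable at (coord k z)" if "z \<in> D" for z
    using assms that by simp
  show "has_partial_on k D h (partial_deriv k h)"
    unfolding has_partial_on_def partial_deriv_def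
  proof
    fix z assume "z \<in> D"
    from * [OF this] obtain l where l: "((\<lambda>r. h (coord_upd k z r)) has_real_derivative l) (at (coord k z))"
      unfolding real_differentiable_def by blast
    with DERIV_imp_deriv [OF l]
    show "((\<lambda>r. h (coord_upd k z r)) has_real_derivative deriv (\<lambda>r. h (coord_upd k z r)) (coord k z)) (at (coord k z))"
      by simp
  qed
  show "Ck_on n d D (partial_deriv k h)" using assms by simp
qed

text \<open>Partial derivatives on a slicewise open set depend only on the values there, so
  agreement on \<open>D\<close> passes to all orders.\<close>

lemma Ck_on_cong:
  assumes D: "slicewise_open d D"
  shows "Ck_on n d D f \<Longrightarrow> (\<And>w. w \<in> D \<Longrightarrow> f w = g w) \<Longrightarrow> Ck_on n d D g"
proof (induction n arbitrary: f g)
  case 0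
  then show ?case by (simp cong: continuous_on_cong)
next
  case (Suc n)
  have c: "continuous_on D g" using Suc.prems by (simp cong: continuous_on_cong)
  have "(\<forall>z\<in>D. (\<lambda>r. g (coord_upd k z r)) differentiable at (coord k z)) \<and> Ck_on n d D (partial_deriv k g)"
    if k: "k \<in> coords d" for k
  proof -
    note f = Ck_on_SucD [OF Suc.prems(1) k]
    have g: "has_partial_on k D g (partial_deriv k f)"
      by (rule has_partial_on_cong [OF D k Suc.prems(2) f(1)])
    have "Ck_on n d D (partial_deriv k g)"
      by (rule Suc.IH [OF f(2)]) (simp add: has_partial_on_imp_partial_deriv [OF g])
    then show ?thesis using g unfolding has_partial_on_def real_differentiable_def by blast
  qed
  then show ?case using c by simp
qed

text \<open>Lets candidates \<open>h' k\<close> stand for the true partial derivatives, with which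
  they agree on \<open>D\<close> but perhaps not outside.\<close>

lemma Ck_on_SucI:
  assumes D: "slicewise_open d D" and c: "continuous_on D h"
    and h: "\<And>k. k \<in> coords d \<Longrightarrow> has_partial_on k D h (h' k)" "\<And>k. k \<in> coords d \<Longrightarrow> Ck_on n d D (h' k)"
  shows "Ck_on (Suc n) d D h"
proof -
  have "(\<forall>z\<in>D. (\<lambda>r. h (coord_upd k z r)) differentiable at (coord k z)) \<and> Ck_on n d D (partial_deriv k h)"
    if k: "k \<in> coords d" for k
    using h(1) [OF k] Ck_on_cong [OF D h(2) [OF k], of "partial_deriv k h"]
    by (auto simp: has_partial_on_imp_partial_deriv [OF h(1) [OF k]] has_partial_on_def real_differentiable_def)
  then show ?thesis using c by simp
qed

lemma Ck_on_Suc_imp: "Ck_on (Suc n) d D h \<Longrightarrow> Ck_on n d D h"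
  by (induction n arbitrary: h) auto

lemma has_partial_on_const: "has_partial_on k D (\<lambda>_. c) (\<lambda>_. 0)"
  and has_partial_on_add: "has_partial_on k D f f' \<Longrightarrow> has_partial_on k D g g' \<Longrightarrow> has_partial_on k D (\<lambda>z. f z + g z) (\<lambda>z. f' z + g' z)"
  by (auto simp: has_partial_on_def intro!: derivative_eq_intros)

lemma has_partial_on_mult:
  assumes "has_partial_on k D f f'" "has_partial_on k D g g'"
  shows "has_partial_on k D (\<lambda>z. f z * g z) (\<lambda>z. f z * g' z + f' z * g z)"
  unfolding has_partial_on_def
proof
  fix z assume "z \<in> D"
  then have "((\<lambda>r. f (coord_upd k z r)) has_real_derivative f' z) (at (coord k z))" "((\<lambda>r. g (coord_upd k z r)) has_real_derivative g' z) (at (coord k z))"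
    using assms unfolding has_partial_on_def by auto
  from DERIV_mult' [OF this]
  show "((\<lambda>r. f (coord_upd k z r) * g (coord_upd k z r)) has_real_derivative f z * g' z + f' z * g z) (at (coord k z))"
    by (simp only: coord_upd_same)
qed

lemma has_partial_on_indep:
  "(\<And>z r. h (coord_upd k z r) = h z) \<Longrightarrow> has_partial_on k D h (\<lambda>_. 0)"
  unfolding has_partial_on_def by simp

lemma has_partial_on_prod:
  assumes "finite I" "\<And>i. i \<in> I \<Longrightarrow> has_partial_on k D (h i) (h' i)"
  shows "has_partial_on k D (\<lambda>z. \<Prod>i\<in>I. h i z) (\<lambda>z. \<Sum>i\<in>I. h' i z * (\<Prod>j\<in>I - {i}. h j z))"
  using assms
proof (induction I rule: finite_induct)
  case (insert a I)
  have "has_partial_on k D (\<lambda>z. h a z * (\<Prod>i\<in>I. h i z)) (\<lambda>z. h a z * (\<Sum>i\<in>I. h' i z * (\<Prod>j\<in>I - {i}. h j z)) + h' a z * (\<Prod>i\<in>I. h i z))"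
    using insert by (intro has_partial_on_mult) auto
  moreover have "h a z * (\<Sum>i\<in>I. h' i z * (\<Prod>j\<in>I - {i}. h j z)) + h' a z * (\<Prod>i\<in>I. h i z) =
     (\<Sum>i\<in>insert a I. h' i z * (\<Prod>j\<in>insert a I - {i}. h j z))" for z
  proof -
    have 1: "insert a I - {a} = I" using insert by auto
    have 2: "h' i z * (\<Prod>j\<in>insert a I - {i}. h j z) = h a z * (h' i z * (\<Prod>j\<in>I - {i}. h j z))" if "i \<in> I" for i
    proof -
      have "insert a I - {i} = insert a (I - {i})" using insert that by auto
      then show ?thesis using insert by simp
    qed
    show ?thesis using insert by (simp add: 1 sum_distrib_left sum.cong [OF refl 2])
  qed
  ultimately show ?case using insert by simp
qed (simp add: has_partial_on_const)

lemma continuous_on_snd_component: "continuous_on D (\<lambda>z :: real \<times> (nat \<Rightarrow> real). snd z i)"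
  by (rule continuous_on_product_then_coordinatewise [OF continuous_on_snd [OF continuous_on_id]])

section \<open>Algebraic closure of the classes C^n\<close>

context
  fixes d :: nat and D :: "(real \<times> (nat \<Rightarrow> real)) set"
  assumes D: "slicewise_open d D"
begin

lemma Ck_on_const: "Ck_on n d D (\<lambda>_. c)"
proof (induction n arbitrary: c)
  case (Suc n)
  show ?case by (rule Ck_on_SucI [OF D _ has_partial_on_const Suc]) simp
qed simp

lemma Ck_on_add: "Ck_on n d D f \<Longrightarrow> Ck_on n d D g \<Longrightarrow> Ck_on n d D (\<lambda>z. f z + g z)"
proof (induction n arbitrary: f g)
  case (Suc n)
  show ?case
  proof (rule Ck_on_SucI [OF D _ has_partial_on_add])
    show "continuous_on D (\<lambda>z. f z + g z)" using Suc.prems by (intro continuous_intros Ck_on_continuous)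
    fix k assume k: "k \<in> coords d"
    show "has_partial_on k D f (partial_deriv k f)" "has_partial_on k D g (partial_deriv k g)"
      using Ck_on_SucD Suc.prems k by blast+
    show "Ck_on n d D (\<lambda>z. partial_deriv k f z + partial_deriv k g z)"
      by (intro Suc.IH) (use Suc.prems Ck_on_SucD k in blast)+
  qed
qed (auto intro!: continuous_intros)

lemma Ck_on_mult: "Ck_on n d D f \<Longrightarrow> Ck_on n d D g \<Longrightarrow> Ck_on n d D (\<lambda>z. f z * g z)"
proof (induction n arbitrary: f g)
  case (Suc n)
  show ?case
  proof (rule Ck_on_SucI [OF D _ has_partial_on_mult])
    show "continuous_on D (\<lambda>z. f z * g z)" using Suc.prems by (intro continuous_intros Ck_on_continuous)
    fix k assume k: "k \<in> coords d"
    show "has_partial_on k D f (partial_deriv k f)" "has_partial_on k D g (partial_deriv k g)"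
      using Ck_on_SucD Suc.prems k by blast+
    show "Ck_on n d D (\<lambda>z. f z * partial_deriv k g z + partial_deriv k f z * g z)"
      by (intro Ck_on_add Suc.IH) (use Suc.prems Ck_on_SucD Ck_on_Suc_imp k in blast)+
  qed
qed (auto intro!: continuous_intros)

lemma Ck_on_coord: "Ck_on n d D (\<lambda>z. coord j z)"
proof -
  have c: "continuous_on D (\<lambda>z. coord j z)"
    by (cases j) (auto intro!: continuous_intros continuous_on_snd_component)
  show ?thesis
  proof (cases n)
    case (Suc m)
    have "has_partial_on k D (coord j) (\<lambda>_. if k = j then 1 else 0)" for k
      unfolding has_partial_on_def by (cases k; cases j) (auto intro!: derivative_eq_intros)
    moreover have "Ck_on m d D (\<lambda>_. if k = j then 1 else 0)" for k by (rule Ck_on_const)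
    ultimately show ?thesis unfolding Suc using c by (intro Ck_on_SucI [OF D]) auto
  qed (use c in simp)
qed

lemma Ck_on_snd: "Ck_on n d D (\<lambda>z. snd z i)"
  using Ck_on_coord [of n "Some i"] by simp

lemma Ck_on_power: "Ck_on n d D f \<Longrightarrow> Ck_on n d D (\<lambda>z. f z ^ m)"
  by (induction m) (auto intro: Ck_on_const Ck_on_mult)

lemma Ck_on_sum: "finite I \<Longrightarrow> (\<And>i. i \<in> I \<Longrightarrow> Ck_on n d D (h i)) \<Longrightarrow> Ck_on n d D (\<lambda>z. \<Sum>i\<in>I. h i z)"
  by (induction I rule: finite_induct) (auto intro: Ck_on_const Ck_on_add)

lemma Ck_on_prod: "finite I \<Longrightarrow> (\<And>i. i \<in> I \<Longrightarrow> Ck_on n d D (h i)) \<Longrightarrow> Ck_on n d D (\<lambda>z. \<Prod>i\<in>I. h i z)"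
  by (induction I rule: finite_induct) (auto intro: Ck_on_const Ck_on_mult)

end

section \<open>The parabolic operator on C^2 functions\<close>

definition parabolic_op :: "real \<Rightarrow> real \<Rightarrow> nat \<Rightarrow> (real \<times> (nat \<Rightarrow> real) \<Rightarrow> real) \<Rightarrow> real \<times> (nat \<Rightarrow> real) \<Rightarrow> real" where
  "parabolic_op \<alpha> \<beta> d h z = partial_deriv None h z + G_op \<alpha> \<beta> d h z"

lemma coords_simps [simp]: "None \<in> coords d" "Some i \<in> coords d \<longleftrightarrow> i < d"
  by (auto simp: coords_def)

lemma parabolic_op_eqI:
  assumes D: "slicewise_open d D" and z: "z \<in> D"
    and "has_partial_on None D h h0"
    and h1: "\<And>i. i < d \<Longrightarrow> has_partial_on (Some i) D h (h1 i)"
    and h2: "\<And>i. i < d \<Longrightarrow> has_partial_on (Some i) D (h1 i) (h2 i)"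
  shows "parabolic_op \<alpha> \<beta> d h z = h0 z + (\<Sum>i<d. \<beta>\<^sup>2 * \<bar>snd z i\<bar>\<^sup>2 / 2 * h2 i z) + (\<Sum>i<d. \<alpha> * snd z i * h1 i z)"
proof -
  \<comment> \<open>The inner derivative equals \<open>h1 i\<close> only on \<open>D\<close>;
    openness along slices allows differentiating it a second time all the same.\<close>
  have "partial_deriv (Some i) (partial_deriv (Some i) h) z = h2 i z" if "i < d" for i
  proof (rule has_partial_on_imp_partial_deriv [OF _ z])
    show "has_partial_on (Some i) D (partial_deriv (Some i) h) (h2 i)"
      by (rule has_partial_on_cong [OF D _ _ h2 [OF that]])
        (use that in \<open>auto simp: has_partial_on_imp_partial_deriv [OF h1 [OF that]]\<close>)
  qed
  then show ?thesis
    by (simp add: parabolic_op_def G_op_def has_partial_on_imp_partial_deriv [OF h1 z] has_partial_on_imp_partial_deriv [OF assms(3) z])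
qed

lemma parabolic_op_const:
  assumes "slicewise_open d D" "z \<in> D" shows "parabolic_op \<alpha> \<beta> d (\<lambda>_. c) z = 0"
  using parabolic_op_eqI [where h = "\<lambda>_. c" and ?h0.0 = "\<lambda>_. 0" and ?h1.0 = "\<lambda>_ _. 0" and ?h2.0 = "\<lambda>_ _. 0",
    OF assms has_partial_on_const has_partial_on_const has_partial_on_const]
  by simp

lemma Ck_on_2D:
  assumes "Ck_on 2 d D h"
  shows "has_partial_on None D h (partial_deriv None h)"
    and "i < d \<Longrightarrow> has_partial_on (Some i) D h (partial_deriv (Some i) h)"
    and "i < d \<Longrightarrow> has_partial_on (Some i) D (partial_deriv (Some i) h) (partial_deriv (Some i) (partial_deriv (Some i) h))"
    and "continuous_on D (partial_deriv None h)"
    and "i < d \<Longrightarrow> continuous_on D (partial_deriv (Some i) h)"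
    and "i < d \<Longrightarrow> continuous_on D (partial_deriv (Some i) (partial_deriv (Some i) h))"
proof -
  have C: "Ck_on (Suc (Suc 0)) d D h" using assms by (simp add: numeral_2_eq_2)
  show "has_partial_on None D h (partial_deriv None h)" "continuous_on D (partial_deriv None h)"
    using Ck_on_SucD [OF C, of None] Ck_on_continuous by auto
  assume "i < d"
  then have i: "Some i \<in> coords d" by simp
  note C1 = Ck_on_SucD [OF C i]
  note C2 = Ck_on_SucD [OF C1(2) i]
  show "has_partial_on (Some i) D h (partial_deriv (Some i) h)"
    "has_partial_on (Some i) D (partial_deriv (Some i) h) (partial_deriv (Some i) (partial_deriv (Some i) h))"
    "continuous_on D (partial_deriv (Some i) h)" "continuous_on D (partial_deriv (Some i) (partial_deriv (Some i) h))"
    using C1 C2 Ck_on_continuous by blast+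
qed

lemma parabolic_op_add:
  assumes D: "slicewise_open d D" and z: "z \<in> D" and h: "Ck_on 2 d D f" "Ck_on 2 d D g"
  shows "parabolic_op \<alpha> \<beta> d (\<lambda>z. f z + g z) z = parabolic_op \<alpha> \<beta> d f z + parabolic_op \<alpha> \<beta> d g z"
  by (subst parabolic_op_eqI [OF D z has_partial_on_add [OF Ck_on_2D(1) [OF h(1)] Ck_on_2D(1) [OF h(2)]]
        has_partial_on_add [OF Ck_on_2D(2) [OF h(1)] Ck_on_2D(2) [OF h(2)]]
        has_partial_on_add [OF Ck_on_2D(3) [OF h(1)] Ck_on_2D(3) [OF h(2)]]])
    (auto simp: parabolic_op_def G_op_def sum.distrib distrib_left)

lemma has_partial_on_cmult:
  assumes "has_partial_on k D f f'" shows "has_partial_on k D (\<lambda>z. c * f z) (\<lambda>z. c * f' z)"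
  using has_partial_on_mult [OF has_partial_on_const assms, of c] by simp

lemma parabolic_op_cmult:
  assumes D: "slicewise_open d D" and z: "z \<in> D" and h: "Ck_on 2 d D f"
  shows "parabolic_op \<alpha> \<beta> d (\<lambda>z. c * f z) z = c * parabolic_op \<alpha> \<beta> d f z"
  by (subst parabolic_op_eqI [OF D z has_partial_on_cmult [OF Ck_on_2D(1) [OF h(1)]]
        has_partial_on_cmult [OF Ck_on_2D(2) [OF h(1)]] has_partial_on_cmult [OF Ck_on_2D(3) [OF h(1)]]])
    (auto simp: parabolic_op_def G_op_def sum_distrib_left algebra_simps)

lemma continuous_on_parabolic_op:
  assumes "Ck_on 2 d D h" shows "continuous_on D (parabolic_op \<alpha> \<beta> d h)"
proof -
  note [continuous_intros] = continuous_on_snd_component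
  have "continuous_on D (\<lambda>z. parabolic_op \<alpha> \<beta> d h z)"
    unfolding parabolic_op_def G_op_def
    using Ck_on_2D [OF assms] by (intro continuous_intros) auto
  then show ?thesis by simp
qed

text \<open>If \<open>l\<close> were positive, \<open>g1\<close> would be positive just to the right
  of \<open>a\<close>, and the mean value theorem would push \<open>g\<close> above
  \<open>g a\<close>.\<close>

lemma local_max_second_derivative:
  fixes g :: "real \<Rightarrow> real"
  assumes g1: "\<forall>\<^sub>F r in nhds a. (g has_real_derivative g1 r) (at r)"
    and g2: "(g1 has_real_derivative l) (at a)"
    and max: "\<forall>\<^sub>F r in nhds a. g r \<le> g a"
  shows "g1 a = 0" "l \<le> 0"
proof -
  obtain e where e: "e > 0" "\<And>r. dist r a < e \<Longrightarrow> (g has_real_derivative g1 r) (at r) \<and> g r \<le> g a"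
    using eventually_conj [OF g1 max] unfolding eventually_nhds_metric by blast
  show "g1 a = 0"
    by (rule DERIV_local_max [of g "g1 a" a e]) (use e in \<open>auto simp: dist_real_def abs_minus_commute\<close>)
  then have 0: "g1 a = 0" .
  show "l \<le> 0"
  proof (rule ccontr)
    assume "\<not> l \<le> 0"
    then obtain \<delta> where \<delta>: "\<delta> > 0" "\<And>h. 0 < h \<Longrightarrow> h < \<delta> \<Longrightarrow> 0 < g1 (a + h)"
      using DERIV_pos_inc_right [OF g2] 0 by auto
    define h where "h = min e \<delta> / 2"
    have h: "0 < h" "h < e" "h < \<delta>" using e \<delta> by (auto simp: h_def)
    have "\<exists>\<xi>>a. \<xi> < a + h \<and> g (a + h) - g a = (a + h - a) * g1 \<xi>"
      by (rule MVT2) (use h e in \<open>auto simp: dist_real_def\<close>)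
    then obtain \<xi> where \<xi>: "a < \<xi>" "\<xi> < a + h" "g (a + h) - g a = h * g1 \<xi>" by auto
    have "g1 \<xi> > 0" using \<delta>(2) [of "\<xi> - a"] \<xi> h by simp
    then have "g (a + h) > g a" using \<xi> h mult_pos_pos [of h "g1 \<xi>"] by linarith
    moreover have "g (a + h) \<le> g a" using e(2) [of "a + h"] h by (simp add: dist_real_def)
    ultimately show False by simp
  qed
qed

text \<open>Maximality along coordinate lines suffices: the operator has no mixed second
  derivatives, and its second-order coefficients are nonnegative.\<close>

lemma parabolic_op_local_max:
  assumes D: "slicewise_open d D" and z: "z \<in> D" and f: "Ck_on 2 d D f"
    and max: "\<And>k. k \<in> coords d \<Longrightarrow> \<forall>\<^sub>F r in nhds (coord k z). f (coord_upd k z r) \<le> f z"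
  shows "parabolic_op \<alpha> \<beta> d f z \<le> 0"
proof -
  have t: "partial_deriv None f z = 0"
  proof -
    obtain e where e: "e > 0" "\<And>r. dist r (fst z) < e \<Longrightarrow> f (r, snd z) \<le> f z"
      using max [of None] unfolding eventually_nhds_metric by auto
    have "((\<lambda>r. f (r, snd z)) has_real_derivative partial_deriv None f z) (at (fst z))"
      using Ck_on_2D(1) [OF f] z unfolding has_partial_on_def by auto
    then show ?thesis
      by (rule DERIV_local_max [where d = e]) (use e in \<open>auto simp: dist_real_def abs_minus_commute\<close>)
  qed
  have x: "partial_deriv (Some i) f z = 0 \<and> partial_deriv (Some i) (partial_deriv (Some i) f) z \<le> 0" if i: "i < d" for i
  proof -
    let ?k = "Some i"
    have ev: "\<forall>\<^sub>F r in nhds (coord ?k z). coord_upd ?k z r \<in> D"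
      using D z i unfolding slicewise_open_def by (metis coords_simps(2))
    have "\<forall>\<^sub>F r in nhds (coord ?k z). ((\<lambda>r. f (coord_upd ?k z r)) has_real_derivative partial_deriv ?k f (coord_upd ?k z r)) (at r)"
      using ev
    proof (rule eventually_mono)
      fix r assume "coord_upd ?k z r \<in> D"
      then have "((\<lambda>s. f (coord_upd ?k (coord_upd ?k z r) s)) has_real_derivative partial_deriv ?k f (coord_upd ?k z r)) (at (coord ?k (coord_upd ?k z r)))"
        using Ck_on_2D(2) [OF f i] unfolding has_partial_on_def by blast
      then show "((\<lambda>r. f (coord_upd ?k z r)) has_real_derivative partial_deriv ?k f (coord_upd ?k z r)) (at r)"
        by (simp only: coord_upd_same)
    qed
    moreover have "((\<lambda>r. partial_deriv ?k f (coord_upd ?k z r)) has_real_derivative partial_deriv ?k (partial_deriv ?k f) z) (at (coord ?k z))"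
      using Ck_on_2D(3) [OF f i] z unfolding has_partial_on_def by blast
    moreover have "\<forall>\<^sub>F r in nhds (coord ?k z). f (coord_upd ?k z r) \<le> f (coord_upd ?k z (coord ?k z))"
      using max [of ?k] i by (simp only: coord_upd_same coords_simps)
    ultimately have "partial_deriv ?k f (coord_upd ?k z (coord ?k z)) = 0" "partial_deriv ?k (partial_deriv ?k f) z \<le> 0"
      by (rule local_max_second_derivative)+
    then show ?thesis by (simp only: coord_upd_same)
  qed
  have "(\<Sum>i<d. \<beta>\<^sup>2 * \<bar>snd z i\<bar>\<^sup>2 / 2 * partial_deriv (Some i) (partial_deriv (Some i) f) z) \<le> 0"
    using x by (intro sum_nonpos mult_nonneg_nonpos) auto
  then show ?thesis using t x by (simp add: parabolic_op_def G_op_def)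
qed

section \<open>Classical solutions with tensor product data\<close>

lemma slicewise_open_cylinder: "slicewise_open d ({0<..<T} \<times> Rn d)"
  unfolding slicewise_open_def
proof (intro ballI)
  fix z k assume z: "z \<in> {0<..<T} \<times> Rn d" and k: "k \<in> coords d"
  show "\<forall>\<^sub>F r in nhds (coord k z). coord_upd k z r \<in> {0<..<T} \<times> Rn d"
  proof (cases k)
    case None
    have "\<forall>\<^sub>F r in nhds (fst z). r \<in> {0<..<T}" using z by (intro eventually_nhds_in_open) auto
    then show ?thesis using z None by (auto elim!: eventually_mono)
  next
    case (Some i)
    then have "(fst z, (snd z)(i := r)) \<in> {0<..<T} \<times> Rn d" for r
      using z k by (cases z) (auto simp: Rn_def PiE_def extensional_def)
    then show ?thesis using Some by simp
  qed
qed

lemma abs_le_norm_Rn: "i < d \<Longrightarrow> \<bar>x i\<bar> \<le> norm_Rn d x"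
proof -
  assume "i < d"
  then have "(x i)\<^sup>2 \<le> (\<Sum>j<d. (x j)\<^sup>2)" by (intro member_le_sum) auto
  then show ?thesis unfolding norm_Rn_def L2_set_def by (metis real_sqrt_abs real_sqrt_le_iff)
qed

lemma norm_Rn_nonneg [simp]: "norm_Rn d x \<ge> 0"
  by (simp add: norm_Rn_def)

text \<open>The working form of \<open>poly_growth\<close> with natural exponents, which add under
  products; \<open>poly_growth_iff\<close> identifies the two.\<close>

definition poly_bounded_on :: "real \<Rightarrow> nat \<Rightarrow> (real \<times> (nat \<Rightarrow> real) \<Rightarrow> real) \<Rightarrow> bool" where
  "poly_bounded_on T d u \<longleftrightarrow> (\<exists>C\<ge>0. \<exists>N. \<forall>t\<in>{0..T}. \<forall>x\<in>Rn d. \<bar>u (t, x)\<bar> \<le> C * (1 + norm_Rn d x) ^ N)"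

lemma poly_bounded_onI:
  "C \<ge> 0 \<Longrightarrow> (\<And>t x. t \<in> {0..T} \<Longrightarrow> x \<in> Rn d \<Longrightarrow> \<bar>u (t, x)\<bar> \<le> C * (1 + norm_Rn d x) ^ N) \<Longrightarrow> poly_bounded_on T d u"
  unfolding poly_bounded_on_def by blast

lemma poly_bounded_on_add:
  assumes "poly_bounded_on T d f" "poly_bounded_on T d g" shows "poly_bounded_on T d (\<lambda>z. f z + g z)"
proof -
  obtain C N C' N' where C: "C \<ge> 0" "C' \<ge> 0"
    and *: "\<And>t x. t \<in> {0..T} \<Longrightarrow> x \<in> Rn d \<Longrightarrow> \<bar>f (t, x)\<bar> \<le> C * (1 + norm_Rn d x) ^ N"
      "\<And>t x. t \<in> {0..T} \<Longrightarrow> x \<in> Rn d \<Longrightarrow> \<bar>g (t, x)\<bar> \<le> C' * (1 + norm_Rn d x) ^ N'"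
    using assms unfolding poly_bounded_on_def by metis
  have "\<bar>f (t, x) + g (t, x)\<bar> \<le> (C + C') * (1 + norm_Rn d x) ^ (N + N')" if "t \<in> {0..T}" "x \<in> Rn d" for t x
  proof -
    have "C * (1 + norm_Rn d x) ^ N \<le> C * (1 + norm_Rn d x) ^ (N + N')" "C' * (1 + norm_Rn d x) ^ N' \<le> C' * (1 + norm_Rn d x) ^ (N + N')"
      using C by (auto intro!: mult_left_mono power_increasing)
    then show ?thesis
      using *(1) [OF that] *(2) [OF that] abs_triangle_ineq [of "f (t, x)" "g (t, x)"] by (simp only: distrib_right)
  qed
  moreover have "0 \<le> C + C'" using C by simp
  ultimately show ?thesis by (rule poly_bounded_onI [rotated])
qed

lemma poly_bounded_on_mult:
  assumes "poly_bounded_on T d f" "poly_bounded_on T d g" shows "poly_bounded_on T d (\<lambda>z. f z * g z)"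
proof -
  obtain C N C' N' where C: "C \<ge> 0" "C' \<ge> 0"
    and *: "\<And>t x. t \<in> {0..T} \<Longrightarrow> x \<in> Rn d \<Longrightarrow> \<bar>f (t, x)\<bar> \<le> C * (1 + norm_Rn d x) ^ N"
      "\<And>t x. t \<in> {0..T} \<Longrightarrow> x \<in> Rn d \<Longrightarrow> \<bar>g (t, x)\<bar> \<le> C' * (1 + norm_Rn d x) ^ N'"
    using assms unfolding poly_bounded_on_def by metis
  have "\<bar>f (t, x) * g (t, x)\<bar> \<le> (C * C') * (1 + norm_Rn d x) ^ (N + N')" if "t \<in> {0..T}" "x \<in> Rn d" for t x
  proof -
    have "\<bar>f (t, x) * g (t, x)\<bar> \<le> (C * (1 + norm_Rn d x) ^ N) * (C' * (1 + norm_Rn d x) ^ N')"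
      unfolding abs_mult using * that C by (intro mult_mono) auto
    then show ?thesis by (simp add: power_add mult_ac)
  qed
  moreover have "0 \<le> C * C'" using C by simp
  ultimately show ?thesis by (rule poly_bounded_onI [rotated])
qed

lemma poly_bounded_on_const: "poly_bounded_on T d (\<lambda>_. c)"
  unfolding poly_bounded_on_def by (intro exI [of _ "\<bar>c\<bar>"] conjI exI [of _ 0]) auto

lemma poly_bounded_on_prod:
  "finite I \<Longrightarrow> (\<And>i. i \<in> I \<Longrightarrow> poly_bounded_on T d (h i)) \<Longrightarrow> poly_bounded_on T d (\<lambda>z. \<Prod>i\<in>I. h i z)"
  by (induction I rule: finite_induct) (auto intro: poly_bounded_on_const poly_bounded_on_mult)

text \<open>One factor of a tensor product solution. Running the flow for the remaining time
  \<open>T - fst z\<close> turns the terminal value into an initial value.\<close>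

definition geo_layer :: "real \<Rightarrow> real \<Rightarrow> real \<Rightarrow> nat \<Rightarrow> (real \<Rightarrow> real) \<Rightarrow> nat \<Rightarrow> real \<times> (nat \<Rightarrow> real) \<Rightarrow> real" where
  "geo_layer \<alpha> \<beta> T i f m z = geo_mean \<alpha> \<beta> f m (T - fst z) (snd z i)"

lemma geo_layer_continuous: "tame f \<Longrightarrow> continuous_on ({0..T} \<times> S) (geo_layer \<alpha> \<beta> T i f m)"
proof -
  assume f: "tame f"
  have "continuous_on ({0..T} \<times> S) (\<lambda>z. (\<lambda>(\<tau>, x). geo_mean \<alpha> \<beta> f m \<tau> x) (T - fst z, snd z i))"
    by (rule continuous_on_compose2 [OF geo_mean_continuous [OF f, of T]])
      (auto intro!: continuous_intros continuous_on_snd_component)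
  then show ?thesis by (simp add: geo_layer_def [abs_def])
qed

lemma geo_layer_poly_bounded: "tame f \<Longrightarrow> i < d \<Longrightarrow> poly_bounded_on T d (geo_layer \<alpha> \<beta> T i f m)"
proof -
  assume f: "tame f" and i: "i < d"
  obtain C N where C: "C \<ge> 0" "\<And>\<tau> x. 0 \<le> \<tau> \<Longrightarrow> \<tau> \<le> T \<Longrightarrow> \<bar>geo_mean \<alpha> \<beta> f m \<tau> x\<bar> \<le> C * (1 + \<bar>x\<bar>) ^ N"
    using geo_mean_poly_bounded [OF f] by metis
  have "\<bar>geo_layer \<alpha> \<beta> T i f m (t, x)\<bar> \<le> C * (1 + norm_Rn d x) ^ N" if "t \<in> {0..T}" for t x
  proof -
    have "\<bar>geo_layer \<alpha> \<beta> T i f m (t, x)\<bar> \<le> C * (1 + \<bar>x i\<bar>) ^ N"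
      unfolding geo_layer_def using that by (auto intro!: C)
    also have "\<dots> \<le> C * (1 + norm_Rn d x) ^ N"
      using C abs_le_norm_Rn [OF i] by (intro mult_left_mono power_mono) auto
    finally show ?thesis .
  qed
  then show ?thesis unfolding poly_bounded_on_def using C by blast
qed

lemma geo_layer_space_partial:
  assumes f: "tame f"
  shows "has_partial_on (Some j) ({0<..<T} \<times> S) (geo_layer \<alpha> \<beta> T i f m)
    (\<lambda>z. if j = i then geo_layer \<alpha> \<beta> T i (deriv f) (Suc m) z else 0)"
  unfolding has_partial_on_def
proof
  fix z assume "z \<in> {0<..<T} \<times> S"
  then have "T - fst z \<ge> 0" by auto
  from geo_mean_space_derivative [OF f this]
  show "((\<lambda>r. geo_layer \<alpha> \<beta> T i f m (coord_upd (Some j) z r)) has_real_derivative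
      (if j = i then geo_layer \<alpha> \<beta> T i (deriv f) (Suc m) z else 0)) (at (coord (Some j) z))"
    by (auto simp: geo_layer_def)
qed

text \<open>The formula of \<open>geo_mean_time_derivative\<close> with the sign of time reversal,
  written as a product with \<open>-1\<close> so that the closure rules for sums and products apply
  to it.\<close>

definition geo_layer_dt :: "real \<Rightarrow> real \<Rightarrow> real \<Rightarrow> nat \<Rightarrow> (real \<Rightarrow> real) \<Rightarrow> nat \<Rightarrow> real \<times> (nat \<Rightarrow> real) \<Rightarrow> real" where
  "geo_layer_dt \<alpha> \<beta> T i f m z = -1 * (
    (\<alpha> - \<beta>\<^sup>2 / 2) * (snd z i * geo_layer \<alpha> \<beta> T i (deriv f) (m + 1) z + m * geo_layer \<alpha> \<beta> T i f m z) +
    \<beta>\<^sup>2 / 2 * (snd z i ^ 2 * geo_layer \<alpha> \<beta> T i (deriv (deriv f)) (m + 2) z + (2 * m + 1) * snd z i * geo_layer \<alpha> \<beta> T i (deriv f) (m + 1) z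
      + m\<^sup>2 * geo_layer \<alpha> \<beta> T i f m z))"

lemma geo_layer_time_partial:
  assumes f: "tame f"
  shows "has_partial_on None ({0<..<T} \<times> S) (geo_layer \<alpha> \<beta> T i f m) (geo_layer_dt \<alpha> \<beta> T i f m)"
  unfolding has_partial_on_def
proof
  fix z assume "z \<in> {0<..<T} \<times> S"
  then have "T - fst z > 0" by auto
  note D = geo_mean_time_derivative [OF f this, of \<alpha> \<beta> m "snd z i"]
  have "((\<lambda>r. T - r) has_real_derivative -1) (at (fst z))" by (auto intro!: derivative_eq_intros)
  from DERIV_chain2 [OF D this]
  show "((\<lambda>r. geo_layer \<alpha> \<beta> T i f m (coord_upd None z r)) has_real_derivative geo_layer_dt \<alpha> \<beta> T i f m z) (at (coord None z))"
    by (simp add: geo_layer_def geo_layer_dt_def)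
qed

text \<open>Every partial derivative is a polynomial in the coordinate and in layers with other tame
  data and powers, hence the generalisation over \<open>f\<close> and \<open>m\<close>.\<close>

lemma geo_layer_Ck_on:
  assumes "tame f"
  shows "Ck_on n d ({0<..<T} \<times> Rn d) (geo_layer \<alpha> \<beta> T i f m)"
  using assms
proof (induction n arbitrary: f m)
  case 0
  have "continuous_on ({0<..<T} \<times> Rn d) (geo_layer \<alpha> \<beta> T i f m)"
    by (rule continuous_on_subset [OF geo_layer_continuous [OF 0, of T "Rn d"]]) auto
  then show ?case by simp
next
  case (Suc n)
  note so = slicewise_open_cylinder [of d T]
  note t = Suc.prems tame_deriv [OF Suc.prems] tame_deriv [OF tame_deriv [OF Suc.prems]]
  have c: "continuous_on ({0<..<T} \<times> Rn d) (geo_layer \<alpha> \<beta> T i f m)"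
    by (rule continuous_on_subset [OF geo_layer_continuous [OF Suc.prems, of T "Rn d"]]) auto
  let ?h = "\<lambda>k. case k of None \<Rightarrow> geo_layer_dt \<alpha> \<beta> T i f m
     | Some j \<Rightarrow> (\<lambda>z. if j = i then geo_layer \<alpha> \<beta> T i (deriv f) (Suc m) z else 0)"
  show ?case
  proof (rule Ck_on_SucI [OF so c, where h' = ?h])
    fix k assume "k \<in> coords d"
    show "has_partial_on k ({0<..<T} \<times> Rn d) (geo_layer \<alpha> \<beta> T i f m) (?h k)"
      using geo_layer_time_partial [OF t(1)] geo_layer_space_partial [OF t(1)] by (cases k) simp_all
    show "Ck_on n d ({0<..<T} \<times> Rn d) (?h k)"
    proof (cases k)
      case None
      have "Ck_on n d ({0<..<T} \<times> Rn d) (\<lambda>z. geo_layer_dt \<alpha> \<beta> T i f m z)"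
        unfolding geo_layer_dt_def
        by (intro Ck_on_add [OF so] Ck_on_mult [OF so] Ck_on_const [OF so] Ck_on_power [OF so] Ck_on_snd [OF so] Suc.IH t)
      then show ?thesis using None by simp
    next
      case (Some j)
      then show ?thesis using Suc.IH [OF t(2)] Ck_on_const [OF so] by (cases "j = i") simp_all
    qed
  qed
qed

section \<open>Finite sums of tensor products and their propagation\<close>

inductive_set tensor_span :: "nat \<Rightarrow> ((nat \<Rightarrow> real) \<Rightarrow> real) set" for d where
  tensor: "(\<And>i. tame (f i)) \<Longrightarrow> (\<lambda>x. \<Prod>i<d. f i (x i)) \<in> tensor_span d"
| sum: "g \<in> tensor_span d \<Longrightarrow> h \<in> tensor_span d \<Longrightarrow> (\<lambda>x. g x + h x) \<in> tensor_span d"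

lemma tensor_span_mult:
  assumes "g \<in> tensor_span d" "h \<in> tensor_span d" shows "(\<lambda>x. g x * h x) \<in> tensor_span d"
  using assms(1)
proof induction
  case (tensor f)
  show ?case using assms(2)
  proof induction
    case (tensor f')
    have "(\<lambda>x. \<Prod>i<d. (\<lambda>y. f i y * f' i y) (x i)) \<in> tensor_span d"
      by (rule tensor_span.tensor) (intro tame_mult \<open>\<And>i. tame (f i)\<close> tensor)
    then show ?case by (simp add: prod.distrib)
  next
    case (sum g h)
    then show ?case using tensor_span.sum [OF sum.IH] by (simp add: distrib_left)
  qed
next
  case (sum g h)
  then show ?case using tensor_span.sum [OF sum.IH] by (simp add: distrib_right)
qed

lemma tensor_span_component:
  assumes "i < d" "tame f" shows "(\<lambda>x. f (x i)) \<in> tensor_span d"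
proof -
  have "(\<lambda>x. \<Prod>j<d. (if j = i then f else (\<lambda>_. 1)) (x j)) \<in> tensor_span d"
    by (rule tensor_span.tensor) (use assms tame_const in auto)
  moreover have "(\<Prod>j<d. (if j = i then f else (\<lambda>_. 1)) (x j)) = f (x i)" for x :: "nat \<Rightarrow> real"
  proof -
    have "(\<Prod>j<d. (if j = i then f else (\<lambda>_. 1)) (x j)) = (\<Prod>j<d. if j = i then f (x j) else 1)"
      by (intro prod.cong) auto
    then show ?thesis using assms(1) by (simp add: prod.delta)
  qed
  ultimately show ?thesis by simp
qed

lemma tensor_span_const: "d \<ge> 1 \<Longrightarrow> (\<lambda>_. c) \<in> tensor_span d"
  using tensor_span_component [of 0 d "\<lambda>_. c"] tame_const by simp

lemma tensor_span_cmult: "d \<ge> 1 \<Longrightarrow> g \<in> tensor_span d \<Longrightarrow> (\<lambda>x. c * g x) \<in> tensor_span d"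
  by (intro tensor_span_mult tensor_span_const)

definition gauss_Rn :: "nat \<Rightarrow> (nat \<Rightarrow> real) measure" where
  "gauss_Rn d = PiM {..<d} (\<lambda>_. gauss)"

text \<open>Position after time \<tau> of the diffusion started in \<open>x\<close>, with one
  standard Gaussian per coordinate as noise; \<open>restrict\<close> keeps it in
  \<open>Rn d\<close>.\<close>

definition geo_flow :: "real \<Rightarrow> real \<Rightarrow> nat \<Rightarrow> real \<Rightarrow> (nat \<Rightarrow> real) \<Rightarrow> (nat \<Rightarrow> real) \<Rightarrow> nat \<Rightarrow> real" where
  "geo_flow \<alpha> \<beta> d \<tau> x y = (\<lambda>i\<in>{..<d}. x i * geo \<alpha> \<beta> \<tau> (y i))"

text \<open>Only the law of the diffusion at the terminal time enters, so no Brownian path has to be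
  constructed.\<close>

definition feynman_kac :: "real \<Rightarrow> real \<Rightarrow> real \<Rightarrow> nat \<Rightarrow> ((nat \<Rightarrow> real) \<Rightarrow> real) \<Rightarrow> real \<times> (nat \<Rightarrow> real) \<Rightarrow> real" where
  "feynman_kac \<alpha> \<beta> T d g z = (\<integral>y. g (geo_flow \<alpha> \<beta> d (T - fst z) (snd z) y) \<partial>gauss_Rn d)"

lemma product_prob_space_gauss: "product_prob_space (\<lambda>_::nat. gauss)"
  by (intro product_prob_spaceI prob_space_gauss)

lemma prob_space_gauss_Rn: "prob_space (gauss_Rn d)"
  unfolding gauss_Rn_def by (intro prob_space_PiM prob_space_gauss)

text \<open>Independence of the coordinates: the expectation of the product factorises.\<close>

lemma feynman_kac_tensor:
  assumes f: "\<And>i. tame (f i)"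
  shows "integrable (gauss_Rn d) (\<lambda>y. \<Prod>i<d. f i (geo_flow \<alpha> \<beta> d \<tau> x y i))"
    and "feynman_kac \<alpha> \<beta> T d (\<lambda>x. \<Prod>i<d. f i (x i)) z = (\<Prod>i<d. geo_layer \<alpha> \<beta> T i (f i) 0 z)"
proof -
  interpret product_prob_space "\<lambda>_::nat. gauss" by (rule product_prob_space_gauss)
  have int: "integrable gauss (\<lambda>y. f i (x i * geo \<alpha> \<beta> \<tau> y))" for i \<tau> x
    using exp_bounded_integrable [OF exp_bounded_geo [OF f, where m = 0]] by simp
  have eq: "(\<Prod>i<d. f i (geo_flow \<alpha> \<beta> d \<tau> x y i)) = (\<Prod>i<d. f i (x i * geo \<alpha> \<beta> \<tau> (y i)))" for \<tau> x y
    by (intro prod.cong) (auto simp: geo_flow_def)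
  show "integrable (gauss_Rn d) (\<lambda>y. \<Prod>i<d. f i (geo_flow \<alpha> \<beta> d \<tau> x y i))"
    unfolding eq gauss_Rn_def by (rule product_integrable_prod [OF finite_lessThan int])
  show "feynman_kac \<alpha> \<beta> T d (\<lambda>x. \<Prod>i<d. f i (x i)) z = (\<Prod>i<d. geo_layer \<alpha> \<beta> T i (f i) 0 z)"
    unfolding feynman_kac_def eq gauss_Rn_def
    by (subst product_integral_prod [OF finite_lessThan int]) (simp add: geo_layer_def geo_mean_def)
qed

lemma tensor_span_integrable:
  assumes "g \<in> tensor_span d"
  shows "integrable (gauss_Rn d) (\<lambda>y. g (geo_flow \<alpha> \<beta> d \<tau> x y))"
  using assms by induction (auto intro: feynman_kac_tensor)

lemma feynman_kac_add:
  assumes "g \<in> tensor_span d" "h \<in> tensor_span d"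
  shows "feynman_kac \<alpha> \<beta> T d (\<lambda>x. g x + h x) = (\<lambda>z. feynman_kac \<alpha> \<beta> T d g z + feynman_kac \<alpha> \<beta> T d h z)"
  unfolding feynman_kac_def using tensor_span_integrable assms by (simp add: fun_eq_iff)

lemma feynman_kac_cmult: "feynman_kac \<alpha> \<beta> T d (\<lambda>x. c * g x) z = c * feynman_kac \<alpha> \<beta> T d g z"
  unfolding feynman_kac_def by simp

lemma feynman_kac_tensor_fun:
  assumes f: "\<And>i. tame (f i)"
  shows "feynman_kac \<alpha> \<beta> T d (\<lambda>x. \<Prod>i<d. f i (x i)) = (\<lambda>z. \<Prod>i<d. geo_layer \<alpha> \<beta> T i (f i) 0 z)"
  by (intro ext feynman_kac_tensor f)

lemma feynman_kac_continuous:
  assumes "g \<in> tensor_span d"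
  shows "continuous_on ({0..T} \<times> S) (feynman_kac \<alpha> \<beta> T d g)"
  using assms
proof induction
  case (tensor f)
  show ?case unfolding feynman_kac_tensor_fun [of f, OF tensor]
    by (intro continuous_intros geo_layer_continuous tensor)
next
  case (sum g h)
  show ?case unfolding feynman_kac_add [OF sum.hyps] by (intro continuous_intros sum.IH)
qed

lemma feynman_kac_poly_bounded:
  assumes "g \<in> tensor_span d"
  shows "poly_bounded_on T d (feynman_kac \<alpha> \<beta> T d g)"
  using assms
proof induction
  case (tensor f)
  show ?case unfolding feynman_kac_tensor_fun [of f, OF tensor]
    by (intro poly_bounded_on_prod geo_layer_poly_bounded tensor) auto
next
  case (sum g h)
  show ?case unfolding feynman_kac_add [OF sum.hyps] by (intro poly_bounded_on_add sum.IH)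
qed

lemma feynman_kac_Ck_on:
  assumes "g \<in> tensor_span d"
  shows "Ck_on n d ({0<..<T} \<times> Rn d) (feynman_kac \<alpha> \<beta> T d g)"
  using assms
proof induction
  case (tensor f)
  show ?case unfolding feynman_kac_tensor_fun [of f, OF tensor]
    by (intro Ck_on_prod [OF slicewise_open_cylinder] geo_layer_Ck_on tensor) auto
next
  case (sum g h)
  show ?case unfolding feynman_kac_add [OF sum.hyps] by (intro Ck_on_add [OF slicewise_open_cylinder] sum.IH)
qed

lemma feynman_kac_terminal: "x \<in> Rn d \<Longrightarrow> feynman_kac \<alpha> \<beta> T d g (T, x) = g x"
proof -
  assume "x \<in> Rn d"
  then have "geo_flow \<alpha> \<beta> d 0 x y = x" for y
    by (auto simp: geo_flow_def geo_def Rn_def PiE_def extensional_def restrict_def)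
  then show ?thesis using prob_space.prob_space [OF prob_space_gauss_Rn, of d] by (simp add: feynman_kac_def)
qed

text \<open>Each coordinate part of the operator acts on its own factor only, so the equation splits
  into \<open>d\<close> one-dimensional equations, each multiplied by the remaining factors.\<close>

lemma feynman_kac_parabolic:
  assumes "g \<in> tensor_span d" and z: "z \<in> {0<..<T} \<times> Rn d"
  shows "parabolic_op \<alpha> \<beta> d (feynman_kac \<alpha> \<beta> T d g) z = 0"
  using assms(1)
proof induction
  case (tensor f)
  let ?D = "{0<..<T} \<times> Rn d"
  note so = slicewise_open_cylinder [of d T]
  let ?L = "\<lambda>i. geo_layer \<alpha> \<beta> T i (f i) 0"
  let ?L1 = "\<lambda>i. geo_layer \<alpha> \<beta> T i (deriv (f i)) 1" and ?L2 = "\<lambda>i. geo_layer \<alpha> \<beta> T i (deriv (deriv (f i))) 2"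
  let ?R = "\<lambda>i z. \<Prod>j\<in>{..<d} - {i}. ?L j z"
  have split: "(\<lambda>z. \<Prod>j<d. ?L j z) = (\<lambda>z. ?L i z * ?R i z)" if "i < d" for i
    using that by (simp add: prod.remove fun_eq_iff)
  have R: "has_partial_on (Some i) ?D (?R i) (\<lambda>_. 0)" for i
    by (rule has_partial_on_indep) (auto simp: geo_layer_def intro!: prod.cong)
  have L: "has_partial_on (Some i) ?D (geo_layer \<alpha> \<beta> T i h m) (geo_layer \<alpha> \<beta> T i (deriv h) (Suc m))" if "tame h" for i h m
    using geo_layer_space_partial [OF that, of i T "Rn d" \<alpha> \<beta> i m] by simp
  have p0: "has_partial_on None ?D (\<lambda>z. \<Prod>j<d. ?L j z) (\<lambda>z. \<Sum>i<d. geo_layer_dt \<alpha> \<beta> T i (f i) 0 z * ?R i z)"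
    by (intro has_partial_on_prod geo_layer_time_partial tensor) auto
  have p1: "has_partial_on (Some i) ?D (\<lambda>z. \<Prod>j<d. ?L j z) (\<lambda>z. ?L1 i z * ?R i z)" if "i < d" for i
    unfolding split [OF that] using has_partial_on_mult [OF L [of "f i", OF tensor] R] by simp
  have p2: "has_partial_on (Some i) ?D (\<lambda>z. ?L1 i z * ?R i z) (\<lambda>z. ?L2 i z * ?R i z)" for i
    using has_partial_on_mult [OF L [of "deriv (f i)", OF tame_deriv [OF tensor], of i 1] R] by (simp add: numeral_2_eq_2)
  have "parabolic_op \<alpha> \<beta> d (\<lambda>z. \<Prod>j<d. ?L j z) z = (\<Sum>i<d. geo_layer_dt \<alpha> \<beta> T i (f i) 0 z * ?R i z) +
      (\<Sum>i<d. \<beta>\<^sup>2 * \<bar>snd z i\<bar>\<^sup>2 / 2 * (?L2 i z * ?R i z)) + (\<Sum>i<d. \<alpha> * snd z i * (?L1 i z * ?R i z))"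
    by (rule parabolic_op_eqI [OF so z p0 p1 p2])
  also have "\<dots> = (\<Sum>i<d. geo_layer_dt \<alpha> \<beta> T i (f i) 0 z * ?R i z + \<beta>\<^sup>2 * \<bar>snd z i\<bar>\<^sup>2 / 2 * (?L2 i z * ?R i z) + \<alpha> * snd z i * (?L1 i z * ?R i z))"
    by (simp add: sum.distrib)
  also have "\<dots> = 0"
  proof (rule sum.neutral, rule ballI)
    fix i
    \<comment> \<open>At \<open>m = 0\<close> the drift correction
      \<open>- \<beta>\<^sup>2 / 2\<close> cancels against the first-order part of the second
      logarithmic derivative.\<close>
    have "geo_layer_dt \<alpha> \<beta> T i (f i) 0 z + \<beta>\<^sup>2 * \<bar>snd z i\<bar>\<^sup>2 / 2 * ?L2 i z + \<alpha> * snd z i * ?L1 i z = 0"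
      by (simp add: geo_layer_dt_def algebra_simps numeral_2_eq_2)
    then have "(geo_layer_dt \<alpha> \<beta> T i (f i) 0 z + \<beta>\<^sup>2 * \<bar>snd z i\<bar>\<^sup>2 / 2 * ?L2 i z + \<alpha> * snd z i * ?L1 i z) * ?R i z = 0" by simp
    then show "geo_layer_dt \<alpha> \<beta> T i (f i) 0 z * ?R i z + \<beta>\<^sup>2 * \<bar>snd z i\<bar>\<^sup>2 / 2 * (?L2 i z * ?R i z) + \<alpha> * snd z i * (?L1 i z * ?R i z) = 0"
      by (simp only: distrib_right mult.assoc)
  qed
  finally show ?case unfolding feynman_kac_tensor_fun [of f, OF tensor] .
next
  case (sum g h)
  show ?case unfolding feynman_kac_add [OF sum.hyps]
    by (simp add: parabolic_op_add [OF slicewise_open_cylinder z feynman_kac_Ck_on feynman_kac_Ck_on] sum)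
qed

section \<open>Density of tensor products\<close>

text \<open>A product and not a power of the norm, so that it belongs to \<open>tensor_span\<close>
  and is propagated to a classical solution.\<close>

definition weight :: "nat \<Rightarrow> nat \<Rightarrow> (nat \<Rightarrow> real) \<Rightarrow> real" where
  "weight d q x = (\<Prod>i<d. (1 + (x i)\<^sup>2) ^ q)"

lemma tame_weight_factor: "tame (\<lambda>y. (1 + y\<^sup>2) ^ q)"
  by (intro tame_power tame_add tame_const tame_ident)

lemma weight_tensor_span: "weight d q \<in> tensor_span d"
  unfolding weight_def [abs_def] by (rule tensor_span.tensor) (rule tame_weight_factor)

lemma weight_ge_1: "weight d q x \<ge> 1"
  unfolding weight_def by (intro prod_ge_1 one_le_power) simp

lemma weight_pos: "weight d q x > 0"
  using weight_ge_1 [of d q x] by linarith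

lemma weight_power: "weight d q x = weight d 1 x ^ q"
  by (simp add: weight_def prod_power_distrib)

lemma weight_Suc: "weight d (Suc q) x = weight d 1 x * weight d q x"
  by (simp add: weight_def prod.distrib)

lemma one_plus_sum_le_prod:
  fixes f :: "'a \<Rightarrow> real"
  assumes "finite I" "\<And>i. i \<in> I \<Longrightarrow> f i \<ge> 0"
  shows "1 + (\<Sum>i\<in>I. f i) \<le> (\<Prod>i\<in>I. 1 + f i)"
  using assms
proof (induction I rule: finite_induct)
  case (insert a I)
  then have IH: "1 + (\<Sum>i\<in>I. f i) \<le> (\<Prod>i\<in>I. 1 + f i)" and n: "f a \<ge> 0" "(\<Sum>i\<in>I. f i) \<ge> 0"
    by (auto intro: sum_nonneg)
  have "1 + (f a + (\<Sum>i\<in>I. f i)) \<le> (1 + f a) * (1 + (\<Sum>i\<in>I. f i))"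
    using mult_nonneg_nonneg [OF n] by (simp add: algebra_simps)
  also have "\<dots> \<le> (1 + f a) * (\<Prod>i\<in>I. 1 + f i)" using n IH by (intro mult_left_mono) auto
  finally show ?case using insert by simp
qed simp

text \<open>Coordinatewise 1 + |s| is at most 2(1 + s^2). The resulting 2^d is harmless, since the
  weight serves existence and uniqueness and not the rate of approximation.\<close>

lemma norm_Rn_le_weight: "1 + norm_Rn d x \<le> 2 ^ d * weight d 1 x"
proof -
  have "norm_Rn d x \<le> (\<Sum>i<d. \<bar>x i\<bar>)" unfolding norm_Rn_def by (rule L2_set_le_sum_abs)
  then have "1 + norm_Rn d x \<le> (\<Prod>i<d. 1 + \<bar>x i\<bar>)"
    using one_plus_sum_le_prod [of "{..<d}" "\<lambda>i. \<bar>x i\<bar>"] by simp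
  also have "\<dots> \<le> (\<Prod>i<d. 2 * (1 + (x i)\<^sup>2))"
  proof (intro prod_mono conjI)
    fix i
    have "0 \<le> (\<bar>x i\<bar> - 1)\<^sup>2" by simp
    then have "2 * \<bar>x i\<bar> \<le> 1 + (x i)\<^sup>2" unfolding power2_diff by simp
    then have "2 * (1 + \<bar>x i\<bar>) \<le> 2 * (2 * (1 + (x i)\<^sup>2))" using zero_le_power2 [of "x i"]
      unfolding distrib_left by linarith
    then show "1 + \<bar>x i\<bar> \<le> 2 * (1 + (x i)\<^sup>2)" by simp
  qed simp
  also have "\<dots> = 2 ^ d * weight d 1 x" by (simp only: weight_def prod.distrib prod_constant card_lessThan power_one_right)
  finally show ?thesis .
qed

lemma norm_Rn_power_le_weight: "(1 + norm_Rn d x) ^ N \<le> 2 ^ (d * N) * weight d N x"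
proof -
  have "(1 + norm_Rn d x) ^ N \<le> (2 ^ d * weight d 1 x) ^ N"
    by (intro power_mono norm_Rn_le_weight) simp
  then show ?thesis by (simp add: power_mult_distrib weight_power [of d N] power_mult)
qed

section \<open>Compactification of R^d and weighted density\<close>

lemma compact_PiE_lessThan:
  fixes K :: "nat \<Rightarrow> real set"
  assumes "\<And>i. compact (K i)"
  shows "compact (PiE {..<d} K)"
proof -
  have eq: "PiE {..<d} K = PiE UNIV (\<lambda>i. if i < d then K i else {undefined})"
    by (auto simp: PiE_def extensional_def Pi_def split: if_splits)
  have "compactin (product_topology (\<lambda>i. euclidean) UNIV) (PiE UNIV (\<lambda>i. if i < d then K i else {undefined}))"
    by (subst compactin_PiE) (use assms in auto)
  then show ?thesis unfolding eq by (simp add: euclidean_product_topology)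
qed

lemma Rn_subset: "PiE {..<d} K \<subseteq> Rn d"
  unfolding Rn_def by (intro PiE_mono) auto

lemma restrict_in_Rn [simp]: "(\<lambda>i\<in>{..<d}. f i) \<in> Rn d"
  by (simp add: Rn_def)

lemma continuous_on_restrict_lessThan:
  assumes "\<And>i. i < d \<Longrightarrow> continuous_on S (\<lambda>x. f x i)"
  shows "continuous_on S (\<lambda>x. (\<lambda>i\<in>{..<d}. f x i :: real))"
proof (rule continuous_on_coordinatewise_then_product)
  fix i
  show "continuous_on S (\<lambda>x. (\<lambda>i\<in>{..<d}. f x i) i)"
    using assms by (cases "i < d") auto
qed

lemma continuous_on_component: "continuous_on S (\<lambda>x :: nat \<Rightarrow> real. x i)"
  by (rule continuous_on_product_then_coordinatewise [OF continuous_on_id])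

text \<open>Functions on $\mathbb{R}^d$ are transported to the compact cube $[-\pi/2,\pi/2]^d$ by the arc tangent, where the
  Stone-Weierstrass theorem applies.\<close>

lemma function_ring_arctan:
  assumes "d \<ge> 1"
  shows "function_ring_on {g. continuous_on (PiE {..<d} (\<lambda>_. {-pi/2..pi/2})) g \<and>
      (\<lambda>x. g (\<lambda>i\<in>{..<d}. arctan (x i))) \<in> tensor_span d} (PiE {..<d} (\<lambda>_. {-pi/2..pi/2}))"
proof (rule function_ring_on.intro)
  let ?S = "PiE {..<d} (\<lambda>_. {-pi/2..pi/2::real})"
  show "compact ?S" by (rule compact_PiE_lessThan) simp
  fix x y assume xy: "x \<in> ?S" "y \<in> ?S" "x \<noteq> y"
  then obtain i where i: "i < d" "x i \<noteq> y i" by (metis PiE_ext lessThan_iff)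
  \<comment> \<open>The coordinate functions separate the points of the cube; pulled back to R^d
    they are arc tangents.\<close>
  have "(\<lambda>x. arctan (x i)) \<in> tensor_span d" by (rule tensor_span_component [OF i(1) tame_arctan])
  then show "\<exists>f\<in>{g. continuous_on ?S g \<and> (\<lambda>x. g (\<lambda>i\<in>{..<d}. arctan (x i))) \<in> tensor_span d}. f x \<noteq> f y"
    using i by (intro bexI [of _ "\<lambda>y. y i"]) (auto intro: continuous_on_component)
qed (use assms tensor_span.sum tensor_span_mult tensor_span_const in \<open>auto intro!: continuous_intros\<close>)

definition clip :: "real \<Rightarrow> real \<Rightarrow> real" where
  "clip r y = max (- r) (min r y)"

text \<open>The arc tangent is increasing and odd, hence commutes with clipping.\<close>

lemma clip_arctan:
  assumes "r \<ge> 0" shows "tan (clip (arctan r) (arctan y)) = clip r y"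
proof -
  have "clip (arctan r) (arctan y) = arctan (clip r y)"
    by (auto simp: clip_def max_def min_def arctan_minus [symmetric] arctan_le_iff simp del: arctan_minus)
  then show ?thesis by (simp add: tan_arctan)
qed

text \<open>One power of the weight beyond the growth of \<phi> makes the quotient \<psi> vanish at
  infinity. Clipping all coordinates then changes \<psi> little, the clipped function extends
  continuously to the closed cube, and an approximant found there is multiplied back by the
  weight.\<close>

lemma tensor_span_dense:
  assumes d: "d \<ge> 1" and \<phi>: "continuous_on (Rn d) \<phi>" and C: "\<And>x. x \<in> Rn d \<Longrightarrow> \<bar>\<phi> x\<bar> \<le> C * (1 + norm_Rn d x) ^ N"
    and \<epsilon>: "\<epsilon> > 0"
  shows "\<exists>g\<in>tensor_span d. \<forall>x\<in>Rn d. \<bar>\<phi> x - g x\<bar> \<le> \<epsilon> * weight d (Suc N) x"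
proof -
  let ?S = "PiE {..<d} (\<lambda>_. {-pi/2..pi/2::real})" and ?W = "weight d (Suc N)"
  define A where "A = C * 2 ^ (d * N)"
  \<comment> \<open>The sign of \<open>C\<close> is read off from the bound at the origin.\<close>
  have C0: "C \<ge> 0"
  proof -
    have "0 \<le> C * (1 + norm_Rn d (\<lambda>i\<in>{..<d}. 0)) ^ N" using C [of "\<lambda>i\<in>{..<d}. 0"] by (simp add: order_trans [OF abs_ge_zero])
    moreover have "(1 + norm_Rn d (\<lambda>i\<in>{..<d}. 0)) ^ N > 0" by (simp add: add_pos_nonneg)
    ultimately show ?thesis by (simp add: zero_le_mult_iff)
  qed
  define \<psi> where "\<psi> x = \<phi> x / ?W x" for x
  have \<psi>: "\<bar>\<psi> x\<bar> \<le> A / (1 + (x j)\<^sup>2)" if "x \<in> Rn d" "j < d" for x j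
  proof -
    have "1 + (x j)\<^sup>2 \<le> weight d 1 x"
    proof -
      have "weight d 1 x = (1 + (x j)\<^sup>2) * (\<Prod>i\<in>{..<d} - {j}. 1 + (x i)\<^sup>2)"
        using that by (simp add: weight_def prod.remove)
      moreover have "(\<Prod>i\<in>{..<d} - {j}. 1 + (x i)\<^sup>2) \<ge> 1" by (intro prod_ge_1) simp
      ultimately show ?thesis using mult_left_mono [of 1 "\<Prod>i\<in>{..<d} - {j}. 1 + (x i)\<^sup>2" "1 + (x j)\<^sup>2"] by simp
    qed
    moreover have "\<bar>\<phi> x\<bar> \<le> A * weight d N x"
      unfolding A_def mult.assoc using C [OF that(1)] mult_left_mono [OF norm_Rn_power_le_weight C0] order_trans by blast
    ultimately have "\<bar>\<phi> x\<bar> * (1 + (x j)\<^sup>2) \<le> (A * weight d N x) * weight d 1 x"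
      by (intro mult_mono) (auto simp: A_def C0 less_imp_le [OF weight_pos])
    then have "\<bar>\<phi> x\<bar> * (1 + (x j)\<^sup>2) \<le> A * ?W x" unfolding weight_Suc [of d N] by (simp only: mult_ac)
    moreover have "1 + (x j)\<^sup>2 > 0" by (simp add: add_pos_nonneg)
    ultimately show ?thesis using weight_pos [of d "Suc N" x] by (simp add: \<psi>_def abs_divide field_simps)
  qed
  have \<psi>c: "continuous_on (Rn d) \<psi>"
    unfolding \<psi>_def weight_def
    by (intro continuous_intros \<phi> continuous_on_component) (auto simp: add_nonneg_eq_0_iff)
  \<comment> \<open>The radius from which on |\<psi>| is at most \<epsilon>/4. A clipped point has a
    coordinate equal to \<open>r\<close> or \<open>- r\<close>, so the bound covers both points
    compared in \<open>\<psi>K\<close>.\<close>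
  define r where "r = sqrt (4 * A / \<epsilon>)"
  have r: "r \<ge> 0" "A / (1 + r\<^sup>2) \<le> \<epsilon> / 4"
  proof -
    have A0: "A \<ge> 0" using C0 by (simp add: A_def)
    then show "r \<ge> 0" using \<epsilon> by (simp add: r_def)
    have "r\<^sup>2 = 4 * A / \<epsilon>" using A0 \<epsilon> by (simp add: r_def)
    then have "4 * A = \<epsilon> * r\<^sup>2" using \<epsilon> by simp
    then have "4 * A \<le> \<epsilon> * (1 + r\<^sup>2)" using \<epsilon> by (simp add: distrib_left)
    moreover have "1 + r\<^sup>2 > 0" by (simp add: add_pos_nonneg)
    ultimately show "A / (1 + r\<^sup>2) \<le> \<epsilon> / 4" by (simp add: field_simps)
  qed
  define K where "K x = (\<lambda>i\<in>{..<d}. clip r (x i))" for x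
  have \<psi>K: "\<bar>\<psi> x - \<psi> (K x)\<bar> \<le> \<epsilon> / 2" if x: "x \<in> Rn d" for x
  proof (cases "\<forall>i<d. \<bar>x i\<bar> \<le> r")
    case True
    have "K x i = x i" for i
      using True x by (cases "i < d") (auto simp: K_def clip_def Rn_def PiE_def extensional_def)
    then have "K x = x" by blast
    then show ?thesis using \<epsilon> by simp
  next
    case False
    then obtain j where j: "j < d" "\<bar>x j\<bar> > r" by auto
    then have "clip r (x j) = r \<or> clip r (x j) = - r" using r(1) by (simp add: clip_def max_def min_def) linarith
    then have e: "(K x j)\<^sup>2 = r\<^sup>2" using j(1) by (auto simp: K_def)
    have "K x \<in> Rn d" by (simp add: K_def)
    from \<psi> [OF this j(1), unfolded e] r(2) have "\<bar>\<psi> (K x)\<bar> \<le> \<epsilon> / 4" by linarith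
    moreover have "\<bar>\<psi> x\<bar> \<le> \<epsilon> / 4"
    proof -
      have "r\<^sup>2 \<le> (x j)\<^sup>2" using power_mono [of r "\<bar>x j\<bar>" 2] j r by simp
      then have "A / (1 + (x j)\<^sup>2) \<le> A / (1 + r\<^sup>2)" using C0 by (intro divide_left_mono mult_pos_pos add_pos_nonneg) (auto simp: A_def)
      then show ?thesis using \<psi> [OF x j(1)] r by linarith
    qed
    ultimately show ?thesis by linarith
  qed
  \<comment> \<open>\<open>H\<close> inverts the arc tangent up to clipping. Clipping at
    \<open>arctan r\<close> keeps \<open>tan\<close> off its poles, which lie on the faces of the
    cube.\<close>
  define H where "H y = (\<lambda>i\<in>{..<d}. tan (clip (arctan r) (y i)))" for y
  have Hc: "continuous_on ?S H"
    unfolding H_def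
  proof (rule continuous_on_restrict_lessThan)
    fix i
    have b: "- (pi / 2) < clip (arctan r) y \<and> clip (arctan r) y < pi / 2" for y
      using arctan_bounded [of r] by (auto simp: clip_def max_def min_def)
    have cosn: "cos (clip (arctan r) y) \<noteq> 0" for y
      using b [of y] cos_gt_zero_pi [of "clip (arctan r) y"] by simp
    have c: "continuous_on ?S (\<lambda>y. clip (arctan r) (y i))"
      unfolding clip_def by (intro continuous_intros continuous_on_component)
    show "continuous_on ?S (\<lambda>y. tan (clip (arctan r) (y i)))"
    proof (rule continuous_on_compose2 [OF _ c])
      show "continuous_on {y::real. cos y \<noteq> 0} tan" by (rule continuous_on_tan) simp
    qed (use cosn in auto)
  qed
  have "continuous_on ?S (\<lambda>y. \<psi> (H y))"
    by (rule continuous_on_compose2 [OF \<psi>c Hc]) (simp only: H_def restrict_in_Rn image_subset_iff ball_simps simp_thms ball_triv)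
  then obtain P where P: "(\<lambda>x. P (\<lambda>i\<in>{..<d}. arctan (x i))) \<in> tensor_span d" "\<And>y. y \<in> ?S \<Longrightarrow> \<bar>\<psi> (H y) - P y\<bar> < \<epsilon> / 2"
    using function_ring_on.Stone_Weierstrass_basic [OF function_ring_arctan [OF d], of "\<lambda>y. \<psi> (H y)" "\<epsilon> / 2"] \<epsilon> by auto
  let ?g = "\<lambda>x. ?W x * P (\<lambda>i\<in>{..<d}. arctan (x i))"
  show ?thesis
  proof (rule bexI [of _ ?g], rule ballI)
    show "?g \<in> tensor_span d" by (intro tensor_span_mult weight_tensor_span P)
    fix x assume x: "x \<in> Rn d"
    let ?y = "\<lambda>i\<in>{..<d}. arctan (x i)"
    have y: "?y \<in> ?S" using arctan_bounded by (auto intro!: less_imp_le)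
    have Hy: "H ?y = K x" unfolding H_def K_def using clip_arctan [OF r(1)] by (auto simp: restrict_def)
    have "\<bar>\<psi> x - P ?y\<bar> \<le> \<epsilon>" using \<psi>K [OF x] P(2) [OF y, unfolded Hy] by linarith
    then have "?W x * \<bar>\<psi> x - P ?y\<bar> \<le> ?W x * \<epsilon>" by (rule mult_left_mono) (rule less_imp_le [OF weight_pos])
    moreover have "?W x * \<bar>\<psi> x - P ?y\<bar> = \<bar>\<phi> x - ?g x\<bar>"
      using weight_pos [of d "Suc N" x] by (simp add: \<psi>_def abs_mult_pos' right_diff_distrib)
    ultimately show "\<bar>\<phi> x - ?g x\<bar> \<le> \<epsilon> * ?W x" by (simp add: mult.commute)
  qed
qed

section \<open>The comparison principle\<close>

text \<open>Half of the notion of solution; by linearity of the operator the other half is the same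
  property of \<open>- u\<close>, so all arguments are one-sided.\<close>

definition viscosity_sub :: "real \<Rightarrow> real \<Rightarrow> real \<Rightarrow> nat \<Rightarrow> (real \<times> (nat \<Rightarrow> real) \<Rightarrow> real) \<Rightarrow> bool" where
  "viscosity_sub T \<alpha> \<beta> d u \<longleftrightarrow> (\<forall>z\<in>{0<..<T} \<times> Rn d. \<forall>h.
     Ck_on 2 d ({0<..<T} \<times> Rn d) h \<longrightarrow> (\<forall>w\<in>{0<..<T} \<times> Rn d. u w \<le> h w) \<longrightarrow> h z = u z \<longrightarrow> 0 \<le> parabolic_op \<alpha> \<beta> d h z)"

lemma viscosity_solution_iff_sub:
  "viscosity_solution T \<alpha> \<beta> d u \<longleftrightarrow> viscosity_sub T \<alpha> \<beta> d u \<and> viscosity_sub T \<alpha> \<beta> d (\<lambda>z. - u z)"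
proof -
  let ?D = "{0<..<T} \<times> Rn d"
  have neg: "Ck_on 2 d ?D (\<lambda>z. - h z) \<and> (z \<in> ?D \<longrightarrow> parabolic_op \<alpha> \<beta> d (\<lambda>z. - h z) z = - parabolic_op \<alpha> \<beta> d h z)"
    if "Ck_on 2 d ?D h" for h z
    using Ck_on_mult [OF slicewise_open_cylinder Ck_on_const [OF slicewise_open_cylinder] that, of "-1"]
      parabolic_op_cmult [OF slicewise_open_cylinder _ that, of z \<alpha> \<beta> "-1"] by simp
  have "viscosity_sub T \<alpha> \<beta> d (\<lambda>z. - u z) \<longleftrightarrow> (\<forall>z\<in>?D. \<forall>h. Ck_on 2 d ?D h \<longrightarrow> (\<forall>w\<in>?D. h w \<le> u w) \<longrightarrow> h z = u z \<longrightarrow> parabolic_op \<alpha> \<beta> d h z \<le> 0)"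
    (is "?l \<longleftrightarrow> ?r")
  proof
    assume l: ?l
    show ?r
    proof (intro ballI allI impI)
      fix z h assume *: "z \<in> ?D" "Ck_on 2 d ?D h" "\<forall>w\<in>?D. h w \<le> u w" "h z = u z"
      have A: "- u w \<le> - h w" if "w \<in> ?D" for w using *(3) that by (metis neg_le_iff_le)
      have B: "- h z = - u z" using *(4) by simp
      have "0 \<le> parabolic_op \<alpha> \<beta> d (\<lambda>z. - h z) z"
        by (rule l [unfolded viscosity_sub_def, rule_format, OF *(1) conjunct1 [OF neg [OF *(2)]] A B])
      then show "parabolic_op \<alpha> \<beta> d h z \<le> 0" using neg [OF *(2)] * by auto
    qed
  next
    assume r: ?r
    show ?l unfolding viscosity_sub_def
    proof (intro ballI allI impI)
      fix z h assume *: "z \<in> ?D" "Ck_on 2 d ?D h" "\<forall>w\<in>?D. - u w \<le> h w" "h z = - u z"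
      have A: "- h w \<le> u w" if "w \<in> ?D" for w
      proof -
        have "- u w \<le> h w" using *(3) that by blast
        then show ?thesis by linarith
      qed
      have B: "- h z = u z" using *(4) by simp
      have "parabolic_op \<alpha> \<beta> d (\<lambda>z. - h z) z \<le> 0"
        by (rule r [rule_format, OF *(1) conjunct1 [OF neg [OF *(2)]] A B])
      then show "0 \<le> parabolic_op \<alpha> \<beta> d h z" using neg [OF *(2)] * by auto
    qed
  qed
  then show ?thesis
    unfolding viscosity_solution_def Let_def viscosity_sub_def parabolic_op_def by blast
qed

text \<open>(1 + x^2)^q is comparable with 1 + x^(2q), whose expectation is explicit; the moments
  exp(\<kappa>\<tau>) stay above exp(-|\<kappa>|T).\<close>

lemma geo_mean_weight_lower:
  obtains c where "c > 0" "\<And>\<tau> x. 0 \<le> \<tau> \<Longrightarrow> \<tau> \<le> T \<Longrightarrow> c * (1 + x\<^sup>2) ^ q \<le> geo_mean \<alpha> \<beta> (\<lambda>y. (1 + y\<^sup>2) ^ q) 0 \<tau> x"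
proof
  define \<kappa> where "\<kappa> = real (2 * q) * \<alpha> + real (2 * q) * (real (2 * q) - 1) * \<beta>\<^sup>2 / 2"
  \<comment> \<open>The factor 2^q comes from bounding (1 + x^2)^q by 2^q (1 + x^(2q)), one more 2
    from bounding (1 + s^q)/2 by (1 + s)^q.\<close>
  define c where "c = exp (- \<bar>\<kappa>\<bar> * T) / 2 ^ (q + 1)"
  show "c > 0" by (simp add: c_def)
  fix \<tau> x :: real assume \<tau>: "0 \<le> \<tau>" "\<tau> \<le> T"
  have "- \<bar>\<kappa>\<bar> * T \<le> - \<bar>\<kappa>\<bar> * \<tau>" using \<tau> by (simp add: mult_left_mono)
  also have "\<dots> \<le> \<kappa> * \<tau>" using \<tau> by (intro mult_right_mono) auto
  finally have m: "exp (- \<bar>\<kappa>\<bar> * T) \<le> (\<integral>z. geo \<alpha> \<beta> \<tau> z ^ (2 * q) \<partial>gauss)"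
    using geo_moment [OF \<tau>(1), of \<alpha> \<beta> "2 * q"] by (simp add: \<kappa>_def)
  have one: "exp (- \<bar>\<kappa>\<bar> * T) \<le> 1" using \<tau> by simp
  have xq: "x ^ (2 * q) \<ge> 0" by (simp add: power_mult)
  have "(1 + x\<^sup>2) ^ q \<le> (2 * max 1 (x\<^sup>2)) ^ q" by (intro power_mono) auto
  also have "\<dots> = 2 ^ q * (max 1 (x\<^sup>2)) ^ q" by (simp add: power_mult_distrib)
  also have "\<dots> \<le> 2 ^ q * (1 + x ^ (2 * q))"
    using xq by (intro mult_left_mono) (auto simp: max_def power_mult)
  finally have "c * (1 + x\<^sup>2) ^ q \<le> c * (2 ^ q * (1 + x ^ (2 * q)))" by (intro mult_left_mono) (auto simp: c_def)
  also have "\<dots> = (exp (- \<bar>\<kappa>\<bar> * T) + x ^ (2 * q) * exp (- \<bar>\<kappa>\<bar> * T)) / 2" by (simp add: c_def field_simps)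
  also have "\<dots> \<le> (1 + x ^ (2 * q) * (\<integral>z. geo \<alpha> \<beta> \<tau> z ^ (2 * q) \<partial>gauss)) / 2"
    by (intro divide_right_mono add_mono one mult_left_mono [OF m xq]) simp
  also have "\<dots> = (\<integral>z. (1 + x ^ (2 * q) * (geo \<alpha> \<beta> \<tau> z ^ (2 * q))) / 2 \<partial>gauss)"
  proof -
    have i: "integrable gauss (\<lambda>z. geo \<alpha> \<beta> \<tau> z ^ (2 * q))"
      using exp_bounded_integrable [OF exp_bounded_geo [OF tame_const [of 1], where m = "2 * q" and \<alpha> = \<alpha> and \<beta> = \<beta> and \<tau> = \<tau>]] by simp
    have "(\<integral>z. 1 + x ^ (2 * q) * (geo \<alpha> \<beta> \<tau> z ^ (2 * q)) \<partial>gauss) = 1 + x ^ (2 * q) * (\<integral>z. geo \<alpha> \<beta> \<tau> z ^ (2 * q) \<partial>gauss)"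
      by (subst Bochner_Integration.integral_add, rule exp_bounded_integrable [OF exp_bounded_const], rule integrable_mult_right [OF i]) simp
    then show ?thesis by (simp only: integral_divide_zero)
  qed
  also have "\<dots> \<le> geo_mean \<alpha> \<beta> (\<lambda>y. (1 + y\<^sup>2) ^ q) 0 \<tau> x"
    unfolding geo_mean_def
  proof (rule integral_mono)
    show "integrable gauss (\<lambda>z. (1 + (x * geo \<alpha> \<beta> \<tau> z)\<^sup>2) ^ q * geo \<alpha> \<beta> \<tau> z ^ 0)"
      by (rule exp_bounded_integrable [OF exp_bounded_geo [OF tame_weight_factor]])
    show "integrable gauss (\<lambda>z. (1 + x ^ (2 * q) * geo \<alpha> \<beta> \<tau> z ^ (2 * q)) / 2)"
    proof -
      have "exp_bounded (\<lambda>z. (1 + x ^ (2 * q) * ((\<lambda>_. 1) (x * geo \<alpha> \<beta> \<tau> z) * geo \<alpha> \<beta> \<tau> z ^ (2 * q))) * (1 / 2))"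
        by (intro exp_bounded_mult exp_bounded_add exp_bounded_const exp_bounded_geo tame_const)
      from exp_bounded_integrable [OF this] show ?thesis by simp
    qed
    fix z
    have "1 \<le> (1 + (x * geo \<alpha> \<beta> \<tau> z)\<^sup>2) ^ q" by (intro one_le_power) simp
    moreover have "((x * geo \<alpha> \<beta> \<tau> z)\<^sup>2) ^ q \<le> (1 + (x * geo \<alpha> \<beta> \<tau> z)\<^sup>2) ^ q" by (intro power_mono) auto
    ultimately have "1 + ((x * geo \<alpha> \<beta> \<tau> z)\<^sup>2) ^ q \<le> (1 + (x * geo \<alpha> \<beta> \<tau> z)\<^sup>2) ^ q + (1 + (x * geo \<alpha> \<beta> \<tau> z)\<^sup>2) ^ q"
      by (rule add_mono)
    then have "(1 + ((x * geo \<alpha> \<beta> \<tau> z)\<^sup>2) ^ q) / 2 \<le> (1 + (x * geo \<alpha> \<beta> \<tau> z)\<^sup>2) ^ q" by simp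
    then show "(1 + x ^ (2 * q) * geo \<alpha> \<beta> \<tau> z ^ (2 * q)) / 2 \<le> (1 + (x * geo \<alpha> \<beta> \<tau> z)\<^sup>2) ^ q * geo \<alpha> \<beta> \<tau> z ^ 0"
      by (simp add: power_mult [symmetric] power_mult_distrib)
  qed
  finally show "c * (1 + x\<^sup>2) ^ q \<le> geo_mean \<alpha> \<beta> (\<lambda>y. (1 + y\<^sup>2) ^ q) 0 \<tau> x" .
qed

text \<open>The propagated weight is a positive classical solution that dominates any given power of the norm;
  it replaces the usual polynomial barrier function in the comparison principle.\<close>

lemma feynman_kac_weight_lower:
  obtains c where "c > 0" "\<And>t x. t \<in> {0..T} \<Longrightarrow> c * (1 + norm_Rn d x) ^ q \<le> feynman_kac \<alpha> \<beta> T d (weight d q) (t, x)"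
proof -
  obtain c where c: "c > 0" "\<And>\<tau> x. 0 \<le> \<tau> \<Longrightarrow> \<tau> \<le> T \<Longrightarrow> c * (1 + x\<^sup>2) ^ q \<le> geo_mean \<alpha> \<beta> (\<lambda>y. (1 + y\<^sup>2) ^ q) 0 \<tau> x"
    by (rule geo_mean_weight_lower [where T = T and q = q and \<alpha> = \<alpha> and \<beta> = \<beta>]) (use that in blast)
  show thesis
  proof
    show "c ^ d / 2 ^ (d * q) > 0" using c by simp
    fix t x assume t: "t \<in> {0..T}"
    have "c ^ d / 2 ^ (d * q) * (1 + norm_Rn d x) ^ q \<le> c ^ d / 2 ^ (d * q) * (2 ^ (d * q) * weight d q x)"
      using c by (intro mult_left_mono norm_Rn_power_le_weight) simp
    also have "\<dots> = (\<Prod>i<d. c * (1 + (x i)\<^sup>2) ^ q)" by (simp add: weight_def prod.distrib)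
    also have "\<dots> \<le> (\<Prod>i<d. geo_layer \<alpha> \<beta> T i (\<lambda>y. (1 + y\<^sup>2) ^ q) 0 (t, x))"
      using c t by (intro prod_mono) (auto simp: geo_layer_def)
    also have "\<dots> = feynman_kac \<alpha> \<beta> T d (weight d q) (t, x)"
      unfolding weight_def [abs_def] by (rule feynman_kac_tensor(2) [symmetric]) (rule tame_weight_factor)
    finally show "c ^ d / 2 ^ (d * q) * (1 + norm_Rn d x) ^ q \<le> feynman_kac \<alpha> \<beta> T d (weight d q) (t, x)" .
  qed
qed

text \<open>The function 1/t does two things in the comparison: it keeps minima away from t = 0,
  where no boundary values are prescribed, and its derivative makes the supersolution
  strict.\<close>

lemma inverse_time_Ck_on:
  "Ck_on n d ({0<..<T} \<times> Rn d) (\<lambda>z. inverse (fst z))"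
  "z \<in> {0<..<T} \<times> Rn d \<Longrightarrow> parabolic_op \<alpha> \<beta> d (\<lambda>z. inverse (fst z)) z = - (inverse (fst z) * inverse (fst z))"
proof -
  let ?D = "{0<..<T} \<times> Rn d"
  note so = slicewise_open_cylinder [of d T]
  let ?h = "\<lambda>k z. if k = None then -1 * (inverse (fst z) * inverse (fst z)) else (0::real)"
  have P: "has_partial_on k ?D (\<lambda>z. inverse (fst z)) (?h k)" for k
  proof (cases k)
    case None
    show ?thesis unfolding has_partial_on_def
      using None by (auto intro!: derivative_eq_intros)
  qed (auto simp: has_partial_on_def)
  show "Ck_on n d ?D (\<lambda>z. inverse (fst z))"
  proof (induction n)
    case 0
    show ?case by (auto intro!: continuous_intros)
  next
    case (Suc n)
    show ?case
    proof (rule Ck_on_SucI [OF so _ P])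
      show "continuous_on ?D (\<lambda>z. inverse (fst z))" by (auto intro!: continuous_intros)
      show "Ck_on n d ?D (?h k)" for k
        using Ck_on_mult [OF so Ck_on_const [OF so] Ck_on_mult [OF so Suc Suc], of "-1"] Ck_on_const [OF so]
        by (cases k) simp_all
    qed
  qed
  assume z: "z \<in> ?D"
  have "has_partial_on (Some i) ?D (?h (Some i)) (\<lambda>_. 0)" for i
    by (simp add: has_partial_on_const)
  from parabolic_op_eqI [where ?h0.0 = "?h None" and ?h1.0 = "\<lambda>i. ?h (Some i)" and ?h2.0 = "\<lambda>_ _. 0", OF so z P P this]
  show "parabolic_op \<alpha> \<beta> d (\<lambda>z. inverse (fst z)) z = - (inverse (fst z) * inverse (fst z))" by simp
qed

lemma norm_box: "x \<in> Rn d \<Longrightarrow> norm_Rn d x \<le> R \<Longrightarrow> x \<in> PiE {..<d} (\<lambda>_. {-R..R})"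
proof -
  assume x: "x \<in> Rn d" and R: "norm_Rn d x \<le> R"
  have "x i \<in> {-R..R}" if "i < d" for i
    using abs_le_norm_Rn [OF that, of x] R by (simp add: abs_le_iff)
  then show ?thesis using x by (simp add: Rn_def PiE_def)
qed

text \<open>A perturbed classical solution is itself the test function. If it fell below
  \<open>u\<close>, the difference would have a negative minimum: growth of the weight excludes
  infinity, 1/t excludes t = 0, the terminal inequality excludes \<open>T\<close>. At an interior
  minimum the subsolution property contradicts the strict sign -\<eta>/t^2. The exponent
  \<open>q\<close> does not depend on \<eta>, so \<eta> can be sent to 0 afterwards.\<close>

lemma comparison_strict:
  assumes T: "T > 0" and uc: "continuous_on ({0..T} \<times> Rn d) u" and ub: "poly_bounded_on T d u"
    and sub: "viscosity_sub T \<alpha> \<beta> d u" and g: "g \<in> tensor_span d"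
    and terminal: "\<And>x. x \<in> Rn d \<Longrightarrow> u (T, x) \<le> g x"
  obtains q where "\<And>\<eta> t x. \<eta> > 0 \<Longrightarrow> 0 < t \<Longrightarrow> t \<le> T \<Longrightarrow> x \<in> Rn d \<Longrightarrow>
    u (t, x) \<le> feynman_kac \<alpha> \<beta> T d g (t, x) + \<eta> * (feynman_kac \<alpha> \<beta> T d (weight d q) (t, x) + inverse t)"
proof -
  let ?v = "feynman_kac \<alpha> \<beta> T d g"
  have "poly_bounded_on T d (\<lambda>z. ?v z + (-1) * u z)"
    by (intro poly_bounded_on_add poly_bounded_on_mult poly_bounded_on_const feynman_kac_poly_bounded g ub)
  then have "\<exists>C\<ge>0. \<exists>N. \<forall>t\<in>{0..T}. \<forall>x\<in>Rn d. \<bar>?v (t, x) - u (t, x)\<bar> \<le> C * (1 + norm_Rn d x) ^ N"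
    unfolding poly_bounded_on_def by simp
  then obtain C N where C: "C \<ge> 0" "\<And>t x. t \<in> {0..T} \<Longrightarrow> x \<in> Rn d \<Longrightarrow> \<bar>?v (t, x) - u (t, x)\<bar> \<le> C * (1 + norm_Rn d x) ^ N"
    by blast
  \<comment> \<open>One power more than the growth of \<open>?v - u\<close>, so that the barrier
    wins at infinity however small \<eta> is.\<close>
  let ?w = "feynman_kac \<alpha> \<beta> T d (weight d (Suc N))"
  obtain c where c: "c > 0" "\<And>t x. t \<in> {0..T} \<Longrightarrow> c * (1 + norm_Rn d x) ^ Suc N \<le> ?w (t, x)"
    by (rule feynman_kac_weight_lower [where T = T and q = "Suc N" and \<alpha> = \<alpha> and \<beta> = \<beta> and d = d]) (use that in blast)
  have w0: "?w (t, x) \<ge> 0" if "t \<in> {0..T}" for t x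
  proof (rule order_trans [OF _ c(2) [OF that]])
    show "0 \<le> c * (1 + norm_Rn d x) ^ Suc N" using c(1) by (intro mult_nonneg_nonneg zero_le_power) auto
  qed
  let ?D = "{0<..<T} \<times> Rn d"
  note so = slicewise_open_cylinder [of d T]
  show thesis
  proof (rule that [of "Suc N"], rule ccontr)
    fix \<eta> ts xs assume \<eta>: "\<eta> > 0" and ts: "0 < ts" "ts \<le> T" and xs: "xs \<in> Rn d"
      and "\<not> u (ts, xs) \<le> ?v (ts, xs) + \<eta> * (?w (ts, xs) + inverse ts)"
    define H where "H z = ?v z + \<eta> * (?w z + inverse (fst z))" for z
    define F where "F z = H z - u z" for z
    have Fs: "F (ts, xs) < 0" using \<open>\<not> _\<close> by (simp add: F_def H_def)
    \<comment> \<open>Beyond this radius the barrier exceeds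
      \<open>C * (1 + norm_Rn d x) ^ N\<close>.\<close>
    define R where "R = C / (\<eta> * c)"
    have R0: "R \<ge> 0" using C \<eta> c by (simp add: R_def)
    \<comment> \<open>An upper bound of the same quantity inside radius \<open>R\<close>; the
      \<open>+ 1\<close> keeps it positive when \<open>C = 0\<close>.\<close>
    define B where "B = C * (1 + R) ^ N + 1"
    have B: "B > 0" using C R0 by (simp add: B_def add_nonneg_pos)
    \<comment> \<open>Before this time \<eta>/t exceeds \<open>B\<close>.\<close>
    define t0 where "t0 = min T (\<eta> / B)"
    have t0: "t0 > 0" "t0 \<le> T" using T \<eta> B by (auto simp: t0_def)
    have F_lower: "F (t, x) \<ge> \<eta> * (c * (1 + norm_Rn d x) ^ Suc N + inverse t) - C * (1 + norm_Rn d x) ^ N"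
      if "0 < t" "t \<le> T" "x \<in> Rn d" for t x
    proof -
      have "\<eta> * (c * (1 + norm_Rn d x) ^ Suc N + inverse t) \<le> \<eta> * (?w (t, x) + inverse t)"
        using c(2) [of t x] that \<eta> by (intro mult_left_mono) auto
      then show ?thesis using C(2) [of t x] that by (auto simp: F_def H_def)
    qed
    have out: "F (t, x) \<ge> 0" if t: "0 < t" "t \<le> T" and x: "x \<in> Rn d" and no: "t < t0 \<or> R < norm_Rn d x" for t x
    proof (cases "R < norm_Rn d x")
      case True
      have p: "\<eta> * c > 0" using \<eta> c by simp
      then have "C < norm_Rn d x * (\<eta> * c)" using True unfolding R_def by (simp only: pos_divide_less_eq)
      then have "C \<le> \<eta> * c * (1 + norm_Rn d x)" using p by (simp only: distrib_left mult_1_right mult.commute [of "norm_Rn d x"])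
      then have "C * (1 + norm_Rn d x) ^ N \<le> (\<eta> * c * (1 + norm_Rn d x)) * (1 + norm_Rn d x) ^ N"
        by (intro mult_right_mono) auto
      also have "\<dots> = \<eta> * (c * (1 + norm_Rn d x) ^ Suc N)" by (simp only: power_Suc mult_ac)
      also have "\<dots> \<le> \<eta> * (c * (1 + norm_Rn d x) ^ Suc N + inverse t)" using t \<eta> by (intro mult_left_mono) auto
      finally show ?thesis using F_lower [OF t x] by linarith
    next
      case False
      then have "t < \<eta> / B" using no by (auto simp: t0_def)
      then have "B \<le> \<eta> * inverse t" using t B by (simp add: field_simps)
      moreover have "C * (1 + norm_Rn d x) ^ N \<le> C * (1 + R) ^ N"
        using False C by (intro mult_left_mono power_mono) auto
      moreover have "\<eta> * (c * (1 + norm_Rn d x) ^ Suc N) \<ge> 0" using \<eta> c by simp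
      ultimately show ?thesis using F_lower [OF t x] unfolding B_def distrib_left by linarith
    qed
    let ?K = "{t0..T} \<times> PiE {..<d} (\<lambda>_. {-R..R})"
    have Kc: "compact ?K" by (intro compact_Times compact_PiE_lessThan) auto
    have Ks: "?K \<subseteq> {0..T} \<times> Rn d" using t0 Rn_subset [of d "\<lambda>_. {-R..R}"] by auto
    have inK: "(t, x) \<in> ?K" if "0 < t" "t \<le> T" "x \<in> Rn d" "F (t, x) < 0" for t x
    proof -
      have "\<not> (t < t0 \<or> R < norm_Rn d x)" using out [OF that(1-3)] that(4) by linarith
      then show ?thesis using norm_box [OF that(3), of R] that(2) by simp
    qed
    have Fc: "continuous_on ?K F"
      unfolding F_def H_def using t0
      by (intro continuous_intros continuous_on_subset [OF feynman_kac_continuous [OF g, of T "Rn d"] Ks]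
        continuous_on_subset [OF feynman_kac_continuous [OF weight_tensor_span, of T "Rn d"] Ks] continuous_on_subset [OF uc Ks]) auto
    have sK: "(ts, xs) \<in> ?K" by (rule inK [OF ts xs Fs])
    then have "?K \<noteq> {}" by (simp only: ex_in_conv [symmetric]) (rule exI)
    from continuous_attains_inf [OF Kc this Fc]
    obtain z1 where z1': "z1 \<in> ?K" "\<forall>z\<in>?K. F z1 \<le> F z" ..
    note z1 = z1'(1) bspec [OF z1'(2)]
    obtain t1 x1 where z1e: "z1 = (t1, x1)" by (cases z1)
    have F1: "F z1 < 0" using z1(2) [OF sK] Fs by linarith
    have "(t1, x1) \<in> {0..T} \<times> Rn d" using z1(1) Ks unfolding z1e by blast
    then have t1: "0 < t1" "t1 \<le> T" "x1 \<in> Rn d" using z1(1) t0 by (auto simp: z1e)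
    \<comment> \<open>Test functions must dominate \<open>u\<close> on the whole cylinder. The
      minimum over \<open>?K\<close> is global because \<open>F\<close> is nonnegative outside and
      \<open>F z1\<close> is negative.\<close>
    have glob: "F z1 \<le> F (t, x)" if "0 < t" "t \<le> T" "x \<in> Rn d" for t x
    proof (cases "F (t, x) < 0")
      case True
      then show ?thesis using z1(2) [OF inK [OF that]] by simp
    qed (use F1 in linarith)
    have "t1 \<noteq> T"
    proof
      assume "t1 = T"
      then have "F z1 = g x1 + \<eta> * (?w (T, x1) + inverse T) - u (T, x1)"
        using t1 by (simp add: F_def H_def z1e feynman_kac_terminal)
      moreover have "\<eta> * (?w (T, x1) + inverse T) \<ge> 0" using w0 [of T x1] T \<eta> by simp
      ultimately show False using F1 terminal [OF t1(3)] by linarith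
    qed
    then have z1D: "z1 \<in> ?D" using t1 by (simp add: z1e)
    \<comment> \<open>The shift by the minimum makes \<open>h\<close> touch \<open>u\<close> from
      above in \<open>z1\<close> without changing any derivative.\<close>
    define h where "h z = H z + (- F z1)" for z
    have Cv: "Ck_on 2 d ?D ?v" by (rule feynman_kac_Ck_on [OF g])
    have Cw: "Ck_on 2 d ?D ?w" by (rule feynman_kac_Ck_on [OF weight_tensor_span])
    have Ci: "Ck_on 2 d ?D (\<lambda>z. inverse (fst z))" by (rule inverse_time_Ck_on)
    have Cwi: "Ck_on 2 d ?D (\<lambda>z. ?w z + inverse (fst z))" by (rule Ck_on_add [OF so Cw Ci])
    have Cn: "Ck_on 2 d ?D (\<lambda>z. \<eta> * (?w z + inverse (fst z)))" by (rule Ck_on_mult [OF so Ck_on_const [OF so] Cwi])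
    have H2: "Ck_on 2 d ?D H" unfolding H_def [abs_def] by (rule Ck_on_add [OF so Cv Cn])
    have h2: "Ck_on 2 d ?D h" unfolding h_def [abs_def] by (rule Ck_on_add [OF so H2 Ck_on_const [OF so]])
    have hu: "u w \<le> h w" if "w \<in> ?D" for w
      using glob [of "fst w" "snd w"] that by (auto simp: h_def F_def)
    have "h z1 = u z1" by (simp add: h_def F_def)
    with sub z1D h2 hu have "0 \<le> parabolic_op \<alpha> \<beta> d h z1" unfolding viscosity_sub_def by blast
    moreover have "parabolic_op \<alpha> \<beta> d h z1 = - (\<eta> * (inverse t1 * inverse t1))"
    proof -
      have "parabolic_op \<alpha> \<beta> d h z1 = parabolic_op \<alpha> \<beta> d H z1"
        unfolding h_def [abs_def]
        by (simp only: parabolic_op_add [OF so z1D H2 Ck_on_const [OF so]] parabolic_op_const [OF so z1D] add_0_right)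
      also have "\<dots> = parabolic_op \<alpha> \<beta> d ?v z1 + \<eta> * (parabolic_op \<alpha> \<beta> d ?w z1 + parabolic_op \<alpha> \<beta> d (\<lambda>z. inverse (fst z)) z1)"
        unfolding H_def [abs_def]
        by (simp only: parabolic_op_add [OF so z1D Cv Cn] parabolic_op_cmult [OF so z1D Cwi] parabolic_op_add [OF so z1D Cw Ci])
      also have "\<dots> = - (\<eta> * (inverse t1 * inverse t1))"
        using feynman_kac_parabolic [OF g z1D] feynman_kac_parabolic [OF weight_tensor_span z1D] inverse_time_Ck_on(2) [OF z1D]
        by (simp add: z1e)
      finally show ?thesis .
    qed
    moreover have "\<eta> * (inverse t1 * inverse t1) > 0" using \<eta> t1 by simp
    ultimately show False by linarith
  qed
qed

text \<open>Let \<eta> tend to 0 at a fixed time in the open interval; the end points, including t =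
  0 where 1/t is useless, follow by continuity.\<close>

lemma comparison:
  assumes T: "T > 0" and uc: "continuous_on ({0..T} \<times> Rn d) u" and ub: "poly_bounded_on T d u"
    and sub: "viscosity_sub T \<alpha> \<beta> d u" and g: "g \<in> tensor_span d"
    and terminal: "\<And>x. x \<in> Rn d \<Longrightarrow> u (T, x) \<le> g x"
    and t: "t \<in> {0..T}" and x: "x \<in> Rn d"
  shows "u (t, x) \<le> feynman_kac \<alpha> \<beta> T d g (t, x)"
proof -
  let ?v = "feynman_kac \<alpha> \<beta> T d g"
  obtain q where q: "\<And>\<eta> t x. \<eta> > 0 \<Longrightarrow> 0 < t \<Longrightarrow> t \<le> T \<Longrightarrow> x \<in> Rn d \<Longrightarrow>
    u (t, x) \<le> ?v (t, x) + \<eta> * (feynman_kac \<alpha> \<beta> T d (weight d q) (t, x) + inverse t)"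
    using comparison_strict [OF assms(1-6)] by blast
  have pos: "0 \<le> ?v (t, x) - u (t, x)" if "t \<in> {0<..<T}" for t
  proof -
    let ?b = "feynman_kac \<alpha> \<beta> T d (weight d q) (t, x) + inverse t"
    have "((\<lambda>\<eta>. ?v (t, x) + \<eta> * ?b - u (t, x)) \<longlongrightarrow> ?v (t, x) + 0 * ?b - u (t, x)) (at_right 0)"
      by (intro tendsto_intros)
    moreover have "\<forall>\<^sub>F \<eta> in at_right 0. 0 \<le> ?v (t, x) + \<eta> * ?b - u (t, x)"
      using eventually_at_right_less [of 0] by (rule eventually_mono) (use q [OF _ _ _ x, of _ t] that in simp)
    ultimately have "0 \<le> ?v (t, x) + 0 * ?b - u (t, x)"
      by (rule tendsto_lowerbound) simp
    then show ?thesis by simp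
  qed
  have "continuous_on {0..T} (\<lambda>t. (\<lambda>z. ?v z - u z) (t, x))"
    by (rule continuous_on_compose2 [OF continuous_on_diff [OF feynman_kac_continuous [OF g] uc]])
      (use x in \<open>auto intro!: continuous_intros\<close>)
  then have "continuous_on (closure {0<..<T}) (\<lambda>t. ?v (t, x) - u (t, x))" using T by simp
  then have "0 \<le> ?v (t, x) - u (t, x)"
    by (rule continuous_ge_on_closure) (use t T pos in auto)
  then show ?thesis by simp
qed

section \<open>Stability and uniqueness\<close>

lemma geo_flow_in_Rn: "geo_flow \<alpha> \<beta> d \<tau> x y \<in> Rn d"
  by (simp add: geo_flow_def)

text \<open>Measurability into \<open>nat \<Rightarrow> real\<close> is coordinatewise, and the
  coordinates from \<open>d\<close> on are constantly \<open>undefined\<close>.\<close>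

lemma continuous_on_Rn_measurable:
  assumes \<phi>: "continuous_on (Rn d) \<phi>" and f: "\<And>i. i < d \<Longrightarrow> (\<lambda>y. f y i) \<in> borel_measurable M"
    and fR: "\<And>y. f y \<in> Rn d"
  shows "(\<lambda>y. \<phi> (f y) :: real) \<in> borel_measurable M"
proof -
  have "f \<in> borel_measurable M"
  proof (rule measurable_coordinatewise_then_product)
    fix i
    show "(\<lambda>y. f y i) \<in> borel_measurable M"
    proof (cases "i < d")
      case False
      then have "f y i = undefined" for y
        using fR [of y] by (simp add: Rn_def PiE_def extensional_def)
      then show ?thesis by simp
    qed (rule f)
  qed
  then have "f \<in> measurable M (restrict_space borel (Rn d))"
    by (intro measurable_restrict_space2) (use fR in simp_all)
  from measurable_compose [OF this borel_measurable_continuous_on_restrict [OF \<phi>]] show ?thesis .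
qed

lemma geo_flow_measurable:
  fixes \<phi> :: "(nat \<Rightarrow> real) \<Rightarrow> real"
  assumes \<phi>: "continuous_on (Rn d) \<phi>"
  shows "(\<lambda>y. \<phi> (geo_flow \<alpha> \<beta> d \<tau> x y)) \<in> borel_measurable (gauss_Rn d)"
proof (rule continuous_on_Rn_measurable [where f = "geo_flow \<alpha> \<beta> d \<tau> x", OF \<phi>])
  show "geo_flow \<alpha> \<beta> d \<tau> x y \<in> Rn d" for y by (rule geo_flow_in_Rn)
  fix i assume i: "i < d"
  then have "(\<lambda>y. y i) \<in> measurable (gauss_Rn d) gauss"
    unfolding gauss_Rn_def by (intro measurable_component_singleton) simp
  then have "(\<lambda>y. geo \<alpha> \<beta> \<tau> (y i)) \<in> borel_measurable (gauss_Rn d)"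
    by (rule measurable_compose) (simp add: measurable_cong_sets [OF sets_gauss refl])
  then show "(\<lambda>y. geo_flow \<alpha> \<beta> d \<tau> x y i) \<in> borel_measurable (gauss_Rn d)"
    using i by (simp add: geo_flow_def)
qed

lemma feynman_kac_approx:
  assumes \<phi>: "continuous_on (Rn d) \<phi>" and g: "g \<in> tensor_span d" and w: "w \<in> tensor_span d"
    and b: "\<And>x. x \<in> Rn d \<Longrightarrow> \<bar>\<phi> x - g x\<bar> \<le> \<epsilon> * w x"
  shows "integrable (gauss_Rn d) (\<lambda>y. \<phi> (geo_flow \<alpha> \<beta> d \<tau> x y))"
    and "\<bar>feynman_kac \<alpha> \<beta> T d \<phi> z - feynman_kac \<alpha> \<beta> T d g z\<bar> \<le> \<epsilon> * feynman_kac \<alpha> \<beta> T d w z"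
proof -
  have int: "integrable (gauss_Rn d) (\<lambda>y. \<phi> (geo_flow \<alpha> \<beta> d \<tau> x y))" for \<tau> x
  proof (rule Bochner_Integration.integrable_bound)
    show "integrable (gauss_Rn d) (\<lambda>y. \<bar>g (geo_flow \<alpha> \<beta> d \<tau> x y)\<bar> + \<epsilon> * w (geo_flow \<alpha> \<beta> d \<tau> x y))"
      by (intro Bochner_Integration.integrable_add integrable_abs integrable_mult_right tensor_span_integrable g w)
    show "AE y in gauss_Rn d. norm (\<phi> (geo_flow \<alpha> \<beta> d \<tau> x y)) \<le> norm (\<bar>g (geo_flow \<alpha> \<beta> d \<tau> x y)\<bar> + \<epsilon> * w (geo_flow \<alpha> \<beta> d \<tau> x y))"
    proof (intro AE_I2)
      fix y
      show "norm (\<phi> (geo_flow \<alpha> \<beta> d \<tau> x y)) \<le> norm (\<bar>g (geo_flow \<alpha> \<beta> d \<tau> x y)\<bar> + \<epsilon> * w (geo_flow \<alpha> \<beta> d \<tau> x y))"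
        using b [OF geo_flow_in_Rn, of \<alpha> \<beta> \<tau> x y] unfolding real_norm_def by linarith
    qed
  qed (rule geo_flow_measurable [OF \<phi>])
  then show "integrable (gauss_Rn d) (\<lambda>y. \<phi> (geo_flow \<alpha> \<beta> d \<tau> x y))" .
  let ?f = "geo_flow \<alpha> \<beta> d (T - fst z) (snd z)"
  have e: "feynman_kac \<alpha> \<beta> T d \<phi> z - feynman_kac \<alpha> \<beta> T d g z = (\<integral>y. \<phi> (?f y) - g (?f y) \<partial>gauss_Rn d)"
    unfolding feynman_kac_def by (rule Bochner_Integration.integral_diff [symmetric]) (intro int tensor_span_integrable g)+
  have "\<bar>feynman_kac \<alpha> \<beta> T d \<phi> z - feynman_kac \<alpha> \<beta> T d g z\<bar> \<le> (\<integral>y. \<bar>\<phi> (?f y) - g (?f y)\<bar> \<partial>gauss_Rn d)"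
    unfolding e by (rule integral_abs_bound)
  also have "\<dots> \<le> (\<integral>y. \<epsilon> * w (?f y) \<partial>gauss_Rn d)"
  proof (rule integral_mono)
    show "integrable (gauss_Rn d) (\<lambda>y. \<bar>\<phi> (?f y) - g (?f y)\<bar>)"
      by (rule integrable_abs [OF Bochner_Integration.integrable_diff [OF int tensor_span_integrable [OF g]]])
    show "integrable (gauss_Rn d) (\<lambda>y. \<epsilon> * w (?f y))"
      by (rule integrable_mult_right [OF tensor_span_integrable [OF w]])
  qed (rule b [OF geo_flow_in_Rn])
  also have "\<dots> = \<epsilon> * feynman_kac \<alpha> \<beta> T d w z" by (simp add: feynman_kac_def)
  finally show "\<bar>feynman_kac \<alpha> \<beta> T d \<phi> z - feynman_kac \<alpha> \<beta> T d g z\<bar> \<le> \<epsilon> * feynman_kac \<alpha> \<beta> T d w z" .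
qed

text \<open>The same \<open>g\<close> approximates the data and the solution; uniqueness compares
  both with it.\<close>

lemma feynman_kac_dense:
  assumes d: "d \<ge> 1" and \<phi>: "continuous_on (Rn d) \<phi>" and C: "\<And>x. x \<in> Rn d \<Longrightarrow> \<bar>\<phi> x\<bar> \<le> C * (1 + norm_Rn d x) ^ N"
    and \<epsilon>: "\<epsilon> > 0"
  shows "\<exists>g\<in>tensor_span d. (\<forall>x\<in>Rn d. \<bar>\<phi> x - g x\<bar> \<le> \<epsilon> * weight d (Suc N) x) \<and>
    (\<forall>z. \<bar>feynman_kac \<alpha> \<beta> T d \<phi> z - feynman_kac \<alpha> \<beta> T d g z\<bar> \<le> \<epsilon> * feynman_kac \<alpha> \<beta> T d (weight d (Suc N)) z)"
proof -
  obtain g where g: "g \<in> tensor_span d" "\<And>x. x \<in> Rn d \<Longrightarrow> \<bar>\<phi> x - g x\<bar> \<le> \<epsilon> * weight d (Suc N) x"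
    using tensor_span_dense [OF d \<phi> C \<epsilon>] by blast
  show ?thesis
    by (intro bexI [of _ g] conjI ballI allI g feynman_kac_approx(2) [OF \<phi> g(1) weight_tensor_span g(2)])
qed

lemma feynman_kac_weight_nonneg: "feynman_kac \<alpha> \<beta> T d (weight d q) z \<ge> 0"
  unfolding feynman_kac_def by (intro Bochner_Integration.integral_nonneg less_imp_le weight_pos)

text \<open>Dividing by \<open>1 + \<bar>w z\<bar>\<close> turns weighted into uniform convergence,
  which preserves continuity.\<close>

lemma continuous_on_weighted_limit:
  fixes v w :: "'a::topological_space \<Rightarrow> real"
  assumes g: "\<And>\<epsilon>. \<epsilon> > 0 \<Longrightarrow> \<exists>g. continuous_on S g \<and> (\<forall>z\<in>S. \<bar>v z - g z\<bar> \<le> \<epsilon> * w z)" and w: "continuous_on S w"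
  shows "continuous_on S v"
proof -
  let ?m = "\<lambda>z. 1 + \<bar>w z\<bar>"
  have m: "?m z > 0" for z by (simp add: add_pos_nonneg)
  have "\<forall>n. \<exists>g. continuous_on S g \<and> (\<forall>z\<in>S. \<bar>v z - g z\<bar> \<le> inverse (real (Suc n)) * w z)"
    using g by simp
  then obtain G where G: "\<And>n. continuous_on S (G n)" "\<And>n z. z \<in> S \<Longrightarrow> \<bar>v z - G n z\<bar> \<le> inverse (real (Suc n)) * w z"
    by metis
  have mc: "continuous_on S ?m" by (intro continuous_intros w)
  have "continuous_on S (\<lambda>z. v z / ?m z)"
  proof (rule uniform_limit_theorem)
    show "\<forall>\<^sub>F n in sequentially. continuous_on S (\<lambda>z. G n z / ?m z)"
      using m by (intro always_eventually allI continuous_on_divide G mc) (simp add: less_imp_neq [symmetric])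
    show "uniform_limit S (\<lambda>n z. G n z / ?m z) (\<lambda>z. v z / ?m z) sequentially"
    proof (rule uniform_limitI)
      fix e :: real assume e: "e > 0"
      obtain N where N: "inverse (real (Suc N)) < e" using reals_Archimedean [OF e] by blast
      have "dist (G n z / ?m z) (v z / ?m z) < e" if "n \<ge> N" "z \<in> S" for n z
      proof -
        have "\<bar>v z - G n z\<bar> \<le> inverse (real (Suc n)) * ?m z"
        proof (rule order_trans [OF G(2) [OF that(2)]])
          show "inverse (real (Suc n)) * w z \<le> inverse (real (Suc n)) * ?m z" by (intro mult_left_mono) auto
        qed
        then have "\<bar>v z - G n z\<bar> / ?m z \<le> inverse (real (Suc n))" using m [of z] by (simp add: pos_divide_le_eq)
        also have "\<dots> \<le> inverse (real (Suc N))" using that by (intro le_imp_inverse_le) auto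
        finally have "\<bar>v z - G n z\<bar> / ?m z < e" using N by linarith
        moreover have "dist (G n z / ?m z) (v z / ?m z) = \<bar>v z - G n z\<bar> / ?m z"
          using m [of z] by (simp add: dist_real_def diff_divide_distrib [symmetric] abs_divide abs_minus_commute)
        ultimately show ?thesis by simp
      qed
      then show "\<forall>\<^sub>F n in sequentially. \<forall>z\<in>S. dist (G n z / ?m z) (v z / ?m z) < e"
        by (auto simp: eventually_sequentially)
    qed
  qed simp
  then have "continuous_on S (\<lambda>z. v z / ?m z * ?m z)" by (intro continuous_on_mult mc)
  moreover have "v z / ?m z * ?m z = v z" for z using m [of z] by simp
  ultimately show ?thesis by simp
qed

lemma feynman_kac_continuous':
  assumes d: "d \<ge> 1" and \<phi>: "continuous_on (Rn d) \<phi>" and C: "\<And>x. x \<in> Rn d \<Longrightarrow> \<bar>\<phi> x\<bar> \<le> C * (1 + norm_Rn d x) ^ N"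
  shows "continuous_on ({0..T} \<times> Rn d) (feynman_kac \<alpha> \<beta> T d \<phi>)"
proof (rule continuous_on_weighted_limit)
  fix \<epsilon> :: real assume \<epsilon>: "\<epsilon> > 0"
  obtain g where g: "g \<in> tensor_span d" "\<And>z. \<bar>feynman_kac \<alpha> \<beta> T d \<phi> z - feynman_kac \<alpha> \<beta> T d g z\<bar> \<le> \<epsilon> * feynman_kac \<alpha> \<beta> T d (weight d (Suc N)) z"
    using feynman_kac_dense [OF d \<phi> C \<epsilon>, of \<alpha> \<beta> T] by blast
  show "\<exists>g. continuous_on ({0..T} \<times> Rn d) g \<and> (\<forall>z\<in>{0..T} \<times> Rn d. \<bar>feynman_kac \<alpha> \<beta> T d \<phi> z - g z\<bar> \<le> \<epsilon> * feynman_kac \<alpha> \<beta> T d (weight d (Suc N)) z)"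
    by (intro exI [of _ "feynman_kac \<alpha> \<beta> T d g"] conjI ballI feynman_kac_continuous g)
qed (rule feynman_kac_continuous [OF weight_tensor_span])

lemma feynman_kac_poly_bounded':
  assumes d: "d \<ge> 1" and \<phi>: "continuous_on (Rn d) \<phi>" and C: "\<And>x. x \<in> Rn d \<Longrightarrow> \<bar>\<phi> x\<bar> \<le> C * (1 + norm_Rn d x) ^ N"
  shows "poly_bounded_on T d (feynman_kac \<alpha> \<beta> T d \<phi>)"
proof -
  have one: "(0::real) < 1" by simp
  obtain g where g: "g \<in> tensor_span d" "\<And>z. \<bar>feynman_kac \<alpha> \<beta> T d \<phi> z - feynman_kac \<alpha> \<beta> T d g z\<bar> \<le> 1 * feynman_kac \<alpha> \<beta> T d (weight d (Suc N)) z"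
    using feynman_kac_dense [OF d \<phi> C one, of \<alpha> \<beta> T] by blast
  have e: "\<bar>feynman_kac \<alpha> \<beta> T d \<phi> z\<bar> \<le> \<bar>feynman_kac \<alpha> \<beta> T d g z\<bar> + \<bar>feynman_kac \<alpha> \<beta> T d (weight d (Suc N)) z\<bar>" for z
    using g(2) [of z] by linarith
  have "poly_bounded_on T d (\<lambda>z. \<bar>feynman_kac \<alpha> \<beta> T d g z\<bar> + \<bar>feynman_kac \<alpha> \<beta> T d (weight d (Suc N)) z\<bar>)"
    by (intro poly_bounded_on_add) (use feynman_kac_poly_bounded [OF g(1), of T \<alpha> \<beta>] feynman_kac_poly_bounded [OF weight_tensor_span, of T d \<alpha> \<beta> "Suc N"] in \<open>simp_all add: poly_bounded_on_def\<close>)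
  then obtain C2 N2 where 2: "C2 \<ge> 0" "\<And>t x. t \<in> {0..T} \<Longrightarrow> x \<in> Rn d \<Longrightarrow>
      \<bar>\<bar>feynman_kac \<alpha> \<beta> T d g (t, x)\<bar> + \<bar>feynman_kac \<alpha> \<beta> T d (weight d (Suc N)) (t, x)\<bar>\<bar> \<le> C2 * (1 + norm_Rn d x) ^ N2"
    unfolding poly_bounded_on_def by blast
  show ?thesis
  proof (rule poly_bounded_onI [OF 2(1)])
    fix t x assume tx: "t \<in> {0..T}" "x \<in> Rn d"
    show "\<bar>feynman_kac \<alpha> \<beta> T d \<phi> (t, x)\<bar> \<le> C2 * (1 + norm_Rn d x) ^ N2"
      using e [of "(t, x)"] 2(2) [OF tx] by linarith
  qed
qed

lemma parabolic_op_sum: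
  assumes D: "slicewise_open d D" and z: "z \<in> D" and "finite I" and h: "\<And>i. i \<in> I \<Longrightarrow> Ck_on 2 d D (h i)"
  shows "parabolic_op \<alpha> \<beta> d (\<lambda>z. \<Sum>i\<in>I. h i z) z = (\<Sum>i\<in>I. parabolic_op \<alpha> \<beta> d (h i) z)"
  using assms(3) h
proof (induction I rule: finite_induct)
  case empty
  then show ?case by (simp add: parabolic_op_const [OF D z])
next
  case (insert i I)
  have 1: "Ck_on 2 d D (h i)" and 2: "Ck_on 2 d D (\<lambda>z. \<Sum>i\<in>I. h i z)"
    using insert by (auto intro: Ck_on_sum [OF D])
  show ?case using insert by (simp add: parabolic_op_add [OF D z 1 2])
qed

text \<open>With a fourth power the first and second derivatives both vanish at the centre, so the
  penalty leaves the operator there unchanged; a square would not.\<close>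

lemma quartic_penalty:
  assumes D: "slicewise_open d D"
  shows "Ck_on n d D (\<lambda>z. (coord k z - c) ^ 4)"
    and "z \<in> D \<Longrightarrow> coord k z = c \<Longrightarrow> parabolic_op \<alpha> \<beta> d (\<lambda>z. (coord k z - c) ^ 4) z = 0"
proof -
  have "Ck_on n d D (\<lambda>z. (coord k z + (- c)) ^ 4)"
    by (rule Ck_on_power [OF D Ck_on_add [OF D Ck_on_coord [OF D] Ck_on_const [OF D]]])
  then show "Ck_on n d D (\<lambda>z. (coord k z - c) ^ 4)" by simp
  let ?h1 = "\<lambda>j z. if j = k then 4 * (coord k z - c) ^ 3 else 0"
  let ?h2 = "\<lambda>j z. if j = k then 12 * (coord k z - c) ^ 2 else 0"
  have upd: "coord k (coord_upd j z r) = coord k z" if "j \<noteq> k" for j z r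
    using that by (cases j; cases k) auto
  have 1: "has_partial_on j D (\<lambda>z. (coord k z - c) ^ 4) (?h1 j)" for j
  proof (cases "j = k")
    case True
    then show ?thesis unfolding has_partial_on_def
      by (auto simp: coord_upd_same intro!: derivative_eq_intros)
  next
    case False
    then show ?thesis using has_partial_on_indep [of "\<lambda>z. (coord k z - c) ^ 4" j D] upd by simp
  qed
  have 2: "has_partial_on j D (?h1 j) (?h2 j)" for j
  proof (cases "j = k")
    case True
    then show ?thesis unfolding has_partial_on_def
      by (auto simp: coord_upd_same intro!: derivative_eq_intros)
  next
    case False
    then show ?thesis by (simp add: has_partial_on_const)
  qed
  assume z: "z \<in> D" "coord k z = c"
  from parabolic_op_eqI [where ?h0.0 = "?h1 None" and ?h1.0 = "\<lambda>i. ?h1 (Some i)" and ?h2.0 = "\<lambda>i. ?h2 (Some i)", OF D z(1) 1 1 2, of \<alpha> \<beta>]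
  show "parabolic_op \<alpha> \<beta> d (\<lambda>z. (coord k z - c) ^ 4) z = 0" using z(2) by (cases k) (auto cong: if_cong)
qed

text \<open>Stability: a touching test function, made strict by a quartic penalty, is touched near the original
  point by the classical solutions that approximate the Feynman-Kac function.\<close>

lemma feynman_kac_viscosity_sub:
  assumes d: "d \<ge> 1" and \<phi>: "continuous_on (Rn d) \<phi>" and C: "\<And>x. x \<in> Rn d \<Longrightarrow> \<bar>\<phi> x\<bar> \<le> C * (1 + norm_Rn d x) ^ N"
  shows "viscosity_sub T \<alpha> \<beta> d (feynman_kac \<alpha> \<beta> T d \<phi>)"
  unfolding viscosity_sub_def
proof (intro ballI allI impI, rule ccontr)
  let ?D = "{0<..<T} \<times> Rn d" and ?v = "feynman_kac \<alpha> \<beta> T d \<phi>"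
  fix z0 h assume z0: "z0 \<in> ?D" and h: "Ck_on 2 d ?D h" and vh: "\<forall>w\<in>?D. ?v w \<le> h w" and eq: "h z0 = ?v z0"
    and "\<not> 0 \<le> parabolic_op \<alpha> \<beta> d h z0"
  then have neg: "parabolic_op \<alpha> \<beta> d h z0 < 0" by simp
  note so = slicewise_open_cylinder [of d T]
  obtain t0 y where z0e: "z0 = (t0, y)" by (cases z0)
  have t0: "0 < t0" "t0 < T" and y: "y \<in> Rn d" using z0 by (auto simp: z0e)
  have fin: "finite (coords d)" by (simp add: coords_def)
  define pen where "pen z = (\<Sum>k\<in>coords d. (coord k z - coord k z0) ^ 4)" for z
  have penC: "Ck_on 2 d ?D pen"
    unfolding pen_def [abs_def] by (rule Ck_on_sum [OF so fin quartic_penalty(1) [OF so]])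
  have pen_op: "parabolic_op \<alpha> \<beta> d pen z0 = 0"
    unfolding pen_def [abs_def]
    by (subst parabolic_op_sum [OF so z0 fin quartic_penalty(1) [OF so]]) (simp add: quartic_penalty(2) [OF so z0 refl])
  have pen_nonneg: "pen z \<ge> 0" for z unfolding pen_def by (intro sum_nonneg) simp
  have pen_ge: "pen z \<ge> (coord k z - coord k z0) ^ 4" if "k \<in> coords d" for k z
    unfolding pen_def by (rule member_le_sum [OF that _ fin]) simp
  define H where "H z = h z + pen z" for z
  have HC: "Ck_on 2 d ?D H" unfolding H_def [abs_def] by (rule Ck_on_add [OF so h penC])
  have Hneg: "parabolic_op \<alpha> \<beta> d H z0 < 0"
    unfolding H_def [abs_def] using neg pen_op by (simp add: parabolic_op_add [OF so z0 h penC])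
  \<comment> \<open>Half the distance to the ends of the time interval, so that the closed box
    \<open>K\<close> stays in the open cylinder.\<close>
  define r where "r = min t0 (T - t0) / 2"
  have r: "r > 0" "t0 - r > 0" "t0 + r < T" using t0 by (auto simp: r_def min_def field_simps)
  define K where "K = {t0 - r..t0 + r} \<times> PiE {..<d} (\<lambda>i. {y i - r..y i + r})"
  have Kc: "compact K" unfolding K_def by (intro compact_Times compact_PiE_lessThan compact_Icc)
  have KD: "K \<subseteq> ?D"
    unfolding K_def using r Rn_subset [of d "\<lambda>i. {y i - r..y i + r}"] by (intro Sigma_mono) auto
  have K_iff: "z \<in> K \<longleftrightarrow> snd z \<in> Rn d \<and> (\<forall>k\<in>coords d. \<bar>coord k z - coord k z0\<bar> \<le> r)" for z
  proof -
    have ivl: "s \<in> {c - r..c + r} \<longleftrightarrow> \<bar>s - c\<bar> \<le> r" for s c by (auto simp: abs_le_iff)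
    have "z \<in> K \<longleftrightarrow> \<bar>fst z - t0\<bar> \<le> r \<and> snd z \<in> Rn d \<and> (\<forall>i<d. \<bar>snd z i - y i\<bar> \<le> r)"
      unfolding K_def mem_Times_iff PiE_iff Rn_def ivl by blast
    also have "\<dots> \<longleftrightarrow> snd z \<in> Rn d \<and> (\<forall>k\<in>coords d. \<bar>coord k z - coord k z0\<bar> \<le> r)"
      by (auto simp: coords_def z0e)
    finally show ?thesis .
  qed
  have z0K: "z0 \<in> K" using y r by (simp add: K_iff z0e)
  have pos: "pen z > 0" if "z \<in> K" "z \<noteq> z0" for z
  proof (rule ccontr)
    assume "\<not> 0 < pen z"
    then have z: "pen z = 0" using pen_nonneg [of z] by linarith
    have c: "coord k z = coord k z0" if "k \<in> coords d" for k
    proof -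
      have "(coord k z - coord k z0) ^ 4 \<le> 0" using pen_ge [OF that, of z] z by simp
      moreover have "(coord k z - coord k z0) ^ 4 \<ge> 0" by simp
      ultimately have "(coord k z - coord k z0) ^ 4 = 0" by (rule antisym)
      then show ?thesis by simp
    qed
    have "fst z = t0" using c [of None] by (simp add: z0e)
    moreover have "snd z = y"
    proof (rule PiE_ext)
      show "snd z \<in> {..<d} \<rightarrow>\<^sub>E UNIV" "y \<in> {..<d} \<rightarrow>\<^sub>E UNIV" using that y by (simp_all add: K_iff Rn_def)
      show "snd z i = y i" if "i \<in> {..<d}" for i using c [of "Some i"] that by (simp add: z0e)
    qed
    ultimately show False using \<open>z \<noteq> z0\<close> by (cases z) (simp add: z0e)
  qed
  \<comment> \<open>The part of the box where the sign is wrong. It is compact and misses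
    \<open>z0\<close>, so the penalty has a positive lower bound on it.\<close>
  let ?B = "K \<inter> parabolic_op \<alpha> \<beta> d H -` {0..}"
  have Hop: "continuous_on K (parabolic_op \<alpha> \<beta> d H)"
    by (rule continuous_on_subset [OF continuous_on_parabolic_op [OF HC] KD])
  have Bc: "compact ?B"
    by (rule closedin_compact [OF Kc continuous_closedin_preimage [OF Hop]]) simp
  obtain \<delta>0 where \<delta>0: "\<delta>0 > 0" "\<And>z. z \<in> ?B \<Longrightarrow> \<delta>0 \<le> pen z"
  proof (cases "?B = {}")
    case True
    then show thesis using that [of 1] by auto
  next
    case False
    have "continuous_on ?B pen"
      by (rule continuous_on_subset [OF Ck_on_continuous [OF penC]]) (use KD in blast)
    from continuous_attains_inf [OF Bc False this] obtain b where b: "b \<in> ?B" "\<forall>z\<in>?B. pen b \<le> pen z" ..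
    have "b \<noteq> z0" using b(1) Hneg by auto
    then have "pen b > 0" using pos b(1) by blast
    then show thesis using that b(2) by blast
  qed
  \<comment> \<open>A point of \<open>K\<close> with penalty below \<delta> lies outside
    \<open>?B\<close> and strictly inside the box, since on a face some summand of the penalty
    equals r^4.\<close>
  define \<delta> where "\<delta> = min \<delta>0 (r ^ 4)"
  have \<delta>: "\<delta> > 0" using \<delta>0 r by (simp add: \<delta>_def)
  let ?w = "feynman_kac \<alpha> \<beta> T d (weight d (Suc N))"
  have wc: "continuous_on K ?w"
    by (rule continuous_on_subset [OF feynman_kac_continuous [OF weight_tensor_span, of T "Rn d"]]) (use KD in auto)
  have "bounded (?w ` K)" by (rule compact_imp_bounded [OF compact_continuous_image [OF wc Kc]])
  then obtain M where M: "M > 0" "\<forall>a\<in>?w ` K. norm a \<le> M" using bounded_pos by blast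
  \<comment> \<open>With this accuracy the classical solution is within \<delta>/4 of
    \<open>?v\<close> on \<open>K\<close>.\<close>
  have \<epsilon>: "\<delta> / (4 * M) > 0" using \<delta> M by simp
  obtain g where g: "g \<in> tensor_span d" "\<And>z. \<bar>?v z - feynman_kac \<alpha> \<beta> T d g z\<bar> \<le> \<delta> / (4 * M) * ?w z"
    using feynman_kac_dense [OF d \<phi> C \<epsilon>, of \<alpha> \<beta> T] by blast
  let ?g = "feynman_kac \<alpha> \<beta> T d g"
  have close: "\<bar>?v z - ?g z\<bar> \<le> \<delta> / 4" if "z \<in> K" for z
  proof -
    have "?w z \<le> M" using M(2) that by (simp add: image_iff) (metis abs_le_D1)
    then have "\<delta> / (4 * M) * ?w z \<le> \<delta> / (4 * M) * M" using \<epsilon> by (intro mult_left_mono) simp_all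
    also have "\<dots> = \<delta> / 4" using M by simp
    finally show ?thesis using g(2) [of z] by linarith
  qed
  define f where "f z = ?g z + (-1) * H z" for z
  have gC: "Ck_on 2 d ?D ?g" by (rule feynman_kac_Ck_on [OF g(1)])
  have nC: "Ck_on 2 d ?D (\<lambda>z. (-1) * H z)" by (rule Ck_on_mult [OF so Ck_on_const [OF so] HC])
  have fC: "Ck_on 2 d ?D f" unfolding f_def [abs_def] by (rule Ck_on_add [OF so gC nC])
  have fc: "continuous_on K f" by (rule continuous_on_subset [OF Ck_on_continuous [OF fC] KD])
  have "K \<noteq> {}" using z0K by (simp only: ex_in_conv [symmetric]) (rule exI)
  from continuous_attains_sup [OF Kc this fc] obtain z1 where z1: "z1 \<in> K" "\<forall>z\<in>K. f z \<le> f z1" ..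
  have pen0: "pen z0 = 0" by (simp add: pen_def)
  have "f z0 = ?g z0 - h z0" by (simp add: f_def H_def pen0)
  moreover have "?v z0 - ?g z0 \<le> \<delta> / 4" using close [OF z0K] by (rule abs_le_D1)
  ultimately have "f z0 \<ge> - \<delta> / 4" using eq by linarith
  then have f1: "f z1 \<ge> - \<delta> / 4" using z1(2) z0K order_trans by blast
  have z1D: "z1 \<in> ?D" using z1(1) KD by blast
  \<comment> \<open>The maximal value is at least -\<delta>/4, while at \<open>z1\<close> it is at
    most \<delta>/4 minus the penalty; so the penalty is at most \<delta>/2.\<close>
  have pen1: "pen z1 < \<delta>"
  proof (rule ccontr)
    assume "\<not> pen z1 < \<delta>"
    moreover have "?v z1 \<le> h z1" using vh z1D by blast
    moreover have "f z1 = ?g z1 - h z1 - pen z1" by (simp add: f_def H_def)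
    moreover have "- (?v z1 - ?g z1) \<le> \<delta> / 4" using close [OF z1(1)] by (rule abs_le_D2)
    ultimately show False using f1 \<delta> by linarith
  qed
  have H1: "parabolic_op \<alpha> \<beta> d H z1 < 0"
  proof (rule ccontr)
    assume "\<not> parabolic_op \<alpha> \<beta> d H z1 < 0"
    then have "z1 \<in> ?B" using z1(1) by simp
    then have "\<delta>0 \<le> pen z1" by (rule \<delta>0)
    then show False using pen1 by (simp add: \<delta>_def)
  qed
  have "parabolic_op \<alpha> \<beta> d f z1 \<le> 0"
  proof (rule parabolic_op_local_max [OF so z1D fC])
    fix k assume k: "k \<in> coords d"
    have int: "\<bar>coord k z1 - coord k z0\<bar> < r"
    proof (rule ccontr)
      assume "\<not> \<bar>coord k z1 - coord k z0\<bar> < r"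
      then have "r ^ 4 \<le> \<bar>coord k z1 - coord k z0\<bar> ^ 4" using r by (intro power_mono) auto
      also have "\<dots> = (coord k z1 - coord k z0) ^ 4" by (rule power_even_abs) simp
      also have "\<dots> \<le> pen z1" by (rule pen_ge [OF k])
      finally show False using pen1 by (simp add: \<delta>_def)
    qed
    have "\<forall>\<^sub>F s in nhds (coord k z1). s \<in> {coord k z0 - r<..<coord k z0 + r}"
      using int by (intro eventually_nhds_in_open) (auto simp: abs_less_iff)
    then show "\<forall>\<^sub>F s in nhds (coord k z1). f (coord_upd k z1 s) \<le> f z1"
    proof (rule eventually_mono)
      fix s assume s: "s \<in> {coord k z0 - r<..<coord k z0 + r}"
      have "coord_upd k z1 s \<in> K"
        unfolding K_iff
      proof (intro conjI ballI)
        have R1: "snd z1 \<in> Rn d" using z1(1) by (simp add: K_iff)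
        show "snd (coord_upd k z1 s) \<in> Rn d"
        proof (cases k)
          case (Some i)
          then have "i < d" using k by simp
          then show ?thesis using R1 Some by (auto simp: Rn_def PiE_iff extensional_def)
        qed (use R1 in simp)
        fix j assume j: "j \<in> coords d"
        show "\<bar>coord j (coord_upd k z1 s) - coord j z0\<bar> \<le> r"
        proof (cases "j = k")
          case True
          then show ?thesis using s by (simp add: coord_upd_same abs_le_iff)
        next
          case False
          then have "coord j (coord_upd k z1 s) = coord j z1" by (cases j; cases k) auto
          then show ?thesis using z1(1) j by (simp add: K_iff)
        qed
      qed
      then show "f (coord_upd k z1 s) \<le> f z1" using z1(2) by blast
    qed
  qed
  \<comment> \<open>The classical solution contributes 0, so the maximum of \<open>f\<close> would
    force a nonnegative operator value for \<open>H\<close>, against \<open>H1\<close>.\<close>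
  moreover have "parabolic_op \<alpha> \<beta> d f z1 = 0 + (-1) * parabolic_op \<alpha> \<beta> d H z1"
    unfolding f_def [abs_def]
    by (simp only: parabolic_op_add [OF so z1D gC nC] parabolic_op_cmult [OF so z1D HC] feynman_kac_parabolic [OF g(1) z1D])
  ultimately show False using H1 by linarith
qed

lemma feynman_kac_viscosity_solution:
  assumes d: "d \<ge> 1" and \<phi>: "continuous_on (Rn d) \<phi>" and C: "\<And>x. x \<in> Rn d \<Longrightarrow> \<bar>\<phi> x\<bar> \<le> C * (1 + norm_Rn d x) ^ N"
  shows "viscosity_solution T \<alpha> \<beta> d (feynman_kac \<alpha> \<beta> T d \<phi>)"
proof -
  have "viscosity_sub T \<alpha> \<beta> d (feynman_kac \<alpha> \<beta> T d (\<lambda>x. - \<phi> x))"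
    by (rule feynman_kac_viscosity_sub [OF d continuous_on_minus [OF \<phi>]]) (use C in simp)
  moreover have "feynman_kac \<alpha> \<beta> T d (\<lambda>x. - \<phi> x) = (\<lambda>z. - feynman_kac \<alpha> \<beta> T d \<phi> z)"
    by (simp add: feynman_kac_def fun_eq_iff)
  ultimately show ?thesis
    unfolding viscosity_solution_iff_sub using feynman_kac_viscosity_sub [OF assms] by simp
qed

text \<open>The data lie between \<open>g\<close> minus and plus \<epsilon> times the weight, both
  in \<open>tensor_span\<close>. Comparison applied to \<open>u\<close> and to \<open>- u\<close>
  squeezes \<open>u\<close> between the corresponding classical solutions.\<close>

lemma viscosity_solution_unique:
  assumes T: "T > 0" and d: "d \<ge> 1" and \<phi>: "continuous_on (Rn d) \<phi>" and C: "\<And>x. x \<in> Rn d \<Longrightarrow> \<bar>\<phi> x\<bar> \<le> C * (1 + norm_Rn d x) ^ N"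
    and uc: "continuous_on ({0..T} \<times> Rn d) u" and ub: "poly_bounded_on T d u"
    and vis: "viscosity_solution T \<alpha> \<beta> d u"
    and terminal: "\<And>x. x \<in> Rn d \<Longrightarrow> u (T, x) = \<phi> x"
    and t: "t \<in> {0..T}" and x: "x \<in> Rn d"
  shows "u (t, x) = feynman_kac \<alpha> \<beta> T d \<phi> (t, x)"
proof -
  let ?w = "feynman_kac \<alpha> \<beta> T d (weight d (Suc N)) (t, x)" and ?v = "feynman_kac \<alpha> \<beta> T d \<phi> (t, x)"
  have "\<bar>u (t, x) - ?v\<bar> \<le> 2 * \<epsilon> * ?w" if \<epsilon>: "\<epsilon> > 0" for \<epsilon>
  proof -
    obtain g where g: "g \<in> tensor_span d" "\<And>x. x \<in> Rn d \<Longrightarrow> \<bar>\<phi> x - g x\<bar> \<le> \<epsilon> * weight d (Suc N) x"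
      "\<And>z. \<bar>feynman_kac \<alpha> \<beta> T d \<phi> z - feynman_kac \<alpha> \<beta> T d g z\<bar> \<le> \<epsilon> * feynman_kac \<alpha> \<beta> T d (weight d (Suc N)) z"
      using feynman_kac_dense [OF d \<phi> C \<epsilon>, of \<alpha> \<beta> T] by blast
    have w: "(\<lambda>x. \<epsilon> * weight d (Suc N) x) \<in> tensor_span d"
      by (rule tensor_span_cmult [OF d weight_tensor_span])
    have n: "(\<lambda>x. -1 * g x) \<in> tensor_span d" by (rule tensor_span_cmult [OF d g(1)])
    have up: "u (t, x) \<le> feynman_kac \<alpha> \<beta> T d (\<lambda>x. g x + \<epsilon> * weight d (Suc N) x) (t, x)"
    proof (rule comparison [OF T uc ub _ tensor_span.sum [OF g(1) w] _ t x])
      show "viscosity_sub T \<alpha> \<beta> d u" using vis unfolding viscosity_solution_iff_sub by simp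
      fix x assume "x \<in> Rn d"
      then show "u (T, x) \<le> g x + \<epsilon> * weight d (Suc N) x" using g(2) [of x] terminal by (simp add: abs_le_iff)
    qed
    have lo: "- u (t, x) \<le> feynman_kac \<alpha> \<beta> T d (\<lambda>x. -1 * g x + \<epsilon> * weight d (Suc N) x) (t, x)"
    proof (rule comparison [OF T _ _ _ tensor_span.sum [OF n w] _ t x])
      show "continuous_on ({0..T} \<times> Rn d) (\<lambda>z. - u z)" by (intro continuous_intros uc)
      show "poly_bounded_on T d (\<lambda>z. - u z)" using ub unfolding poly_bounded_on_def by simp
      show "viscosity_sub T \<alpha> \<beta> d (\<lambda>z. - u z)" using vis unfolding viscosity_solution_iff_sub by simp
      fix x assume "x \<in> Rn d"
      then show "- u (T, x) \<le> -1 * g x + \<epsilon> * weight d (Suc N) x" using g(2) [of x] terminal by (simp add: abs_le_iff)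
    qed
    note up [unfolded fun_cong [OF feynman_kac_add [OF g(1) w]] feynman_kac_cmult]
      lo [unfolded fun_cong [OF feynman_kac_add [OF n w]] feynman_kac_cmult] g(3) [of "(t, x)"]
    then show ?thesis by (simp add: abs_le_iff)
  qed
  note bd = this
  have "\<bar>u (t, x) - ?v\<bar> \<le> 0"
  proof (rule field_le_epsilon)
    fix e :: real assume e: "e > 0"
    have w0: "?w \<ge> 0" by (rule feynman_kac_weight_nonneg)
    \<comment> \<open>Dividing by \<open>?w + 1\<close> avoids a separate case for a vanishing
      \<open>?w\<close>.\<close>
    have "\<bar>u (t, x) - ?v\<bar> \<le> 2 * (e / (2 * (?w + 1))) * ?w" by (rule bd) (use e w0 in simp)
    also have "\<dots> = e * (?w / (?w + 1))"
    proof -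
      have "2 * (e / (2 * a)) * b = e * (b / a)" if "a > 0" for a b :: real using that by (simp add: field_simps)
      then show ?thesis using w0 by (simp only: add_nonneg_pos zero_less_one)
    qed
    also have "\<dots> \<le> e * 1" using e w0 by (intro mult_left_mono) simp_all
    finally show "\<bar>u (t, x) - ?v\<bar> \<le> 0 + e" by simp
  qed
  then show ?thesis by simp
qed

section \<open>Averages of networks\<close>

text \<open>The condition on widths in recursive form, with \<open>c\<close> the width entering the
  list and the row dimension handed on to the tail; the requirement of two layers is kept
  apart.\<close>

primrec layered :: "nat \<Rightarrow> network \<Rightarrow> bool" where
  "layered c [] \<longleftrightarrow> False"
| "layered c (x # \<Phi>) \<longleftrightarrow> c \<ge> 1 \<and> fst x \<in> carrier_mat (dim_row (fst x)) c \<and> snd x \<in> carrier_vec (dim_row (fst x)) \<and>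
     (if \<Phi> = [] then dim_row (fst x) = 1 else layered (dim_row (fst x)) \<Phi>)"

lemma layered_simps [simp]:
  "layered c [(W, B)] \<longleftrightarrow> c \<ge> 1 \<and> W \<in> carrier_mat 1 c \<and> B \<in> carrier_vec 1"
  "layered c ((W, B) # x # \<Phi>) \<longleftrightarrow> c \<ge> 1 \<and> W \<in> carrier_mat (dim_row W) c \<and> B \<in> carrier_vec (dim_row W) \<and> layered (dim_row W) (x # \<Phi>)"
  by auto

declare layered.simps(2) [simp del]

text \<open>\<open>eval_layers\<close> treats the last layer differently, so the induction separates
  one layer from several and lets the width follow the rows.\<close>

lemma network_induct [case_names Nil single Cons]:
  fixes P :: "nat \<Rightarrow> network \<Rightarrow> bool"
  assumes "\<And>c. P c []" "\<And>c W B. P c [(W, B)]"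
    "\<And>c W B y \<Phi>. P (dim_row W) (y # \<Phi>) \<Longrightarrow> P c ((W, B) # y # \<Phi>)"
  shows "P c \<Phi>"
proof (induction \<Phi> arbitrary: c)
  case (Cons x \<Phi>)
  note IH = Cons.IH
  obtain W B where x: "x = (W, B)" by (cases x)
  show ?case
  proof (cases \<Phi>)
    case Nil
    show ?thesis unfolding x Nil by (rule assms)
  next
    case (Cons y \<Phi>')
    have "P (dim_row W) (y # \<Phi>')" using IH [of "dim_row W"] by (simp only: Cons)
    then show ?thesis unfolding x Cons by (rule assms)
  qed
qed (rule assms)

lemma layeredI:
  assumes "length \<Phi> = L" "L \<ge> 1" "\<forall>k\<le>L. l k \<ge> (1::nat)" "l L = 1"
    "\<forall>k<L. \<Phi> ! k \<in> carrier_mat (l (Suc k)) (l k) \<times> carrier_vec (l (Suc k))"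
  shows "layered (l 0) \<Phi>"
  using assms
proof (induction \<Phi> arbitrary: L l)
  case C: (Cons x \<Phi>)
  obtain W B where x: "x = (W, B)" by (cases x)
  have WB: "W \<in> carrier_mat (l 1) (l 0)" "B \<in> carrier_vec (l 1)"
    using C.prems(2) C.prems(5) [rule_format, of 0] by (auto simp: x)
  have l0: "l 0 \<ge> 1" using C.prems(3) by simp
  show ?case
  proof (cases \<Phi>)
    case Nil
    then show ?thesis using C.prems WB l0 by (simp add: x)
  next
    case (Cons y \<Phi>')
    have "layered (l (Suc 0)) \<Phi>"
    proof (rule C.IH)
      show "length \<Phi> = L - 1" "1 \<le> L - 1" using C.prems(1) Cons by auto
      show "\<forall>k\<le>L - 1. 1 \<le> l (Suc k)" "l (Suc (L - 1)) = 1" using C.prems(2-4) by auto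
      show "\<forall>k<L - 1. \<Phi> ! k \<in> carrier_mat (l (Suc (Suc k))) (l (Suc k)) \<times> carrier_vec (l (Suc (Suc k)))"
      proof (intro allI impI)
        fix k assume "k < L - 1"
        then show "\<Phi> ! k \<in> carrier_mat (l (Suc (Suc k))) (l (Suc k)) \<times> carrier_vec (l (Suc (Suc k)))"
          using C.prems(5) [rule_format, of "Suc k"] by simp
      qed
    qed
    moreover have "dim_row W = l (Suc 0)" using WB by auto
    ultimately show ?thesis using WB l0 Cons by (cases y) (simp add: x)
  qed
qed simp

lemma layered_widths:
  assumes "layered c \<Phi>"
  shows "\<exists>l. l 0 = c \<and> (\<forall>k\<le>length \<Phi>. l k \<ge> (1::nat)) \<and> l (length \<Phi>) = 1 \<and>
    (\<forall>k<length \<Phi>. \<Phi> ! k \<in> carrier_mat (l (Suc k)) (l k) \<times> carrier_vec (l (Suc k)))"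
  using assms
proof (induction c \<Phi> rule: network_induct)
  case (single c W B)
  then show ?case by (intro exI [of _ "case_nat c (\<lambda>_. 1)"]) (auto split: nat.split)
next
  case (Cons c W B y \<Phi>)
  then obtain l where l: "l 0 = dim_row W" "\<forall>k\<le>length (y # \<Phi>). l k \<ge> 1" "l (length (y # \<Phi>)) = 1"
    "\<forall>k<length (y # \<Phi>). (y # \<Phi>) ! k \<in> carrier_mat (l (Suc k)) (l k) \<times> carrier_vec (l (Suc k))"
    by auto
  have c: "c \<ge> 1" "W \<in> carrier_mat (dim_row W) c" "B \<in> carrier_vec (dim_row W)" using Cons(2) by auto
  let ?l = "case_nat c l" and ?N = "(W, B) # y # \<Phi>"
  have 1: "1 \<le> ?l k" if "k \<le> length ?N" for k
  proof (cases k)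
    case (Suc i)
    then show ?thesis using l(2) that by simp
  qed (use c(1) in simp)
  have c0: "W \<in> carrier_mat (l 0) c" "B \<in> carrier_vec (l 0)" using c(2,3) by (simp_all only: l(1))
  have 2: "?N ! k \<in> carrier_mat (?l (Suc k)) (?l k) \<times> carrier_vec (?l (Suc k))" if "k < length ?N" for k
  proof (cases k)
    case 0
    then show ?thesis using c0 by simp
  next
    case (Suc i)
    then show ?thesis using l(4) [rule_format, of i] that by simp
  qed
  have "?l 0 = c" "?l (length ?N) = 1" using l(3) by simp_all
  with 1 2 show ?case by (intro exI [of _ ?l] conjI allI impI)
qed simp

lemma networks_iff_layered: "\<Phi> \<in> networks \<longleftrightarrow> length \<Phi> \<ge> 2 \<and> layered (input_dim \<Phi>) \<Phi>"
proof
  assume "\<Phi> \<in> networks"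
  then obtain L l where l: "L \<ge> 2" "\<forall>k\<le>L. l k \<ge> (1::nat)" "l L = 1" "length \<Phi> = L"
     "\<forall>k<L. \<Phi> ! k \<in> carrier_mat (l (Suc k)) (l k) \<times> carrier_vec (l (Suc k))"
    unfolding networks_def by blast
  then have "layered (l 0) \<Phi>" by (intro layeredI) auto
  moreover have "input_dim \<Phi> = l 0"
    using l(1,4) l(5) [rule_format, of 0] by (cases \<Phi>) (auto simp: input_dim_def)
  ultimately show "length \<Phi> \<ge> 2 \<and> layered (input_dim \<Phi>) \<Phi>" using l by simp
next
  assume "length \<Phi> \<ge> 2 \<and> layered (input_dim \<Phi>) \<Phi>"
  then show "\<Phi> \<in> networks" using layered_widths [of "input_dim \<Phi>" \<Phi>] unfolding networks_def by blast
qed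

section \<open>Parallel copies of a network\<close>

definition stack_vec :: "nat \<Rightarrow> nat \<Rightarrow> (nat \<Rightarrow> real vec) \<Rightarrow> real vec" where
  "stack_vec M n xs = Matrix.vec (M * n) (\<lambda>i. vec_index (xs (i div n)) (i mod n))"

lemma block_index: "i < M * (n::nat) \<Longrightarrow> i div n < M \<and> i mod n < n"
  by (metis less_mult_imp_div_less mod_less_divisor mult_0_right not_less_zero gr0I)

lemma sum_blocks:
  fixes f :: "nat \<Rightarrow> nat \<Rightarrow> 'a::comm_monoid_add"
  assumes "n \<ge> 1"
  shows "(\<Sum>j<M * n. f (j div n) (j mod n)) = (\<Sum>m<M. \<Sum>j<n. f m j)"
proof -
  have "(\<Sum>j<M * n. f (j div n) (j mod n)) = (\<Sum>m<M. \<Sum>j=m * n..<m * n + n. f (j div n) (j mod n))"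
    by (rule sum.nat_group [symmetric])
  also have "\<dots> = (\<Sum>m<M. \<Sum>j<n. f m j)"
  proof (rule sum.cong [OF refl])
    fix m
    have "(\<Sum>j=m * n..<m * n + n. f (j div n) (j mod n)) = (\<Sum>j=0..<n. f ((j + m * n) div n) ((j + m * n) mod n))"
      using sum.shift_bounds_nat_ivl [of "\<lambda>j. f (j div n) (j mod n)" 0 "m * n" n] by (simp add: add.commute)
    also have "\<dots> = (\<Sum>j<n. f m j)" unfolding atLeast0LessThan using assms by (intro sum.cong) auto
    finally show "(\<Sum>j=m * n..<m * n + n. f (j div n) (j mod n)) = (\<Sum>j<n. f m j)" .
  qed
  finally show ?thesis .
qed

lemma affine_index:
  fixes W :: "real mat"
  assumes "i < dim_row W" "dim_vec B = dim_row W" "dim_vec x = dim_col W"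
  shows "vec_index (W *\<^sub>v x + B) i = (\<Sum>j<dim_col W. W $$ (i, j) * vec_index x j) + vec_index B i"
  using assms by (simp add: scalar_prod_def atLeast0LessThan)

text \<open>The block diagonal layer: \<open>div\<close> selects the copy and \<open>mod\<close> the
  entry within it, as in \<open>stack_vec\<close>.\<close>

definition block_layer :: "nat \<Rightarrow> real mat \<times> real vec \<Rightarrow> real mat \<times> real vec" where
  "block_layer M = (\<lambda>(W, B). (Matrix.mat (M * dim_row W) (M * dim_col W)
      (\<lambda>(i, j). if i div dim_row W = j div dim_col W then W $$ (i mod dim_row W, j mod dim_col W) else 0),
     stack_vec M (dim_row W) (\<lambda>_. B)))"

text \<open>Averaging is merged into the last affine map. The bias is kept as it is, being the mean
  of \<open>M\<close> equal biases.\<close>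

definition mean_layer :: "nat \<Rightarrow> real mat \<times> real vec \<Rightarrow> real mat \<times> real vec" where
  "mean_layer M = (\<lambda>(W, B). (Matrix.mat 1 (M * dim_col W) (\<lambda>(i, j). W $$ (0, j mod dim_col W) / M), B))"

text \<open>All copies read the same input; the coordinate scaling of copy \<open>m\<close> is
  absorbed into its columns of the weight matrix, so no layer is added.\<close>

definition scaled_layer :: "nat \<Rightarrow> (nat \<Rightarrow> nat \<Rightarrow> real) \<Rightarrow> real mat \<times> real vec \<Rightarrow> real mat \<times> real vec" where
  "scaled_layer M y = (\<lambda>(W, B). (Matrix.mat (M * dim_row W) (dim_col W)
      (\<lambda>(i, j). W $$ (i mod dim_row W, j) * y (i div dim_row W) j), stack_vec M (dim_row W) (\<lambda>_. B)))"

primrec mean_tail :: "nat \<Rightarrow> network \<Rightarrow> network" where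
  "mean_tail M [] = []"
| "mean_tail M (x # \<Phi>) = (if \<Phi> = [] then mean_layer M x else block_layer M x) # mean_tail M \<Phi>"

text \<open>With at least two layers the first one, which scales, is never the last one, which
  averages.\<close>

primrec mean_network :: "nat \<Rightarrow> (nat \<Rightarrow> nat \<Rightarrow> real) \<Rightarrow> network \<Rightarrow> network" where
  "mean_network M y [] = []"
| "mean_network M y (x # \<Phi>) = scaled_layer M y x # mean_tail M \<Phi>"

lemma dim_stack_vec [simp]: "dim_vec (stack_vec M n xs) = M * n"
  by (simp add: stack_vec_def)

lemma stack_vec_carrier [simp]: "stack_vec M n xs \<in> carrier_vec (M * n)"
  by (simp add: stack_vec_def)

lemma block_layer_eval:
  assumes W: "W \<in> carrier_mat r c" and B: "B \<in> carrier_vec r" and c: "c \<ge> 1" and xs: "\<And>m. m < M \<Longrightarrow> xs m \<in> carrier_vec c"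
  shows "fst (block_layer M (W, B)) *\<^sub>v stack_vec M c xs + snd (block_layer M (W, B)) = stack_vec M r (\<lambda>m. W *\<^sub>v xs m + B)"
proof (rule eq_vecI)
  have dims: "dim_row W = r" "dim_col W = c" "dim_vec B = r" using W B by auto
  show "dim_vec (fst (block_layer M (W, B)) *\<^sub>v stack_vec M c xs + snd (block_layer M (W, B))) = dim_vec (stack_vec M r (\<lambda>m. W *\<^sub>v xs m + B))"
    using dims by (simp add: block_layer_def)
  fix i assume "i < dim_vec (stack_vec M r (\<lambda>m. W *\<^sub>v xs m + B))"
  then have i: "i < M * r" by simp
  note b = block_index [OF i]
  let ?W = "fst (block_layer M (W, B))"
  have "vec_index (?W *\<^sub>v stack_vec M c xs + snd (block_layer M (W, B))) i =
     (\<Sum>j<M * c. ?W $$ (i, j) * vec_index (stack_vec M c xs) j) + vec_index B (i mod r)"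
    using i dims by (subst affine_index) (auto simp: block_layer_def stack_vec_def)
  also have "(\<Sum>j<M * c. ?W $$ (i, j) * vec_index (stack_vec M c xs) j) =
      (\<Sum>j<M * c. (\<lambda>m l. if i div r = m then W $$ (i mod r, l) * vec_index (xs m) l else 0) (j div c) (j mod c))"
    by (rule sum.cong) (use i dims in \<open>auto simp: block_layer_def stack_vec_def\<close>)
  also have "\<dots> = (\<Sum>m<M. \<Sum>l<c. if i div r = m then W $$ (i mod r, l) * vec_index (xs m) l else 0)"
    by (rule sum_blocks [OF c])
  also have "\<dots> = (\<Sum>m<M. if i div r = m then \<Sum>l<c. W $$ (i mod r, l) * vec_index (xs m) l else 0)"
    by (rule sum.cong) auto
  also have "\<dots> = (\<Sum>l<c. W $$ (i mod r, l) * vec_index (xs (i div r)) l)" using b by (simp add: sum.delta)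
  also have "\<dots> + vec_index B (i mod r) = vec_index (W *\<^sub>v xs (i div r) + B) (i mod r)"
    using b dims xs [of "i div r"] by (subst affine_index) auto
  also have "\<dots> = vec_index (stack_vec M r (\<lambda>m. W *\<^sub>v xs m + B)) i" using i by (simp add: stack_vec_def)
  finally show "vec_index (?W *\<^sub>v stack_vec M c xs + snd (block_layer M (W, B))) i = vec_index (stack_vec M r (\<lambda>m. W *\<^sub>v xs m + B)) i" .
qed

lemma scaled_layer_eval:
  assumes W: "W \<in> carrier_mat r c" and B: "B \<in> carrier_vec r"
  shows "fst (scaled_layer M y (W, B)) *\<^sub>v Matrix.vec c x + snd (scaled_layer M y (W, B)) =
    stack_vec M r (\<lambda>m. W *\<^sub>v Matrix.vec c (\<lambda>j. x j * y m j) + B)"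
proof (rule eq_vecI)
  have dims: "dim_row W = r" "dim_col W = c" "dim_vec B = r" using W B by auto
  show "dim_vec (fst (scaled_layer M y (W, B)) *\<^sub>v Matrix.vec c x + snd (scaled_layer M y (W, B))) = dim_vec (stack_vec M r (\<lambda>m. W *\<^sub>v Matrix.vec c (\<lambda>j. x j * y m j) + B))"
    using dims by (simp add: scaled_layer_def)
  fix i assume "i < dim_vec (stack_vec M r (\<lambda>m. W *\<^sub>v Matrix.vec c (\<lambda>j. x j * y m j) + B))"
  then have i: "i < M * r" by simp
  note b = block_index [OF i]
  let ?W = "fst (scaled_layer M y (W, B))"
  have "vec_index (?W *\<^sub>v Matrix.vec c x + snd (scaled_layer M y (W, B))) i =
     (\<Sum>j<c. ?W $$ (i, j) * vec_index (Matrix.vec c x) j) + vec_index B (i mod r)"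
    using i dims by (subst affine_index) (auto simp: scaled_layer_def stack_vec_def)
  also have "(\<Sum>j<c. ?W $$ (i, j) * vec_index (Matrix.vec c x) j) =
      (\<Sum>j<c. W $$ (i mod r, j) * vec_index (Matrix.vec c (\<lambda>j. x j * y (i div r) j)) j)"
    by (rule sum.cong) (use i dims in \<open>auto simp: scaled_layer_def\<close>)
  also have "\<dots> + vec_index B (i mod r) = vec_index (W *\<^sub>v Matrix.vec c (\<lambda>j. x j * y (i div r) j) + B) (i mod r)"
    using b dims by (subst affine_index) auto
  also have "\<dots> = vec_index (stack_vec M r (\<lambda>m. W *\<^sub>v Matrix.vec c (\<lambda>j. x j * y m j) + B)) i" using i by (simp add: stack_vec_def)
  finally show "vec_index (?W *\<^sub>v Matrix.vec c x + snd (scaled_layer M y (W, B))) i = vec_index (stack_vec M r (\<lambda>m. W *\<^sub>v Matrix.vec c (\<lambda>j. x j * y m j) + B)) i" .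
qed

lemma map_vec_stack_vec:
  assumes "\<And>m. m < M \<Longrightarrow> xs m \<in> carrier_vec n"
  shows "map_vec a (stack_vec M n xs) = stack_vec M n (\<lambda>m. map_vec a (xs m))"
proof (rule eq_vecI)
  fix i assume "i < dim_vec (stack_vec M n (\<lambda>m. map_vec a (xs m)))"
  then have i: "i < M * n" by simp
  then show "vec_index (map_vec a (stack_vec M n xs)) i = vec_index (stack_vec M n (\<lambda>m. map_vec a (xs m))) i"
    using block_index [OF i] assms [of "i div n"] by (simp add: stack_vec_def carrier_vecD)
qed simp

text \<open>The invariant is that the state is the stack of the \<open>M\<close> individual states:
  block layers and activations act on each block separately, and only the last layer mixes
  them.\<close>

lemma mean_tail_eval:
  assumes "layered c \<Phi>" "M \<ge> 1" "\<And>m. m < M \<Longrightarrow> xs m \<in> carrier_vec c"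
  shows "vec_index (eval_layers a (mean_tail M \<Phi>) (stack_vec M c xs)) 0 = (\<Sum>m<M. vec_index (eval_layers a \<Phi> (xs m)) 0) / M"
  using assms
proof (induction c \<Phi> arbitrary: xs rule: network_induct)
  case (single c W B)
  have dims: "dim_row W = 1" "dim_col W = c" "dim_vec B = 1" and c: "c \<ge> 1" using single(1) by auto
  obtain W' where W': "mean_layer M (W, B) = (W', B)" "W' = Matrix.mat 1 (M * c) (\<lambda>(i, j). W $$ (0, j mod c) / M)"
    using dims by (simp add: mean_layer_def)
  have "vec_index (eval_layers a (mean_tail M [(W, B)]) (stack_vec M c xs)) 0 = (\<Sum>j<M * c. W' $$ (0, j) * vec_index (stack_vec M c xs) j) + vec_index B 0"
  proof -
    have "eval_layers a (mean_tail M [(W, B)]) v = W' *\<^sub>v v + B" for v by (simp add: W'(1))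
    then show ?thesis using dims by (simp only:) (subst affine_index, auto simp: W'(2))
  qed
  also have "(\<Sum>j<M * c. W' $$ (0, j) * vec_index (stack_vec M c xs) j) = (\<Sum>j<M * c. (\<lambda>m l. W $$ (0, l) / M * vec_index (xs m) l) (j div c) (j mod c))"
    by (rule sum.cong) (auto simp: W'(2) stack_vec_def)
  also have "\<dots> = (\<Sum>m<M. \<Sum>l<c. W $$ (0, l) / M * vec_index (xs m) l)" by (rule sum_blocks [OF c])
  also have "\<dots> + vec_index B 0 = (\<Sum>m<M. (\<Sum>l<c. W $$ (0, l) * vec_index (xs m) l) + vec_index B 0) / M"
    using single(2) by (simp add: sum.distrib add_divide_distrib sum_divide_distrib)
  also have "\<dots> = (\<Sum>m<M. vec_index (eval_layers a [(W, B)] (xs m)) 0) / M"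
  proof -
    have "(\<Sum>l<c. W $$ (0, l) * vec_index (xs m) l) + vec_index B 0 = vec_index (eval_layers a [(W, B)] (xs m)) 0" if "m < M" for m
      using dims carrier_vecD [OF single(3) [OF that]] affine_index [of 0 W B "xs m"] by simp
    then show ?thesis by simp
  qed
  finally show ?case .
next
  case (Cons c W B y \<Phi>)
  let ?r = "dim_row W"
  have W: "W \<in> carrier_mat ?r c" and B: "B \<in> carrier_vec ?r" and c: "c \<ge> 1" and ly: "layered ?r (y # \<Phi>)" using Cons(2) by auto
  have car: "W *\<^sub>v xs m + B \<in> carrier_vec ?r" for m by (rule carrier_vecI) (simp add: carrier_vecD [OF B])
  obtain W' B' where WB': "block_layer M (W, B) = (W', B')" by (cases "block_layer M (W, B)")
  have "eval_layers a (mean_tail M ((W, B) # y # \<Phi>)) (stack_vec M c xs) =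
      eval_layers a (mean_tail M (y # \<Phi>)) (map_vec a (W' *\<^sub>v stack_vec M c xs + B'))"
    by (cases "mean_tail M (y # \<Phi>)"; cases \<Phi>) (simp_all add: WB')
  also have "W' *\<^sub>v stack_vec M c xs + B' = stack_vec M ?r (\<lambda>m. W *\<^sub>v xs m + B)"
    using block_layer_eval [OF W B c, where xs = xs and M = M] Cons(4) by (simp only: WB' fst_conv snd_conv)
  also have "map_vec a \<dots> = stack_vec M ?r (\<lambda>m. map_vec a (W *\<^sub>v xs m + B))"
    by (rule map_vec_stack_vec) (rule car)
  finally have eq: "eval_layers a (mean_tail M ((W, B) # y # \<Phi>)) (stack_vec M c xs) =
      eval_layers a (mean_tail M (y # \<Phi>)) (stack_vec M ?r (\<lambda>m. map_vec a (W *\<^sub>v xs m + B)))" .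
  show ?case unfolding eq by (subst Cons(1) [OF ly Cons(3)]) (use car in auto)
qed simp

lemma mean_network_eval:
  assumes "layered c \<Phi>" "length \<Phi> \<ge> 2" "M \<ge> 1"
  shows "vec_index (eval_layers a (mean_network M y \<Phi>) (Matrix.vec c x)) 0 =
    (\<Sum>m<M. vec_index (eval_layers a \<Phi> (Matrix.vec c (\<lambda>j. x j * y m j))) 0) / M"
proof -
  obtain W B z \<Phi>' where \<Phi>: "\<Phi> = (W, B) # z # \<Phi>'"
    using assms(2) by (cases \<Phi>; cases "tl \<Phi>") auto
  let ?r = "dim_row W"
  have W: "W \<in> carrier_mat ?r c" and B: "B \<in> carrier_vec ?r" and ly: "layered ?r (z # \<Phi>')" using assms(1) \<Phi> by auto
  have car: "W *\<^sub>v v + B \<in> carrier_vec ?r" for v by (rule carrier_vecI) (simp add: carrier_vecD [OF B])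
  obtain W' B' where WB': "scaled_layer M y (W, B) = (W', B')" by (cases "scaled_layer M y (W, B)")
  have "eval_layers a (mean_network M y \<Phi>) (Matrix.vec c x) =
      eval_layers a (mean_tail M (z # \<Phi>')) (map_vec a (W' *\<^sub>v Matrix.vec c x + B'))"
    unfolding \<Phi> by (cases "mean_tail M (z # \<Phi>')"; cases \<Phi>') (simp_all add: WB')
  also have "W' *\<^sub>v Matrix.vec c x + B' = stack_vec M ?r (\<lambda>m. W *\<^sub>v Matrix.vec c (\<lambda>j. x j * y m j) + B)"
    using scaled_layer_eval [OF W B, of M y x] by (simp add: WB')
  also have "map_vec a \<dots> = stack_vec M ?r (\<lambda>m. map_vec a (W *\<^sub>v Matrix.vec c (\<lambda>j. x j * y m j) + B))"
    by (rule map_vec_stack_vec) (rule car)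
  finally have eq: "eval_layers a (mean_network M y \<Phi>) (Matrix.vec c x) =
      eval_layers a (mean_tail M (z # \<Phi>')) (stack_vec M ?r (\<lambda>m. map_vec a (W *\<^sub>v Matrix.vec c (\<lambda>j. x j * y m j) + B)))" .
  show ?thesis unfolding eq by (subst mean_tail_eval [OF ly assms(3)]) (use car \<Phi> in auto)
qed

lemma layered_mean_tail: "layered c \<Phi> \<Longrightarrow> M \<ge> 1 \<Longrightarrow> layered (M * c) (mean_tail M \<Phi>)"
proof (induction c \<Phi> rule: network_induct)
  case (single c W B)
  then show ?case by (auto simp: mean_layer_def)
next
  case (Cons c W B y \<Phi>)
  obtain z \<Psi> where z: "mean_tail M (y # \<Phi>) = z # \<Psi>" by (cases "mean_tail M (y # \<Phi>)"; cases \<Phi>) auto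
  have "layered (M * dim_row W) (mean_tail M (y # \<Phi>))" using Cons by auto
  then have "layered (M * dim_row W) (z # \<Psi>)" by (simp only: z)
  moreover have "dim_col W = c" "dim_vec B = dim_row W" "M * c \<ge> 1" using Cons by auto
  moreover have "mean_tail M ((W, B) # y # \<Phi>) = block_layer M (W, B) # z # \<Psi>"
    by (simp only: mean_tail.simps(2) [of M "(W, B)" "y # \<Phi>"] z list.distinct if_False)
  ultimately show ?case by (simp add: block_layer_def del: mean_tail.simps)
qed simp

lemma length_mean_tail [simp]: "length (mean_tail M \<Phi>) = length \<Phi>"
  by (induction \<Phi>) auto

lemma layered_mean_network:
  assumes "layered c \<Phi>" "length \<Phi> \<ge> 2" "M \<ge> 1" shows "layered c (mean_network M y \<Phi>)"
proof -
  obtain W B z \<Phi>' where \<Phi>: "\<Phi> = (W, B) # z # \<Phi>'"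
    using assms(2) by (cases \<Phi>; cases "tl \<Phi>") auto
  obtain u \<Psi> where u: "mean_tail M (z # \<Phi>') = u # \<Psi>" by (cases "mean_tail M (z # \<Phi>')"; cases \<Phi>') auto
  have ly: "c \<ge> 1" "W \<in> carrier_mat (dim_row W) c" "B \<in> carrier_vec (dim_row W)" "layered (dim_row W) (z # \<Phi>')"
    using assms(1) unfolding \<Phi> layered_simps by blast+
  have "layered (M * dim_row W) (mean_tail M (z # \<Phi>'))" by (rule layered_mean_tail [OF ly(4) assms(3)])
  then have "layered (M * dim_row W) (u # \<Psi>)" by (simp only: u)
  moreover have "dim_col W = c" "dim_vec B = dim_row W" "c \<ge> 1"
    using carrier_matD(2) [OF ly(2)] carrier_vecD [OF ly(3)] ly(1) by blast+
  moreover have "mean_network M y \<Phi> = scaled_layer M y (W, B) # u # \<Psi>" by (simp only: \<Phi> mean_network.simps u)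
  ultimately show ?thesis by (simp add: scaled_layer_def del: mean_network.simps)
qed

lemma param_count_Cons: "param_count ((W, B) # \<Phi>) = dim_row W * (dim_col W + 1) + param_count \<Phi>"
  by (simp add: param_count_def)

text \<open>The zero blocks count as parameters, hence the square of \<open>M\<close>; it is
  affordable because \<open>M\<close> will be polynomial in the dimension and the inverse
  accuracy.\<close>

lemma param_count_mean_tail: "layered c \<Phi> \<Longrightarrow> M \<ge> 1 \<Longrightarrow> param_count (mean_tail M \<Phi>) \<le> M\<^sup>2 * param_count \<Phi>"
proof (induction c \<Phi> rule: network_induct)
  case (single c W B)
  then have "M * dim_col W + 1 \<le> M\<^sup>2 * (dim_col W + 1)"
  proof -
    have "M * dim_col W \<le> M\<^sup>2 * dim_col W" using single by (intro mult_right_mono) (auto simp: power2_eq_square)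
    moreover have "1 \<le> M\<^sup>2" using single by simp
    ultimately show ?thesis unfolding distrib_left by linarith
  qed
  moreover have "dim_row W = 1" using single by auto
  ultimately show ?case by (simp add: mean_layer_def param_count_def)
next
  case (Cons c W B y \<Phi>)
  have "M * dim_row W * (M * dim_col W + 1) \<le> M * dim_row W * (M * (dim_col W + 1))"
    using Cons by (intro mult_left_mono) auto
  also have "\<dots> = M\<^sup>2 * (dim_row W * (dim_col W + 1))" by (simp only: power2_eq_square mult_ac)
  finally have 1: "M * dim_row W * (M * dim_col W + 1) \<le> M\<^sup>2 * (dim_row W * (dim_col W + 1))" .
  have 2: "param_count (mean_tail M (y # \<Phi>)) \<le> M\<^sup>2 * param_count (y # \<Phi>)" using Cons by auto
  have "param_count (mean_tail M ((W, B) # y # \<Phi>)) = M * dim_row W * (M * dim_col W + 1) + param_count (mean_tail M (y # \<Phi>))"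
    by (simp add: block_layer_def param_count_Cons)
  then show ?case using add_mono [OF 1 2] by (simp only: param_count_Cons [of W B] distrib_left)
qed (simp add: param_count_def)

lemma param_count_mean_network:
  assumes "layered c \<Phi>" "length \<Phi> \<ge> 2" "M \<ge> 1"
  shows "param_count (mean_network M y \<Phi>) \<le> M\<^sup>2 * param_count \<Phi>"
proof -
  obtain W B z \<Phi>' where \<Phi>: "\<Phi> = (W, B) # z # \<Phi>'"
    using assms(2) by (cases \<Phi>; cases "tl \<Phi>") auto
  have 1: "M * dim_row W * (dim_col W + 1) \<le> M\<^sup>2 * (dim_row W * (dim_col W + 1))"
    unfolding mult.assoc using assms(3) by (intro mult_right_mono) (auto simp: power2_eq_square)
  have "layered (dim_row W) (z # \<Phi>')" using assms(1) unfolding \<Phi> layered_simps by blast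
  then have 2: "param_count (mean_tail M (z # \<Phi>')) \<le> M\<^sup>2 * param_count (z # \<Phi>')"
    by (rule param_count_mean_tail [OF _ assms(3)])
  have "param_count (mean_network M y \<Phi>) = M * dim_row W * (dim_col W + 1) + param_count (mean_tail M (z # \<Phi>'))"
    by (simp add: \<Phi> scaled_layer_def param_count_Cons)
  then show ?thesis using add_mono [OF 1 2] by (simp only: \<Phi> param_count_Cons [of W B] distrib_left)
qed

lemma input_dim_layered: "layered c \<Phi> \<Longrightarrow> input_dim \<Phi> = c"
proof (cases \<Phi>)
  case (Cons x \<Phi>')
  assume "layered c \<Phi>"
  then have "fst x \<in> carrier_mat (dim_row (fst x)) c" unfolding Cons layered.simps(2) by blast
  then show ?thesis unfolding Cons input_dim_def list.sel by (rule carrier_matD(2))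
qed simp

lemma average_network:
  assumes \<Phi>: "\<Phi> \<in> networks" and r: "realizes_on a \<Phi> d" and M: "M \<ge> 1"
  obtains \<Psi> where "\<Psi> \<in> networks" "param_count \<Psi> \<le> M\<^sup>2 * param_count \<Phi>" "realizes_on a \<Psi> d"
    "\<And>x. x \<in> Rn d \<Longrightarrow> realization a \<Psi> x = (\<Sum>m<M. realization a \<Phi> (\<lambda>i\<in>{..<d}. x i * y m i)) / M"
proof -
  have d: "input_dim \<Phi> = d" and cont: "continuous_on (Rn d) (realization a \<Phi>)"
    using r by (auto simp: realizes_on_def cfun_def)
  have ly: "layered d \<Phi>" and len: "length \<Phi> \<ge> 2" using \<Phi> by (auto simp: networks_iff_layered d)
  let ?\<Psi> = "mean_network M y \<Phi>"
  have lyP: "layered d ?\<Psi>" by (rule layered_mean_network [OF ly len M])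
  have dP: "input_dim ?\<Psi> = d" by (rule input_dim_layered [OF lyP])
  have lenP: "length ?\<Psi> = length \<Phi>" by (cases \<Phi>) auto
  have val: "realization a ?\<Psi> x = (\<Sum>m<M. realization a \<Phi> (\<lambda>i\<in>{..<d}. x i * y m i)) / M" if "x \<in> Rn d" for x
  proof -
    have "Matrix.vec d (\<lambda>j. x j * y m j) = Matrix.vec d (\<lambda>i\<in>{..<d}. x i * y m i)" for m
      by (rule eq_vecI) auto
    then show ?thesis
      using that mean_network_eval [OF ly len M, of a y x] by (simp add: realization_def d dP)
  qed
  have "continuous_on (Rn d) (realization a ?\<Psi>)"
  proof (subst continuous_on_cong [OF refl val])
    have "continuous_on (Rn d) (\<lambda>x. realization a \<Phi> (\<lambda>i\<in>{..<d}. x i * y m i))" for m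
    proof (rule continuous_on_compose2 [OF cont])
      show "continuous_on (Rn d) (\<lambda>x. \<lambda>i\<in>{..<d}. x i * y m i)"
        by (rule continuous_on_restrict_lessThan) (intro continuous_intros continuous_on_component)
      show "(\<lambda>x. \<lambda>i\<in>{..<d}. x i * y m i) ` Rn d \<subseteq> Rn d" by (rule image_subsetI) simp
    qed
    then show "continuous_on (Rn d) (\<lambda>x. (\<Sum>m<M. realization a \<Phi> (\<lambda>i\<in>{..<d}. x i * y m i)) / M)"
      using M by (intro continuous_intros) auto
  qed
  moreover have "realization a ?\<Psi> \<in> Rn d \<rightarrow>\<^sub>E UNIV" unfolding realization_def dP by simp
  ultimately have R: "realizes_on a ?\<Psi> d" by (simp add: realizes_on_def dP cfun_def)
  have N: "?\<Psi> \<in> networks" using lyP len by (simp add: networks_iff_layered dP lenP)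
  show thesis by (rule that [OF N param_count_mean_network [OF ly len M] R val])
qed

section \<open>Greedy sampling\<close>

lemma powr_le_power:
  fixes n q :: real
  assumes "n \<ge> 0" "q \<ge> 0" shows "n powr q \<le> (1 + n) ^ nat \<lceil>q\<rceil>"
proof -
  have "n powr q \<le> (1 + n) powr q" using assms by (intro powr_mono2) auto
  also have "\<dots> \<le> (1 + n) powr (real (nat \<lceil>q\<rceil>))" using assms by (intro powr_mono) (auto simp: real_nat_ceiling_ge)
  also have "\<dots> = (1 + n) ^ nat \<lceil>q\<rceil>" using assms by (intro powr_realpow) auto
  finally show ?thesis .
qed

lemma one_plus_powr_le_power:
  fixes n q :: real
  assumes "n \<ge> 0" "q \<ge> 0" shows "1 + n powr q \<le> 2 * (1 + n) ^ nat \<lceil>q\<rceil>"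
proof -
  have "1 \<le> (1 + n) ^ nat \<lceil>q\<rceil>" using assms by (intro one_le_power) auto
  then show ?thesis using powr_le_power [OF assms] by linarith
qed

text \<open>The exponent \<open>Suc N\<close> is positive even for \<open>N = 0\<close>, as the
  infimum in \<open>poly_growth\<close> demands.\<close>

lemma power_le_powr:
  fixes n :: real
  assumes "n \<ge> 0" shows "(1 + n) ^ N \<le> 2 ^ N * (1 + n powr real (Suc N))"
proof (cases "n \<le> 1")
  case True
  then have "(1 + n) ^ N \<le> 2 ^ N" using assms by (intro power_mono) auto
  also have "\<dots> \<le> 2 ^ N * (1 + n powr real (Suc N))" by simp
  finally show ?thesis .
next
  case False
  then have "(1 + n) ^ N \<le> (2 * n) ^ N" by (intro power_mono) auto
  also have "\<dots> = 2 ^ N * n ^ N" by (rule power_mult_distrib)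
  also have "n ^ N \<le> n ^ Suc N" using False by (intro power_increasing) auto
  also have "n ^ Suc N = n powr real (Suc N)" using False by (intro powr_realpow [symmetric]) auto
  also have "n powr real (Suc N) \<le> 1 + n powr real (Suc N)" by simp
  finally show ?thesis by simp
qed

lemma poly_growth_iff: "poly_growth T d u \<longleftrightarrow> poly_bounded_on T d u"
proof
  assume "poly_growth T d u"
  then obtain q where q: "q > 0" "(SUP (t, x)\<in>{0..T} \<times> Rn d. ereal (\<bar>u (t, x)\<bar> / (1 + norm_Rn d x powr q))) < \<infinity>"
    unfolding poly_growth_def INF_less_iff by auto
  define X where "X = (SUP (t, x)\<in>{0..T} \<times> Rn d. ereal (\<bar>u (t, x)\<bar> / (1 + norm_Rn d x powr q)))"
  have "X \<noteq> \<infinity>" using q(2) unfolding X_def by (rule less_imp_neq)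
  then obtain n :: nat where n: "X < ereal (real n)" unfolding less_PInf_Ex_of_nat by (rule exE)
  show "poly_bounded_on T d u"
  proof (rule poly_bounded_onI [of "2 * real n"])
    fix t x assume tx: "t \<in> {0..T}" "x \<in> Rn d"
    have "ereal (\<bar>u (t, x)\<bar> / (1 + norm_Rn d x powr q)) \<le> X"
      unfolding X_def by (rule SUP_upper2 [of "(t, x)"]) (use tx in simp_all)
    also have "\<dots> < ereal (real n)" by (rule n)
    finally have "\<bar>u (t, x)\<bar> / (1 + norm_Rn d x powr q) \<le> real n" by simp
    then have "\<bar>u (t, x)\<bar> \<le> real n * (1 + norm_Rn d x powr q)"
      by (subst (asm) pos_divide_le_eq) (simp_all add: add_pos_nonneg)
    also have "\<dots> \<le> real n * (2 * (1 + norm_Rn d x) ^ nat \<lceil>q\<rceil>)"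
      using q(1) by (intro mult_left_mono one_plus_powr_le_power) simp_all
    finally show "\<bar>u (t, x)\<bar> \<le> 2 * real n * (1 + norm_Rn d x) ^ nat \<lceil>q\<rceil>" by (simp only: mult_ac)
  qed simp
next
  assume "poly_bounded_on T d u"
  then obtain C N where C: "C \<ge> 0" "\<And>t x. t \<in> {0..T} \<Longrightarrow> x \<in> Rn d \<Longrightarrow> \<bar>u (t, x)\<bar> \<le> C * (1 + norm_Rn d x) ^ N"
    unfolding poly_bounded_on_def by blast
  have "(SUP (t, x)\<in>{0..T} \<times> Rn d. ereal (\<bar>u (t, x)\<bar> / (1 + norm_Rn d x powr real (Suc N)))) \<le> ereal (C * 2 ^ N)"
  proof (rule SUP_least, clarify)
    fix t x assume tx: "t \<in> {0..T}" "x \<in> Rn d"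
    have "\<bar>u (t, x)\<bar> \<le> C * (2 ^ N * (1 + norm_Rn d x powr real (Suc N)))"
      using C(2) [OF tx] mult_left_mono [OF power_le_powr C(1), of "norm_Rn d x" N] by simp
    then have "\<bar>u (t, x)\<bar> / (1 + norm_Rn d x powr real (Suc N)) \<le> C * 2 ^ N"
      by (subst pos_divide_le_eq) (simp_all add: add_pos_nonneg mult.assoc)
    then show "ereal (\<bar>u (t, x)\<bar> / (1 + norm_Rn d x powr real (Suc N))) \<le> ereal (C * 2 ^ N)" by simp
  qed
  also have "\<dots> < \<infinity>" by simp
  finally show "poly_growth T d u"
    unfolding poly_growth_def INF_less_iff by (intro bexI [of _ "real (Suc N)"]) simp_all
qed

section \<open>Solution families as Feynman-Kac functions\<close>

lemma viscosity_solution_cong: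
  assumes "\<And>z. z \<in> {0<..<T} \<times> Rn d \<Longrightarrow> u z = v z"
  shows "viscosity_solution T \<alpha> \<beta> d u \<longleftrightarrow> viscosity_solution T \<alpha> \<beta> d v"
  unfolding viscosity_solution_def Let_def using assms by (intro ball_cong refl) simp

text \<open>Since families are extensional in the dimension and in the point, equality of functions
  is literal, and one equivalence yields existence and uniqueness together.\<close>

lemma solution_family_iff:
  assumes T: "T > 0" and c: "\<And>d. d \<ge> 1 \<Longrightarrow> continuous_on (Rn d) (\<phi> d)"
    and b: "\<And>d x. d \<ge> 1 \<Longrightarrow> x \<in> Rn d \<Longrightarrow> \<bar>\<phi> d x\<bar> \<le> C d * (1 + norm_Rn d x) ^ N"
  shows "solution_family T \<alpha> \<beta> \<phi> u \<longleftrightarrow> u = (\<lambda>d\<in>{1..}. \<lambda>z\<in>{0..T} \<times> Rn d. feynman_kac \<alpha> \<beta> T d (\<phi> d) z)"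
    (is "?l \<longleftrightarrow> u = ?U")
proof
  assume l: ?l
  show "u = ?U"
  proof (rule extensionalityI [of _ "{1..}"])
    show "u \<in> extensional {1..}" using l by (simp add: solution_family_def PiE_def)
    fix d :: nat assume d: "d \<in> {1..}"
    then have d1: "d \<ge> 1" by simp
    have ud: "u d \<in> cfun ({0..T} \<times> Rn d)" using l d unfolding solution_family_def by (blast dest: PiE_mem)
    have "u d = (\<lambda>z\<in>{0..T} \<times> Rn d. feynman_kac \<alpha> \<beta> T d (\<phi> d) z)"
    proof (rule extensionalityI [of _ "{0..T} \<times> Rn d"])
      show "u d \<in> extensional ({0..T} \<times> Rn d)" using ud by (simp add: cfun_def PiE_def)
      fix z assume z: "z \<in> {0..T} \<times> Rn d"
      then obtain t x where tx: "z = (t, x)" "t \<in> {0..T}" "x \<in> Rn d" by (rule SigmaE)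
      have "u d (t, x) = feynman_kac \<alpha> \<beta> T d (\<phi> d) (t, x)"
      proof (rule viscosity_solution_unique [OF T d1 c [OF d1] b [OF d1] _ _ _ _ tx(2,3)])
        show "continuous_on ({0..T} \<times> Rn d) (u d)" using ud by (simp add: cfun_def)
        show "poly_bounded_on T d (u d)" "viscosity_solution T \<alpha> \<beta> d (u d)"
          using l d1 unfolding solution_family_def poly_growth_iff by blast+
        show "\<And>x. x \<in> Rn d \<Longrightarrow> u d (T, x) = \<phi> d x" using l d1 unfolding solution_family_def by blast
      qed
      then show "u d z = (\<lambda>z\<in>{0..T} \<times> Rn d. feynman_kac \<alpha> \<beta> T d (\<phi> d) z) z" using z by (simp only: tx(1) restrict_apply' if_True)
    qed simp
    then show "u d = ?U d" using d by simp
  qed simp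
next
  assume u: "u = ?U"
  have ud: "u d = (\<lambda>z\<in>{0..T} \<times> Rn d. feynman_kac \<alpha> \<beta> T d (\<phi> d) z)" if "d \<ge> 1" for d using that by (simp add: u)
  have uz: "u d z = feynman_kac \<alpha> \<beta> T d (\<phi> d) z" if "d \<ge> 1" "z \<in> {0..T} \<times> Rn d" for d z
    unfolding ud [OF that(1)] using that(2) by (rule restrict_apply')
  show ?l
    unfolding solution_family_def
  proof (intro conjI allI impI ballI)
    show "u \<in> (\<Pi>\<^sub>E d\<in>{1..}. cfun ({0..T} \<times> Rn d))"
    proof (rule PiE_I)
      fix d :: nat assume "d \<in> {1..}"
      then have d: "d \<ge> 1" by simp
      have "continuous_on ({0..T} \<times> Rn d) (u d)"
        by (rule iffD2 [OF continuous_on_cong [OF refl uz [OF d]] feynman_kac_continuous' [OF d c [OF d] b [OF d]]])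
      moreover have "u d \<in> {0..T} \<times> Rn d \<rightarrow>\<^sub>E UNIV" unfolding ud [OF d] by simp
      ultimately show "u d \<in> cfun ({0..T} \<times> Rn d)" unfolding cfun_def by blast
    qed (simp add: u)
    fix d :: nat assume d: "d \<ge> 1"
    show "u d (T, x) = \<phi> d x" if "x \<in> Rn d" for x
    proof -
      have "(T, x) \<in> {0..T} \<times> Rn d" using that T by simp
      from uz [OF d this] show ?thesis by (simp only: feynman_kac_terminal [OF that])
    qed
    obtain C1 N1 where 1: "C1 \<ge> 0" "\<And>t x. t \<in> {0..T} \<Longrightarrow> x \<in> Rn d \<Longrightarrow> \<bar>feynman_kac \<alpha> \<beta> T d (\<phi> d) (t, x)\<bar> \<le> C1 * (1 + norm_Rn d x) ^ N1"
      using feynman_kac_poly_bounded' [OF d c [OF d] b [OF d], of T \<alpha> \<beta>] unfolding poly_bounded_on_def by blast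
    show "poly_growth T d (u d)"
      unfolding poly_growth_iff
    proof (rule poly_bounded_onI [OF 1(1)])
      fix t x assume tx: "t \<in> {0..T}" "x \<in> Rn d"
      show "\<bar>u d (t, x)\<bar> \<le> C1 * (1 + norm_Rn d x) ^ N1" unfolding uz [OF d SigmaI [OF tx]] by (rule 1(2) [OF tx])
    qed
    show "viscosity_solution T \<alpha> \<beta> d (u d)"
    proof (rule iffD2 [OF viscosity_solution_cong feynman_kac_viscosity_solution [OF d c [OF d] b [OF d]]])
      fix z assume "z \<in> {0<..<T} \<times> Rn d"
      then have "z \<in> {0..T} \<times> Rn d" by (cases z) simp
      then show "u d z = feynman_kac \<alpha> \<beta> T d (\<phi> d) z" by (rule uz [OF d])
    qed
  qed
qed

text \<open>A random variable cannot exceed its mean everywhere; this turns expectations into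
  concrete samples.\<close>

lemma (in prob_space) exists_le_expectation:
  fixes X :: "'a \<Rightarrow> real"
  assumes "integrable M X" obtains y where "y \<in> space M" "X y \<le> expectation X"
proof (rule ccontr)
  assume "\<not> thesis"
  then have "AE y in M. expectation X < X y" using that by (intro AE_I2) (force simp: not_le [symmetric])
  then have "expectation (\<lambda>_. expectation X) < expectation X"
    by (intro integral_less_AE_space assms) (auto simp: emeasure_space_1)
  then show False by (simp add: prob_space)
qed

text \<open>The samples are chosen greedily: since the summands are centred, adding the best next sample raises
  the functional by no more than its mean increment (Maurey's argument). The second summand of the functional
  controls a high moment, which reduces the $L^p$ norm to the $L^2$ norm.\<close>

lemma greedy_sampling:
  fixes \<eta> :: "'x \<Rightarrow> 'y \<Rightarrow> real" and M :: nat
  assumes P: "prob_space P" and Q: "prob_space Q"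
    and meas: "(\<lambda>(x, y). \<eta> x y) \<in> borel_measurable (Q \<Otimes>\<^sub>M P)"
    and H: "\<And>x y. x \<in> space Q \<Longrightarrow> y \<in> space P \<Longrightarrow> \<bar>\<eta> x y\<bar> \<le> H y"
    and Hint: "integrable P H" "integrable P (\<lambda>y. H y ^ 2)" "integrable P (\<lambda>y. H y ^ (2 * k))"
    and centred: "\<And>x. x \<in> space Q \<Longrightarrow> (\<integral>y. \<eta> x y \<partial>P) = 0"
    and AB: "A \<ge> 0" "B \<ge> 0"
  shows "\<exists>ys. (\<forall>j. ys j \<in> space P) \<and>
    A * (\<integral>x. (\<Sum>j<M. \<eta> x (ys j))\<^sup>2 \<partial>Q) + B * (\<Sum>j<M. \<integral>x. \<eta> x (ys j) ^ (2 * k) \<partial>Q)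
      \<le> real M * (A * (\<integral>y. H y ^ 2 \<partial>P) + B * (\<integral>y. H y ^ (2 * k) \<partial>P))"
proof (induction M)
  case 0
  obtain y where "y \<in> space P" using prob_space.not_empty [OF P] by blast
  then show ?case by (intro exI [of _ "\<lambda>_. y"]) simp
next
  case (Suc M)
  interpret PP: prob_space P by (rule P)
  interpret QQ: prob_space Q by (rule Q)
  interpret pair_sigma_finite Q P ..
  let ?V = "\<integral>y. H y ^ 2 \<partial>P" and ?K = "\<integral>y. H y ^ (2 * k) \<partial>P"
  from Suc obtain ys where ys: "\<And>j. ys j \<in> space P"
    and IH: "A * (\<integral>x. (\<Sum>j<M. \<eta> x (ys j))\<^sup>2 \<partial>Q) + B * (\<Sum>j<M. \<integral>x. \<eta> x (ys j) ^ (2 * k) \<partial>Q) \<le> real M * (A * ?V + B * ?K)"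
    by blast
  have m1: "(\<lambda>x. \<eta> x y) \<in> borel_measurable Q" if "y \<in> space P" for y
    using measurable_compose [OF measurable_Pair2' [OF that] meas] by simp
  have Hn: "0 \<le> H y" if "y \<in> space P" for y
    using H [OF _ that] QQ.not_empty by (meson abs_ge_zero ex_in_conv order_trans)
  have bdd: "integrable Q g" if "g \<in> borel_measurable Q" "\<And>x. x \<in> space Q \<Longrightarrow> \<bar>g x\<bar> \<le> b" for g :: "'x \<Rightarrow> real" and b
    by (rule QQ.integrable_const_bound [of _ b]) (use that in auto)
  define S where "S x = (\<Sum>j<M. \<eta> x (ys j))" for x
  define s where "s = (\<Sum>j<M. H (ys j))"
  have Sm: "S \<in> borel_measurable Q" unfolding S_def by (intro borel_measurable_sum m1 ys)
  have Sb: "\<bar>S x\<bar> \<le> s" if "x \<in> space Q" for x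
    unfolding S_def s_def by (rule order_trans [OF sum_abs sum_mono]) (rule H [OF that ys])
  have s0: "s \<ge> 0" unfolding s_def by (intro sum_nonneg Hn ys)
  have Sint: "integrable Q (\<lambda>x. (S x)\<^sup>2)"
  proof (rule bdd)
    show "\<bar>(S x)\<^sup>2\<bar> \<le> s\<^sup>2" if "x \<in> space Q" for x
      using power_mono [OF Sb [OF that], of 2] by simp
  qed (use Sm in simp)
  have int_pair: "integrable (Q \<Otimes>\<^sub>M P) (\<lambda>(x, y). S x * \<eta> x y)"
  proof (rule Fubini_integrable)
    have "(\<lambda>z. S (fst z)) \<in> borel_measurable (Q \<Otimes>\<^sub>M P)" by (rule measurable_compose [OF measurable_fst Sm])
    from borel_measurable_times [OF this meas]
    show mm: "(\<lambda>(x, y). S x * \<eta> x y) \<in> borel_measurable (Q \<Otimes>\<^sub>M P)"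
      by (simp add: case_prod_beta')
    have ma: "(\<lambda>(x, y). \<bar>S x * \<eta> x y\<bar>) \<in> borel_measurable (Q \<Otimes>\<^sub>M P)"
      using borel_measurable_abs [OF mm] by (simp add: case_prod_beta')
    have i: "integrable P (\<lambda>y. s * H y)" by (intro integrable_mult_right Hint)
    have m2: "(\<lambda>y. \<eta> x y) \<in> borel_measurable P" if "x \<in> space Q" for x
      using measurable_compose [OF measurable_Pair1' [OF that] meas] by simp
    have le: "\<bar>S x * \<eta> x y\<bar> \<le> s * H y" if "x \<in> space Q" "y \<in> space P" for x y
      unfolding abs_mult by (rule mult_mono [OF Sb [OF that(1)] H [OF that] s0]) simp
    have ix: "integrable P (\<lambda>y. S x * \<eta> x y)" if "x \<in> space Q" for x
      by (rule Bochner_Integration.integrable_bound [OF i])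
        (use m2 [OF that] le [OF that] Hn s0 in \<open>auto intro!: AE_I2\<close>)
    then show "AE x in Q. integrable P (\<lambda>y. case (x, y) of (x, y) \<Rightarrow> S x * \<eta> x y)" by (auto intro!: AE_I2)
    have "integrable Q (\<lambda>x. \<integral>y. \<bar>S x * \<eta> x y\<bar> \<partial>P)"
    proof (rule bdd)
      show "(\<lambda>x. \<integral>y. \<bar>S x * \<eta> x y\<bar> \<partial>P) \<in> borel_measurable Q"
        by (rule sigma_finite_measure.borel_measurable_lebesgue_integral [OF PP.sigma_finite_measure_axioms ma])
      fix x assume x: "x \<in> space Q"
      have "(\<integral>y. \<bar>S x * \<eta> x y\<bar> \<partial>P) \<le> (\<integral>y. s * H y \<partial>P)"
        by (rule integral_mono [OF integrable_abs [OF ix [OF x]] i le [OF x]])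
      then show "\<bar>\<integral>y. \<bar>S x * \<eta> x y\<bar> \<partial>P\<bar> \<le> (\<integral>y. s * H y \<partial>P)"
        by (subst abs_of_nonneg) (auto intro: Bochner_Integration.integral_nonneg)
    qed
    then show "integrable Q (\<lambda>x. \<integral>y. norm (case (x, y) of (x, y) \<Rightarrow> S x * \<eta> x y) \<partial>P)" by simp
  qed
  \<comment> \<open>Fubini lets the sample be integrated first, where the summand is
    centred.\<close>
  have cross: "(\<integral>y. (\<integral>x. S x * \<eta> x y \<partial>Q) \<partial>P) = 0"
  proof -
    have "(\<integral>y. (\<integral>x. S x * \<eta> x y \<partial>Q) \<partial>P) = (\<integral>x. (\<integral>y. S x * \<eta> x y \<partial>P) \<partial>Q)"
      by (rule Fubini_integral [OF int_pair])
    also have "\<dots> = (\<integral>x. 0 \<partial>Q)"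
      by (rule Bochner_Integration.integral_cong [OF refl]) (simp add: centred)
    finally show ?thesis by simp
  qed
  have cross_int: "integrable P (\<lambda>y. \<integral>x. S x * \<eta> x y \<partial>Q)"
    by (rule integrable_snd [OF int_pair])
  \<comment> \<open>A majorant of the enlarged functional as a function of the next sample, apart
    from the moment terms of earlier samples. Only the cross term is kept exactly, because it has to
    cancel in the mean.\<close>
  let ?X = "\<lambda>y. A * (\<integral>x. (S x)\<^sup>2 \<partial>Q) + 2 * A * (\<integral>x. S x * \<eta> x y \<partial>Q) + (A * H y ^ 2 + B * H y ^ (2 * k))"
  have Xint: "integrable P ?X"
    by (intro Bochner_Integration.integrable_add integrable_mult_right Hint cross_int PP.integrable_const)
  obtain y where y: "y \<in> space P" "?X y \<le> (\<integral>y. ?X y \<partial>P)" by (rule PP.exists_le_expectation [OF Xint])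
  have "(\<integral>y. ?X y \<partial>P) = A * (\<integral>x. (S x)\<^sup>2 \<partial>Q) + (A * ?V + B * ?K)"
  proof -
    have "(\<integral>y. ?X y \<partial>P) = (\<integral>y. A * (\<integral>x. (S x)\<^sup>2 \<partial>Q) + 2 * A * (\<integral>x. S x * \<eta> x y \<partial>Q) \<partial>P) + (\<integral>y. A * H y ^ 2 + B * H y ^ (2 * k) \<partial>P)"
      by (intro Bochner_Integration.integral_add Bochner_Integration.integrable_add integrable_mult_right Hint cross_int PP.integrable_const)
    also have "(\<integral>y. A * H y ^ 2 + B * H y ^ (2 * k) \<partial>P) = A * ?V + B * ?K"
      by (subst Bochner_Integration.integral_add) (intro integrable_mult_right Hint | simp)+
    also have "(\<integral>y. A * (\<integral>x. (S x)\<^sup>2 \<partial>Q) + 2 * A * (\<integral>x. S x * \<eta> x y \<partial>Q) \<partial>P) = A * (\<integral>x. (S x)\<^sup>2 \<partial>Q)"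
      by (subst Bochner_Integration.integral_add) (intro integrable_mult_right cross_int PP.integrable_const | simp add: cross PP.prob_space)+
    finally show ?thesis .
  qed
  with y(2) have Xy: "?X y \<le> A * (\<integral>x. (S x)\<^sup>2 \<partial>Q) + (A * ?V + B * ?K)" by linarith
  have e1: "integrable Q (\<lambda>x. S x * \<eta> x y)"
  proof (rule bdd)
    show "\<bar>S x * \<eta> x y\<bar> \<le> s * H y" if "x \<in> space Q" for x
      unfolding abs_mult by (rule mult_mono [OF Sb [OF that] H [OF that y(1)] s0]) simp
  qed (intro borel_measurable_times Sm m1 y)
  have pw: "\<bar>\<eta> x y ^ m\<bar> \<le> H y ^ m" if "x \<in> space Q" for x m
    unfolding power_abs by (intro power_mono H that y) simp
  have e2: "integrable Q (\<lambda>x. \<eta> x y ^ m)" for m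
    by (rule bdd [OF borel_measurable_power [OF m1 [OF y(1)]] pw])
  have le: "(\<integral>x. \<eta> x y ^ m \<partial>Q) \<le> H y ^ m" for m
  proof -
    have "(\<integral>x. \<eta> x y ^ m \<partial>Q) \<le> (\<integral>x. H y ^ m \<partial>Q)"
      by (rule integral_mono [OF e2 QQ.integrable_const]) (rule order_trans [OF abs_ge_self pw])
    then show ?thesis by (simp add: QQ.prob_space)
  qed
  have sq: "(\<integral>x. (S x + \<eta> x y)\<^sup>2 \<partial>Q) = (\<integral>x. (S x)\<^sup>2 \<partial>Q) + 2 * (\<integral>x. S x * \<eta> x y \<partial>Q) + (\<integral>x. \<eta> x y ^ 2 \<partial>Q)"
  proof -
    have "(\<integral>x. (S x + \<eta> x y)\<^sup>2 \<partial>Q) = (\<integral>x. ((S x)\<^sup>2 + 2 * (S x * \<eta> x y)) + \<eta> x y ^ 2 \<partial>Q)"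
      by (intro Bochner_Integration.integral_cong refl) (simp add: power2_sum)
    also have "\<dots> = (\<integral>x. (S x)\<^sup>2 + 2 * (S x * \<eta> x y) \<partial>Q) + (\<integral>x. \<eta> x y ^ 2 \<partial>Q)"
      by (intro Bochner_Integration.integral_add Bochner_Integration.integrable_add integrable_mult_right Sint e1 e2)
    also have "(\<integral>x. (S x)\<^sup>2 + 2 * (S x * \<eta> x y) \<partial>Q) = (\<integral>x. (S x)\<^sup>2 \<partial>Q) + 2 * (\<integral>x. S x * \<eta> x y \<partial>Q)"
      by (subst Bochner_Integration.integral_add) (intro integrable_mult_right Sint e1 | simp)+
    finally show ?thesis .
  qed
  define zs where "zs j = (if j = M then y else ys j)" for j
  have z1: "(\<Sum>j<M. \<eta> x (zs j)) = S x" for x unfolding S_def by (rule sum.cong) (auto simp: zs_def)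
  have z2: "(\<Sum>j<M. \<integral>x. \<eta> x (zs j) ^ (2 * k) \<partial>Q) = (\<Sum>j<M. \<integral>x. \<eta> x (ys j) ^ (2 * k) \<partial>Q)" by (rule sum.cong) (auto simp: zs_def)
  have zM: "zs M = y" by (simp add: zs_def)
  have "A * (\<integral>x. (\<Sum>j<Suc M. \<eta> x (zs j))\<^sup>2 \<partial>Q) + B * (\<Sum>j<Suc M. \<integral>x. \<eta> x (zs j) ^ (2 * k) \<partial>Q) =
    A * ((\<integral>x. (S x)\<^sup>2 \<partial>Q) + 2 * (\<integral>x. S x * \<eta> x y \<partial>Q) + (\<integral>x. \<eta> x y ^ 2 \<partial>Q)) +
    B * ((\<Sum>j<M. \<integral>x. \<eta> x (ys j) ^ (2 * k) \<partial>Q) + (\<integral>x. \<eta> x y ^ (2 * k) \<partial>Q))"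
    by (simp only: sum.lessThan_Suc z1 z2 zM sq)
  also have "\<dots> \<le> A * ((\<integral>x. (S x)\<^sup>2 \<partial>Q) + 2 * (\<integral>x. S x * \<eta> x y \<partial>Q) + H y ^ 2) +
    B * ((\<Sum>j<M. \<integral>x. \<eta> x (ys j) ^ (2 * k) \<partial>Q) + H y ^ (2 * k))"
    using le AB by (intro add_mono mult_left_mono) auto
  also have "\<dots> = ?X y + B * (\<Sum>j<M. \<integral>x. \<eta> x (ys j) ^ (2 * k) \<partial>Q)" by (simp only: distrib_left mult_ac add_ac)
  also have "\<dots> \<le> A * (\<integral>x. (S x)\<^sup>2 \<partial>Q) + (A * ?V + B * ?K) + B * (\<Sum>j<M. \<integral>x. \<eta> x (ys j) ^ (2 * k) \<partial>Q)"
    using Xy by (rule add_right_mono)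
  also have "\<dots> \<le> real M * (A * ?V + B * ?K) + (A * ?V + B * ?K)" using IH unfolding S_def by linarith
  also have "\<dots> = real (Suc M) * (A * ?V + B * ?K)" by (simp add: algebra_simps)
  finally have "A * (\<integral>x. (\<Sum>j<Suc M. \<eta> x (zs j))\<^sup>2 \<partial>Q) + B * (\<Sum>j<Suc M. \<integral>x. \<eta> x (zs j) ^ (2 * k) \<partial>Q) \<le> real (Suc M) * (A * ?V + B * ?K)" .
  moreover have "\<forall>j. zs j \<in> space P" using ys y(1) by (simp add: zs_def)
  ultimately show ?case by blast
qed

text \<open>Three ranges: up to \<theta> the first term suffices; above it, while t^k is at most
  \<Lambda>, the factor (t/\<theta>)^2 exceeds 1; beyond that, t^k is at most
  t^(2k)/\<Lambda>.\<close>

lemma powr_le_truncated: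
  assumes p: "0 < p" "p \<le> real k" and k: "k \<ge> 1" and \<theta>: "0 < \<theta>" and \<Lambda>: "\<Lambda> \<ge> 1" and t: "t \<ge> 0"
  shows "t powr p \<le> \<theta> powr p + \<Lambda> / \<theta>\<^sup>2 * t\<^sup>2 + t ^ (2 * k) / \<Lambda>"
proof -
  have nn: "\<theta> powr p \<ge> 0" "\<Lambda> / \<theta>\<^sup>2 * t\<^sup>2 \<ge> 0" "t ^ (2 * k) / \<Lambda> \<ge> 0" using \<Lambda> t by simp_all
  consider "t \<le> \<theta>" | "\<theta> < t" "t ^ k \<le> \<Lambda>" | "\<Lambda> < t ^ k" by linarith
  then show ?thesis
  proof cases
    case 1
    then have "t powr p \<le> \<theta> powr p" using p t by (intro powr_mono2) auto
    then show ?thesis using nn by linarith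
  next
    case 2
    have "t powr p \<le> \<Lambda>"
    proof (cases "t \<le> 1")
      case True
      then have "t powr p \<le> 1" using p t powr_mono2 [of p t 1] by simp
      then show ?thesis using \<Lambda> by linarith
    next
      case False
      then have "t powr p \<le> t powr real k" using p by (intro powr_mono) auto
      also have "\<dots> = t ^ k" using False by (intro powr_realpow) auto
      finally show ?thesis using 2 by linarith
    qed
    also have "\<Lambda> * 1 \<le> \<Lambda> * (t\<^sup>2 / \<theta>\<^sup>2)"
      using 2 \<theta> \<Lambda> power_mono [of \<theta> t 2] by (intro mult_left_mono) auto
    then have "\<Lambda> \<le> \<Lambda> / \<theta>\<^sup>2 * t\<^sup>2" by simp
    finally show ?thesis using nn by linarith
  next
    case 3
    have t1: "t > 1"
    proof (rule ccontr)
      assume "\<not> 1 < t"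
      then have "t ^ k \<le> 1" using t by (intro power_le_one) auto
      then show False using 3 \<Lambda> by linarith
    qed
    then have "t powr p \<le> t powr real k" using p by (intro powr_mono) auto
    also have "\<dots> = t ^ k" using t1 by (intro powr_realpow) auto
    also have "\<dots> \<le> t ^ (2 * k) / \<Lambda>"
    proof -
      have "t ^ k * \<Lambda> \<le> t ^ k * t ^ k" using 3 t by (intro mult_left_mono) auto
      then show ?thesis using \<Lambda> by (simp add: pos_le_divide_eq mult_2 power_add)
    qed
    finally show ?thesis using nn by linarith
  qed
qed

text \<open>Jensen's inequality for the uniform mean.\<close>

lemma power_mean_even:
  fixes f :: "nat \<Rightarrow> real"
  assumes "M \<ge> 1"
  shows "((\<Sum>j<M. f j) / M) ^ (2 * k) \<le> (\<Sum>j<M. f j ^ (2 * k)) / real M"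
proof -
  have "(\<Sum>j<M. (1 / real M) *\<^sub>R f j) ^ (2 * k) \<le> (\<Sum>j<M. (1 / real M) * f j ^ (2 * k))"
    by (rule convex_on_sum [of "{..<M}" UNIV "\<lambda>x. x ^ (2 * k)"]) (use assms in \<open>auto intro: convex_power_even simp: lessThan_empty_iff\<close>)
  then show ?thesis by (simp add: sum_divide_distrib)
qed

lemma monte_carlo_Lp:
  fixes \<eta> :: "'x \<Rightarrow> 'y \<Rightarrow> real" and M :: nat
  assumes P: "prob_space P" and Q: "prob_space Q"
    and meas: "(\<lambda>(x, y). \<eta> x y) \<in> borel_measurable (Q \<Otimes>\<^sub>M P)"
    and H: "\<And>x y. x \<in> space Q \<Longrightarrow> y \<in> space P \<Longrightarrow> \<bar>\<eta> x y\<bar> \<le> H y"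
    and Hint: "integrable P H" "integrable P (\<lambda>y. H y ^ 2)" "integrable P (\<lambda>y. H y ^ (2 * k))"
    and centred: "\<And>x. x \<in> space Q \<Longrightarrow> (\<integral>y. \<eta> x y \<partial>P) = 0"
    and p: "0 < p" "p \<le> real k" and k: "k \<ge> 1" and \<theta>: "0 < \<theta>" and \<Lambda>: "\<Lambda> \<ge> 1" and M: "M \<ge> 1"
  obtains ys where "\<And>j. ys j \<in> space P" "integrable Q (\<lambda>x. \<bar>(\<Sum>j<M. \<eta> x (ys j)) / real M\<bar> powr p)"
    "(\<integral>x. \<bar>(\<Sum>j<M. \<eta> x (ys j)) / real M\<bar> powr p \<partial>Q) \<le> \<theta> powr p + \<Lambda> / \<theta>\<^sup>2 * (\<integral>y. H y ^ 2 \<partial>P) / real M + (\<integral>y. H y ^ (2 * k) \<partial>P) / \<Lambda>"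
proof -
  interpret Q: prob_space Q by (rule Q)
  \<comment> \<open>Weights matching the truncated inequality for the mean
    \<open>S x / real M\<close>: two powers of \<open>M\<close> from squaring the mean, one from
    Jensen's inequality in the high moment.\<close>
  let ?A = "\<Lambda> / \<theta>\<^sup>2 / (real M)\<^sup>2" and ?B = "1 / (\<Lambda> * real M)"
  have AB: "?A \<ge> 0" "?B \<ge> 0" using \<Lambda> by simp_all
  obtain ys where ys: "\<And>j. ys j \<in> space P"
    and g: "?A * (\<integral>x. (\<Sum>j<M. \<eta> x (ys j))\<^sup>2 \<partial>Q) + ?B * (\<Sum>j<M. \<integral>x. \<eta> x (ys j) ^ (2 * k) \<partial>Q)
      \<le> real M * (?A * (\<integral>y. H y ^ 2 \<partial>P) + ?B * (\<integral>y. H y ^ (2 * k) \<partial>P))"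
    using greedy_sampling [OF P Q meas H Hint centred AB, of M] by blast
  have m1: "(\<lambda>x. \<eta> x y) \<in> borel_measurable Q" if "y \<in> space P" for y
    using measurable_compose [OF measurable_Pair2' [OF that] meas] by simp
  have bdd: "integrable Q g" if "g \<in> borel_measurable Q" "\<And>x. x \<in> space Q \<Longrightarrow> \<bar>g x\<bar> \<le> b" for g :: "'x \<Rightarrow> real" and b
    by (rule Q.integrable_const_bound [of _ b]) (use that in auto)
  define S where "S x = (\<Sum>j<M. \<eta> x (ys j))" for x
  define s where "s = (\<Sum>j<M. H (ys j))"
  have Sm: "S \<in> borel_measurable Q" unfolding S_def by (intro borel_measurable_sum m1 ys)
  have Sb: "\<bar>S x\<bar> \<le> s" if "x \<in> space Q" for x
    unfolding S_def s_def by (rule order_trans [OF sum_abs sum_mono]) (rule H [OF that ys])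
  have i1: "integrable Q (\<lambda>x. (S x)\<^sup>2)"
  proof (rule bdd)
    show "\<bar>(S x)\<^sup>2\<bar> \<le> s\<^sup>2" if "x \<in> space Q" for x
      using power_mono [OF Sb [OF that], of 2] by simp
  qed (use Sm in simp)
  have i2: "integrable Q (\<lambda>x. \<eta> x (ys j) ^ (2 * k))" for j
  proof (rule bdd)
    show "\<bar>\<eta> x (ys j) ^ (2 * k)\<bar> \<le> H (ys j) ^ (2 * k)" if "x \<in> space Q" for x
      unfolding power_abs by (intro power_mono H that ys) simp
  qed (intro borel_measurable_power m1 ys)
  have i3: "integrable Q (\<lambda>x. \<theta> powr p + ?A * (S x)\<^sup>2 + ?B * (\<Sum>j<M. \<eta> x (ys j) ^ (2 * k)))"
    by (intro Bochner_Integration.integrable_add Q.integrable_const integrable_mult_right i1 Bochner_Integration.integrable_sum i2)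
  have pt: "\<bar>S x / real M\<bar> powr p \<le> \<theta> powr p + ?A * (S x)\<^sup>2 + ?B * (\<Sum>j<M. \<eta> x (ys j) ^ (2 * k))" for x
  proof -
    have "\<bar>S x / real M\<bar> powr p \<le> \<theta> powr p + \<Lambda> / \<theta>\<^sup>2 * \<bar>S x / real M\<bar>\<^sup>2 + \<bar>S x / real M\<bar> ^ (2 * k) / \<Lambda>"
      by (rule powr_le_truncated [OF p k \<theta> \<Lambda>]) simp
    moreover have "\<Lambda> / \<theta>\<^sup>2 * \<bar>S x / real M\<bar>\<^sup>2 = ?A * (S x)\<^sup>2" by (simp add: power_divide)
    moreover have "\<bar>S x / real M\<bar> ^ (2 * k) / \<Lambda> \<le> ?B * (\<Sum>j<M. \<eta> x (ys j) ^ (2 * k))"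
    proof -
      have "\<bar>S x / real M\<bar> ^ (2 * k) = (S x / real M) ^ (2 * k)" by (rule power_even_abs) simp
      also have "\<dots> \<le> (\<Sum>j<M. \<eta> x (ys j) ^ (2 * k)) / real M" unfolding S_def by (rule power_mean_even [OF M])
      finally have "\<bar>S x / real M\<bar> ^ (2 * k) / \<Lambda> \<le> (\<Sum>j<M. \<eta> x (ys j) ^ (2 * k)) / real M / \<Lambda>"
        using \<Lambda> by (intro divide_right_mono) auto
      then show ?thesis by (simp add: mult.commute)
    qed
    ultimately show ?thesis by linarith
  qed
  have i4: "integrable Q (\<lambda>x. \<bar>S x / real M\<bar> powr p)"
    by (rule Bochner_Integration.integrable_bound [OF i3])
      (use Sm pt in \<open>auto intro!: AE_I2 order_trans [OF _ abs_ge_self]\<close>)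
  have "(\<integral>x. \<bar>S x / real M\<bar> powr p \<partial>Q) \<le> (\<integral>x. \<theta> powr p + ?A * (S x)\<^sup>2 + ?B * (\<Sum>j<M. \<eta> x (ys j) ^ (2 * k)) \<partial>Q)"
    by (rule integral_mono [OF i4 i3 pt])
  also have "\<dots> = (\<integral>x. \<theta> powr p + ?A * (S x)\<^sup>2 \<partial>Q) + (\<integral>x. ?B * (\<Sum>j<M. \<eta> x (ys j) ^ (2 * k)) \<partial>Q)"
    by (intro Bochner_Integration.integral_add Bochner_Integration.integrable_add Q.integrable_const integrable_mult_right i1 Bochner_Integration.integrable_sum i2)
  also have "(\<integral>x. \<theta> powr p + ?A * (S x)\<^sup>2 \<partial>Q) = \<theta> powr p + ?A * (\<integral>x. (S x)\<^sup>2 \<partial>Q)"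
    by (subst Bochner_Integration.integral_add) (intro integrable_mult_right i1 Q.integrable_const | simp add: Q.prob_space)+
  also have "(\<integral>x. ?B * (\<Sum>j<M. \<eta> x (ys j) ^ (2 * k)) \<partial>Q) = ?B * (\<Sum>j<M. \<integral>x. \<eta> x (ys j) ^ (2 * k) \<partial>Q)"
    by (simp only: integral_mult_right_zero Bochner_Integration.integral_sum [OF i2])
  also have "\<theta> powr p + ?A * (\<integral>x. (S x)\<^sup>2 \<partial>Q) + \<dots> \<le> \<theta> powr p + real M * (?A * (\<integral>y. H y ^ 2 \<partial>P) + ?B * (\<integral>y. H y ^ (2 * k) \<partial>P))"
    using g unfolding S_def by linarith
  also have "\<dots> = \<theta> powr p + \<Lambda> / \<theta>\<^sup>2 * (\<integral>y. H y ^ 2 \<partial>P) / real M + (\<integral>y. H y ^ (2 * k) \<partial>P) / \<Lambda>"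
  proof -
    have id: "m * (b / m\<^sup>2 * v + 1 / (l * m) * w) = b * v / m + w / l" if "m > 0" "l > 0" for m b v l w :: real
      using that by (simp add: field_simps power2_eq_square)
    have "real M * (?A * (\<integral>y. H y ^ 2 \<partial>P) + ?B * (\<integral>y. H y ^ (2 * k) \<partial>P)) = \<Lambda> / \<theta>\<^sup>2 * (\<integral>y. H y ^ 2 \<partial>P) / real M + (\<integral>y. H y ^ (2 * k) \<partial>P) / \<Lambda>"
      by (rule id) (use M \<Lambda> in simp_all)
    then show ?thesis by (simp only: add.assoc)
  qed
  finally show thesis by (rule that [OF ys i4 [unfolded S_def], unfolded S_def [symmetric]])
qed

section \<open>Moments and parameter bounds\<close>

text \<open>Dominates \<open>1 + norm_Rn d\<close> of the flow for all starting points in the unit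
  cube at once.\<close>

definition geo_norm :: "real \<Rightarrow> real \<Rightarrow> real \<Rightarrow> nat \<Rightarrow> (nat \<Rightarrow> real) \<Rightarrow> real" where
  "geo_norm \<alpha> \<beta> T d y = 1 + norm_Rn d (\<lambda>i. geo \<alpha> \<beta> T (y i))"

lemma geo_norm_ge_1: "geo_norm \<alpha> \<beta> T d y \<ge> 1"
  by (simp add: geo_norm_def)

lemma gauss_Rn_component_measurable: "i < d \<Longrightarrow> (\<lambda>y. y i) \<in> measurable (gauss_Rn d) gauss"
  unfolding gauss_Rn_def by (intro measurable_component_singleton) simp

lemma gauss_Rn_component:
  fixes f :: "real \<Rightarrow> real"
  assumes i: "i < d" and f: "integrable gauss f"
  shows "integrable (gauss_Rn d) (\<lambda>y. f (y i))" "(\<integral>y. f (y i) \<partial>gauss_Rn d) = (\<integral>z. f z \<partial>gauss)"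
proof -
  have D: "distr (gauss_Rn d) gauss (\<lambda>y. y i) = gauss"
    unfolding gauss_Rn_def by (rule distr_PiM_component) (use i prob_space_gauss in auto)
  note m = gauss_Rn_component_measurable [OF i]
  show "integrable (gauss_Rn d) (\<lambda>y. f (y i))"
    by (rule integrable_distr [OF m]) (simp add: D f)
  have "(\<integral>z. f z \<partial>distr (gauss_Rn d) gauss (\<lambda>y. y i)) = (\<integral>y. f (y i) \<partial>gauss_Rn d)"
    by (rule integral_distr [OF m]) (use f in auto)
  then show "(\<integral>y. f (y i) \<partial>gauss_Rn d) = (\<integral>z. f z \<partial>gauss)" by (simp only: D)
qed

lemma geo_component_measurable: "i < d \<Longrightarrow> (\<lambda>y. geo \<alpha> \<beta> \<tau> (y i)) \<in> borel_measurable (gauss_Rn d)"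
  by (rule measurable_compose [OF gauss_Rn_component_measurable]) (simp_all add: measurable_cong_sets [OF sets_gauss refl])

lemma geo_norm_measurable: "geo_norm \<alpha> \<beta> T d \<in> borel_measurable (gauss_Rn d)"
proof -
  have "(\<lambda>y. \<Sum>i<d. (geo \<alpha> \<beta> T (y i))\<^sup>2) \<in> borel_measurable (gauss_Rn d)"
    by (intro borel_measurable_sum borel_measurable_power geo_component_measurable) simp
  from measurable_compose [OF this borel_measurable_sqrt] show ?thesis
    unfolding geo_norm_def [abs_def] norm_Rn_def L2_set_def by (intro borel_measurable_add borel_measurable_const)
qed

text \<open>The sum is at most \<open>d\<close> times its largest term; the loss is polynomial in
  \<open>d\<close>.\<close>

lemma sum_power_le:
  fixes f :: "nat \<Rightarrow> real"
  assumes "d \<ge> 1" and f: "\<And>i. i < d \<Longrightarrow> f i \<ge> 0"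
  shows "(\<Sum>i<d. f i) ^ j \<le> real d ^ j * (\<Sum>i<d. f i ^ j)"
proof -
  have "Max (f ` {..<d}) \<in> f ` {..<d}" using assms(1) by (intro Max_in) (auto simp: lessThan_empty_iff)
  then obtain m where m: "m < d" "f m = Max (f ` {..<d})" by auto
  have "(\<Sum>i<d. f i) \<le> (\<Sum>i<d. f m)" unfolding m(2) by (intro sum_mono Max_ge) auto
  then have "(\<Sum>i<d. f i) ^ j \<le> (real d * f m) ^ j" using f by (intro power_mono sum_nonneg) auto
  also have "\<dots> = real d ^ j * f m ^ j" by (rule power_mult_distrib)
  also have "\<dots> \<le> real d ^ j * (\<Sum>i<d. f i ^ j)"
    using m(1) f by (intro mult_left_mono member_le_sum) auto
  finally show ?thesis .
qed

text \<open>A one-dimensional quantity, hence free of \<open>d\<close>: all dependence on the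
  dimension stays in explicit powers.\<close>

definition geo_moment_const :: "real \<Rightarrow> real \<Rightarrow> real \<Rightarrow> nat \<Rightarrow> real" where
  "geo_moment_const \<alpha> \<beta> T j = (\<integral>z. (1 + geo \<alpha> \<beta> T z) ^ j \<partial>gauss)"

lemma geo_moment_const:
  "integrable gauss (\<lambda>z. (1 + geo \<alpha> \<beta> T z) ^ j)" "geo_moment_const \<alpha> \<beta> T j \<ge> 1"
proof -
  have "tame (\<lambda>y. (1 + y) ^ j)" by (intro tame_power tame_add tame_const tame_ident)
  from exp_bounded_integrable [OF exp_bounded_geo [OF this, where x = 1 and m = 0]]
  show i: "integrable gauss (\<lambda>z. (1 + geo \<alpha> \<beta> T z) ^ j)" by simp
  have "(\<integral>z. 1 \<partial>gauss) \<le> geo_moment_const \<alpha> \<beta> T j"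
    unfolding geo_moment_const_def
    by (rule integral_mono [OF exp_bounded_integrable [OF exp_bounded_const] i]) (simp add: one_le_power)
  then show "geo_moment_const \<alpha> \<beta> T j \<ge> 1" by simp
qed

text \<open>This is where the dimension stays polynomial: \<open>d\<close> to the power
  \<open>j\<close> from the power of a sum, one more factor from the number of summands. Moments of
  the product weight would grow exponentially.\<close>

lemma geo_norm_moment:
  assumes d: "d \<ge> 1"
  shows "integrable (gauss_Rn d) (\<lambda>y. geo_norm \<alpha> \<beta> T d y ^ j)"
    and "(\<integral>y. geo_norm \<alpha> \<beta> T d y ^ j \<partial>gauss_Rn d) \<le> geo_moment_const \<alpha> \<beta> T j * real d ^ (j + 1)"
proof -
  let ?b = "\<lambda>y. real d ^ j * (\<Sum>i<d. (1 + geo \<alpha> \<beta> T (y i)) ^ j)"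
  have le: "geo_norm \<alpha> \<beta> T d y ^ j \<le> ?b y" for y
  proof -
    have "norm_Rn d (\<lambda>i. geo \<alpha> \<beta> T (y i)) \<le> (\<Sum>i<d. \<bar>geo \<alpha> \<beta> T (y i)\<bar>)"
      unfolding norm_Rn_def by (rule L2_set_le_sum_abs)
    then have "geo_norm \<alpha> \<beta> T d y \<le> (\<Sum>i<d. 1 + geo \<alpha> \<beta> T (y i))"
      using d by (simp add: geo_norm_def sum.distrib)
    then have "geo_norm \<alpha> \<beta> T d y ^ j \<le> (\<Sum>i<d. 1 + geo \<alpha> \<beta> T (y i)) ^ j"
      using geo_norm_ge_1 [of \<alpha> \<beta> T d y] by (intro power_mono) simp_all
    also have "\<dots> \<le> ?b y" by (rule sum_power_le [OF d]) (simp add: add_nonneg_nonneg)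
    finally show ?thesis .
  qed
  have ic: "integrable (gauss_Rn d) (\<lambda>y. (1 + geo \<alpha> \<beta> T (y i)) ^ j)" if "i < d" for i
    by (rule gauss_Rn_component(1) [OF that geo_moment_const(1)])
  have ib: "integrable (gauss_Rn d) ?b"
    by (intro integrable_mult_right Bochner_Integration.integrable_sum ic) simp
  show ig: "integrable (gauss_Rn d) (\<lambda>y. geo_norm \<alpha> \<beta> T d y ^ j)"
  proof (rule Bochner_Integration.integrable_bound [OF ib])
    show "AE y in gauss_Rn d. norm (geo_norm \<alpha> \<beta> T d y ^ j) \<le> norm (?b y)"
    proof (intro AE_I2)
      fix y
      have "0 \<le> geo_norm \<alpha> \<beta> T d y ^ j" using geo_norm_ge_1 [of \<alpha> \<beta> T d y] by (intro zero_le_power) simp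
      then show "norm (geo_norm \<alpha> \<beta> T d y ^ j) \<le> norm (?b y)" using le [of y] unfolding real_norm_def by linarith
    qed
  qed (intro borel_measurable_power geo_norm_measurable)
  have "(\<integral>y. geo_norm \<alpha> \<beta> T d y ^ j \<partial>gauss_Rn d) \<le> (\<integral>y. ?b y \<partial>gauss_Rn d)"
    by (rule integral_mono [OF ig ib le])
  also have "\<dots> = real d ^ j * (\<Sum>i<d. \<integral>y. (1 + geo \<alpha> \<beta> T (y i)) ^ j \<partial>gauss_Rn d)"
    by (subst integral_mult_right_zero, subst Bochner_Integration.integral_sum) (use ic in simp_all)
  also have "(\<Sum>i<d. \<integral>y. (1 + geo \<alpha> \<beta> T (y i)) ^ j \<partial>gauss_Rn d) = (\<Sum>i<d. geo_moment_const \<alpha> \<beta> T j)"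
    by (rule sum.cong [OF refl]) (simp add: gauss_Rn_component(2) [OF _ geo_moment_const(1)] geo_moment_const_def)
  finally show "(\<integral>y. geo_norm \<alpha> \<beta> T d y ^ j \<partial>gauss_Rn d) \<le> geo_moment_const \<alpha> \<beta> T j * real d ^ (j + 1)"
    by (simp add: mult_ac)
qed

definition unit_cube_measure :: "nat \<Rightarrow> (nat \<Rightarrow> real) measure" where
  "unit_cube_measure d = restrict_space (lebesgue_Rn d) (unit_cube d)"

lemma unit_cube_sets: "unit_cube d \<in> sets (lebesgue_Rn d)"
  unfolding unit_cube_def lebesgue_Rn_def by (intro sets_PiM_I_finite) auto

lemma space_unit_cube_measure: "space (unit_cube_measure d) = unit_cube d"
  using sets.sets_into_space [OF unit_cube_sets, of d] by (auto simp: unit_cube_measure_def space_restrict_space)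

lemma prob_space_unit_cube: "prob_space (unit_cube_measure d)"
proof
  interpret product_sigma_finite "\<lambda>_::nat. lborel :: real measure" by standard
  have "emeasure (lebesgue_Rn d) (unit_cube d) = (\<Prod>i<d. emeasure lborel {0..1::real})"
    unfolding lebesgue_Rn_def unit_cube_def by (rule emeasure_PiM) auto
  also have "\<dots> = 1" by simp
  finally show "emeasure (unit_cube_measure d) (space (unit_cube_measure d)) = 1"
    unfolding space_unit_cube_measure unit_cube_measure_def
    by (subst emeasure_restrict_space) (use unit_cube_sets sets.sets_into_space [OF unit_cube_sets] in \<open>auto simp: Int_absorb2\<close>)
qed

lemma set_integral_unit_cube: "(LINT x:unit_cube d|lebesgue_Rn d. f x) = (\<integral>x. f x \<partial>unit_cube_measure d)"
  for f :: "(nat \<Rightarrow> real) \<Rightarrow> real"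
  unfolding set_lebesgue_integral_def unit_cube_measure_def
  by (subst integral_restrict_space) (use unit_cube_sets sets.sets_into_space [OF unit_cube_sets] in \<open>auto simp: Int_absorb2\<close>)

lemma unit_cube_in_Rn: "x \<in> unit_cube d \<Longrightarrow> x \<in> Rn d"
  unfolding unit_cube_def using Rn_subset by blast

lemma norm_geo_flow_le: "x \<in> unit_cube d \<Longrightarrow> 1 + norm_Rn d (geo_flow \<alpha> \<beta> d T x y) \<le> geo_norm \<alpha> \<beta> T d y"
proof -
  assume x: "x \<in> unit_cube d"
  have "norm_Rn d (geo_flow \<alpha> \<beta> d T x y) = L2_set (\<lambda>i. x i * geo \<alpha> \<beta> T (y i)) {..<d}"
    unfolding norm_Rn_def by (rule L2_set_cong) (auto simp: geo_flow_def)
  also have "\<dots> \<le> norm_Rn d (\<lambda>i. geo \<alpha> \<beta> T (y i))"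
    unfolding norm_Rn_def
  proof (rule L2_set_mono)
    fix i assume "i \<in> {..<d}"
    then have "x i \<in> {0..1}" using x unfolding unit_cube_def by (rule PiE_mem [rotated])
    then show "x i * geo \<alpha> \<beta> T (y i) \<le> geo \<alpha> \<beta> T (y i)" "0 \<le> x i * geo \<alpha> \<beta> T (y i)"
      by (simp_all add: mult_left_le_one_le)
  qed
  finally show ?thesis by (simp add: geo_norm_def)
qed

lemma geo_flow_pair_measurable:
  assumes R: "continuous_on (Rn d) R"
  shows "(\<lambda>(x, y). R (geo_flow \<alpha> \<beta> d T x y) :: real) \<in> borel_measurable (unit_cube_measure d \<Otimes>\<^sub>M gauss_Rn d)"
proof -
  have "(\<lambda>z. R (geo_flow \<alpha> \<beta> d T (fst z) (snd z))) \<in> borel_measurable (unit_cube_measure d \<Otimes>\<^sub>M gauss_Rn d)"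
  proof (rule continuous_on_Rn_measurable [where f = "\<lambda>z. geo_flow \<alpha> \<beta> d T (fst z) (snd z)", OF R])
    show "geo_flow \<alpha> \<beta> d T (fst z) (snd z) \<in> Rn d" for z by (rule geo_flow_in_Rn)
    fix i assume i: "i < d"
    have "(\<lambda>x. x i) \<in> borel_measurable (lebesgue_Rn d)"
      using i measurable_component_singleton [of i "{..<d}" "\<lambda>_. lborel :: real measure"]
      unfolding lebesgue_Rn_def by simp
    then have "(\<lambda>x. x i) \<in> borel_measurable (unit_cube_measure d)"
      unfolding unit_cube_measure_def by (rule measurable_restrict_space1)
    then have "(\<lambda>z. fst z i) \<in> borel_measurable (unit_cube_measure d \<Otimes>\<^sub>M gauss_Rn d)"
      by (rule measurable_compose [OF measurable_fst])
    moreover have "(\<lambda>z. geo \<alpha> \<beta> T (snd z i)) \<in> borel_measurable (unit_cube_measure d \<Otimes>\<^sub>M gauss_Rn d)"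
      by (rule measurable_compose [OF measurable_snd geo_component_measurable [OF i]])
    ultimately show "(\<lambda>z. geo_flow \<alpha> \<beta> d T (fst z) (snd z) i) \<in> borel_measurable (unit_cube_measure d \<Otimes>\<^sub>M gauss_Rn d)"
      using i by (simp add: geo_flow_def borel_measurable_times)
  qed
  then show ?thesis by (simp add: case_prod_beta')
qed

text \<open>The centred integrand is at most this number times a power of \<open>geo_norm\<close>:
  one summand for the function, one for its mean, and the final \<open>+ 1\<close> to stay above
  1.\<close>

definition mc_scale :: "real \<Rightarrow> real \<Rightarrow> real \<Rightarrow> real \<Rightarrow> nat \<Rightarrow> nat \<Rightarrow> real" where
  "mc_scale \<alpha> \<beta> T b n d = 2 * b * (1 + geo_moment_const \<alpha> \<beta> T n * real d ^ (n + 1)) + 1"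

text \<open>Bounds the moment of order \<open>2 * k\<close> of the majorant \<open>H\<close> in
  \<open>monte_carlo_flow\<close>; as \<open>H\<close> is at least 1, it bounds the second moment as
  well.\<close>

definition mc_moment :: "real \<Rightarrow> real \<Rightarrow> real \<Rightarrow> real \<Rightarrow> nat \<Rightarrow> nat \<Rightarrow> nat \<Rightarrow> real" where
  "mc_moment \<alpha> \<beta> T b n k d = mc_scale \<alpha> \<beta> T b n d ^ (2 * k) * (geo_moment_const \<alpha> \<beta> T (n * (2 * k)) * real d ^ (n * (2 * k) + 1))"

lemma monte_carlo_flow:
  fixes \<alpha> \<beta> T :: real and M :: nat
  assumes d: "d \<ge> 1" and R: "continuous_on (Rn d) R" and b: "b \<ge> 0" and c: "c \<ge> 0"
    and Rb: "\<And>x. x \<in> Rn d \<Longrightarrow> \<bar>R x\<bar> \<le> b * (1 + norm_Rn d x powr c)"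
    and p: "0 < p" "p \<le> real k" and k: "k \<ge> 1" and \<theta>: "0 < \<theta>" and \<Lambda>: "\<Lambda> \<ge> 1" and M: "M \<ge> 1"
  defines "K \<equiv> mc_moment \<alpha> \<beta> T b (nat \<lceil>c\<rceil>) k d"
  obtains ys where
    "integrable (unit_cube_measure d) (\<lambda>x. \<bar>(\<Sum>j<M. R (geo_flow \<alpha> \<beta> d T x (ys j))) / real M - (\<integral>y. R (geo_flow \<alpha> \<beta> d T x y) \<partial>gauss_Rn d)\<bar> powr p)"
    "(\<integral>x. \<bar>(\<Sum>j<M. R (geo_flow \<alpha> \<beta> d T x (ys j))) / real M - (\<integral>y. R (geo_flow \<alpha> \<beta> d T x y) \<partial>gauss_Rn d)\<bar> powr p \<partial>unit_cube_measure d)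
      \<le> \<theta> powr p + \<Lambda> / \<theta>\<^sup>2 * K / real M + K / \<Lambda>"
proof -
  let ?Q = "unit_cube_measure d" and ?P = "gauss_Rn d" and ?n = "nat \<lceil>c\<rceil>"
  let ?G = "geo_norm \<alpha> \<beta> T d" and ?L = "mc_scale \<alpha> \<beta> T b (nat \<lceil>c\<rceil>) d"
  interpret P: prob_space ?P by (rule prob_space_gauss_Rn)
  have G: "?G y \<ge> 1" for y by (rule geo_norm_ge_1)
  have Gn: "?G y ^ j \<ge> 1" for y j by (rule one_le_power [OF G])
  have Rf: "\<bar>R (geo_flow \<alpha> \<beta> d T x y)\<bar> \<le> 2 * b * ?G y ^ ?n" if "x \<in> unit_cube d" for x y
  proof -
    let ?N = "norm_Rn d (geo_flow \<alpha> \<beta> d T x y)"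
    have "\<bar>R (geo_flow \<alpha> \<beta> d T x y)\<bar> \<le> b * (1 + ?N powr c)" by (rule Rb [OF geo_flow_in_Rn])
    also have "\<dots> \<le> b * (2 * (1 + ?N) ^ ?n)"
      by (intro mult_left_mono b one_plus_powr_le_power c) simp
    also have "\<dots> \<le> b * (2 * ?G y ^ ?n)"
      by (intro mult_left_mono b power_mono norm_geo_flow_le that) simp_all
    finally show ?thesis by (simp only: mult_ac)
  qed
  have Gint: "integrable ?P (\<lambda>y. ?G y ^ j)" for j by (rule geo_norm_moment(1) [OF d])
  have Rint: "integrable ?P (\<lambda>y. R (geo_flow \<alpha> \<beta> d T x y))" if "x \<in> unit_cube d" for x
  proof (rule Bochner_Integration.integrable_bound [OF integrable_mult_right [OF Gint [of ?n], of "2 * b"]])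
    show "AE y in ?P. norm (R (geo_flow \<alpha> \<beta> d T x y)) \<le> norm (2 * b * ?G y ^ ?n)"
    proof (intro AE_I2)
      fix y show "norm (R (geo_flow \<alpha> \<beta> d T x y)) \<le> norm (2 * b * ?G y ^ ?n)"
        using Rf [OF that, of y] unfolding real_norm_def by linarith
    qed
  qed (rule geo_flow_measurable [OF R])
  define m where "m x = (\<integral>y. R (geo_flow \<alpha> \<beta> d T x y) \<partial>?P)" for x
  have mb: "\<bar>m x\<bar> \<le> 2 * b * (geo_moment_const \<alpha> \<beta> T ?n * real d ^ (?n + 1))" if "x \<in> unit_cube d" for x
  proof -
    have "\<bar>m x\<bar> \<le> (\<integral>y. \<bar>R (geo_flow \<alpha> \<beta> d T x y)\<bar> \<partial>?P)" unfolding m_def by (rule integral_abs_bound)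
    also have "\<dots> \<le> (\<integral>y. 2 * b * ?G y ^ ?n \<partial>?P)"
      by (rule integral_mono [OF integrable_abs [OF Rint [OF that]] integrable_mult_right [OF Gint] Rf [OF that]])
    also have "\<dots> = 2 * b * (\<integral>y. ?G y ^ ?n \<partial>?P)" by (rule integral_mult_right_zero)
    also have "\<dots> \<le> 2 * b * (geo_moment_const \<alpha> \<beta> T ?n * real d ^ (?n + 1))"
      using b by (intro mult_left_mono geo_norm_moment(2) [OF d]) simp
    finally show ?thesis .
  qed
  define \<eta> where "\<eta> x y = R (geo_flow \<alpha> \<beta> d T x y) - m x" for x y
  define H where "H y = ?L * ?G y ^ ?n" for y
  have c0: "geo_moment_const \<alpha> \<beta> T ?n * real d ^ (?n + 1) \<ge> 0"
    using geo_moment_const(2) [of \<alpha> \<beta> T ?n] by (intro mult_nonneg_nonneg) simp_all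
  have L1: "?L \<ge> 1" unfolding mc_scale_def using b c0 by simp
  have \<eta>H: "\<bar>\<eta> x y\<bar> \<le> H y" if "x \<in> space ?Q" for x y
  proof -
    have x: "x \<in> unit_cube d" using that by (simp only: space_unit_cube_measure)
    let ?c = "2 * b * (geo_moment_const \<alpha> \<beta> T ?n * real d ^ (?n + 1))"
    have "\<bar>\<eta> x y\<bar> \<le> 2 * b * ?G y ^ ?n + ?c * 1" unfolding \<eta>_def using Rf [OF x, of y] mb [OF x] by linarith
    also have "\<dots> \<le> 2 * b * ?G y ^ ?n + ?c * ?G y ^ ?n" using b c0 by (intro add_left_mono mult_left_mono Gn) simp
    also have "\<dots> = (?L - 1) * ?G y ^ ?n" by (simp only: mc_scale_def distrib_left distrib_right mult_1_right add_diff_cancel_right')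
    also have "\<dots> \<le> H y" unfolding H_def using Gn [of y ?n] by (intro mult_right_mono) simp_all
    finally show ?thesis .
  qed
  have Hpow: "(\<lambda>y. H y ^ j) = (\<lambda>y. ?L ^ j * ?G y ^ (?n * j))" for j
    by (simp only: H_def power_mult_distrib power_mult)
  have Hint: "integrable ?P (\<lambda>y. H y ^ j)" for j unfolding Hpow by (intro integrable_mult_right Gint)
  have Kle: "(\<integral>y. H y ^ (2 * k) \<partial>?P) \<le> K"
    unfolding Hpow K_def mc_moment_def
    by (subst integral_mult_right_zero, intro mult_left_mono geo_norm_moment(2) [OF d]) (use L1 in simp)
  have H1: "H y \<ge> 1" for y
    unfolding H_def using mult_mono [OF L1 Gn [of y ?n]] L1 by simp
  have Vle: "(\<integral>y. H y ^ 2 \<partial>?P) \<le> K"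
  proof (rule order_trans [OF integral_mono [OF Hint Hint] Kle])
    show "H y ^ 2 \<le> H y ^ (2 * k)" for y using k by (intro power_increasing H1) simp
  qed
  have mmeas: "m \<in> borel_measurable ?Q"
    unfolding m_def [abs_def]
    by (rule P.borel_measurable_lebesgue_integral [OF geo_flow_pair_measurable [OF R]])
  have meas: "(\<lambda>(x, y). \<eta> x y) \<in> borel_measurable (?Q \<Otimes>\<^sub>M ?P)"
    using borel_measurable_diff [OF geo_flow_pair_measurable [OF R, of \<alpha> \<beta> T] measurable_compose [OF measurable_fst mmeas]]
    by (simp add: \<eta>_def case_prod_beta')
  have centred: "(\<integral>y. \<eta> x y \<partial>?P) = 0" if "x \<in> space ?Q" for x
  proof -
    have x: "x \<in> unit_cube d" using that by (simp only: space_unit_cube_measure)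
    show ?thesis unfolding \<eta>_def
      by (subst Bochner_Integration.integral_diff [OF Rint [OF x] P.integrable_const]) (simp add: m_def P.prob_space)
  qed
  have Hint1: "integrable ?P H" using Hint [of 1] by simp
  obtain ys where ys: "integrable ?Q (\<lambda>x. \<bar>(\<Sum>j<M. \<eta> x (ys j)) / real M\<bar> powr p)"
    "(\<integral>x. \<bar>(\<Sum>j<M. \<eta> x (ys j)) / real M\<bar> powr p \<partial>?Q) \<le> \<theta> powr p + \<Lambda> / \<theta>\<^sup>2 * (\<integral>y. H y ^ 2 \<partial>?P) / real M + (\<integral>y. H y ^ (2 * k) \<partial>?P) / \<Lambda>"
    by (rule monte_carlo_Lp [OF prob_space_gauss_Rn prob_space_unit_cube meas \<eta>H Hint1 Hint Hint centred p k \<theta> \<Lambda> M])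
  have eq: "(\<Sum>j<M. \<eta> x (ys j)) / real M = (\<Sum>j<M. R (geo_flow \<alpha> \<beta> d T x (ys j))) / real M - (\<integral>y. R (geo_flow \<alpha> \<beta> d T x y) \<partial>?P)" for x
    using M by (simp add: \<eta>_def sum_subtractf diff_divide_distrib m_def)
  have "\<Lambda> / \<theta>\<^sup>2 * (\<integral>y. H y ^ 2 \<partial>?P) / real M \<le> \<Lambda> / \<theta>\<^sup>2 * K / real M"
    using \<Lambda> by (intro divide_right_mono mult_left_mono Vle) simp_all
  moreover have "(\<integral>y. H y ^ (2 * k) \<partial>?P) / \<Lambda> \<le> K / \<Lambda>"
    using \<Lambda> by (intro divide_right_mono Kle) simp
  ultimately have fin: "\<theta> powr p + \<Lambda> / \<theta>\<^sup>2 * (\<integral>y. H y ^ 2 \<partial>?P) / real M + (\<integral>y. H y ^ (2 * k) \<partial>?P) / \<Lambda>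
      \<le> \<theta> powr p + \<Lambda> / \<theta>\<^sup>2 * K / real M + K / \<Lambda>" by (intro add_mono order_refl)
  show thesis by (rule that [OF ys(1) [unfolded eq] order_trans [OF ys(2) [unfolded eq] fin]])
qed

text \<open>The sum is at most twice its larger summand; this works for every positive exponent,
  also below 1 where Minkowski's inequality fails.\<close>

lemma powr_add_le:
  fixes a b p :: real
  assumes "a \<ge> 0" "b \<ge> 0" "p > 0" shows "(a + b) powr p \<le> (2 * a) powr p + 2 powr p * b powr p"
proof -
  have *: "(2 * b) powr p = 2 powr p * b powr p" using assms by (simp add: powr_mult)
  show ?thesis
  proof (cases "a \<le> b")
    case True
    then have "(a + b) powr p \<le> (2 * b) powr p" using assms by (intro powr_mono2) simp_all
    then show ?thesis using * by (simp add: add_increasing)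
  next
    case False
    then have "(a + b) powr p \<le> (2 * a) powr p" using assms by (intro powr_mono2) simp_all
    then show ?thesis by (simp add: add_increasing2)
  qed
qed

text \<open>The error splits into a bias, from replacing \<phi> by the network under the
  expectation, and a sampling error. The bias is bounded by \<open>\<delta> * L\<close> pointwise on
  the cube.\<close>

lemma network_approximation:
  fixes \<alpha> \<beta> T :: real and M :: nat and \<phi> :: "(nat \<Rightarrow> real) \<Rightarrow> real"
  assumes T: "T > 0" and d: "d \<ge> 1" and b: "b \<ge> 0" and c: "c \<ge> 0" and p: "0 < p" "p \<le> real k" and k: "k \<ge> 1"
    and \<phi>: "continuous_on (Rn d) \<phi>"
    and N: "\<Phi> \<in> networks" "realizes_on a \<Phi> d"
    and Rb: "\<And>x. x \<in> Rn d \<Longrightarrow> \<bar>realization a \<Phi> x\<bar> \<le> b * (1 + norm_Rn d x powr c)"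
    and diff: "\<And>x. x \<in> Rn d \<Longrightarrow> \<bar>\<phi> x - realization a \<Phi> x\<bar> \<le> b * \<delta> * (1 + norm_Rn d x powr c)"
    and \<delta>: "\<delta> > 0" and \<theta>: "0 < \<theta>" and \<Lambda>: "\<Lambda> \<ge> 1" and M: "M \<ge> 1"
  defines "L \<equiv> mc_scale \<alpha> \<beta> T b (nat \<lceil>c\<rceil>) d" and "K \<equiv> mc_moment \<alpha> \<beta> T b (nat \<lceil>c\<rceil>) k d"
  obtains \<Psi> where "\<Psi> \<in> networks" "param_count \<Psi> \<le> M\<^sup>2 * param_count \<Phi>" "realizes_on a \<Psi> d"
    "(LINT x:unit_cube d|lebesgue_Rn d. \<bar>feynman_kac \<alpha> \<beta> T d \<phi> (0, x) - realization a \<Psi> x\<bar> powr p)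
      \<le> (2 * (\<delta> * L)) powr p + 2 powr p * (\<theta> powr p + \<Lambda> / \<theta>\<^sup>2 * K / real M + K / \<Lambda>)"
proof -
  let ?R = "realization a \<Phi>" and ?Q = "unit_cube_measure d" and ?P = "gauss_Rn d" and ?n = "nat \<lceil>c\<rceil>"
  interpret Q: prob_space ?Q by (rule prob_space_unit_cube)
  have R: "continuous_on (Rn d) ?R" using N(2) by (simp add: realizes_on_def cfun_def)
  obtain ys where ys: "integrable ?Q (\<lambda>x. \<bar>(\<Sum>j<M. ?R (geo_flow \<alpha> \<beta> d T x (ys j))) / real M - (\<integral>y. ?R (geo_flow \<alpha> \<beta> d T x y) \<partial>?P)\<bar> powr p)"
    "(\<integral>x. \<bar>(\<Sum>j<M. ?R (geo_flow \<alpha> \<beta> d T x (ys j))) / real M - (\<integral>y. ?R (geo_flow \<alpha> \<beta> d T x y) \<partial>?P)\<bar> powr p \<partial>?Q)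
      \<le> \<theta> powr p + \<Lambda> / \<theta>\<^sup>2 * K / real M + K / \<Lambda>"
    unfolding K_def by (rule monte_carlo_flow [OF d R b c Rb p k \<theta> \<Lambda> M])
  let ?S = "\<lambda>x. (\<Sum>j<M. ?R (geo_flow \<alpha> \<beta> d T x (ys j))) / real M - (\<integral>y. ?R (geo_flow \<alpha> \<beta> d T x y) \<partial>?P)"
  \<comment> \<open>The sampled lognormal factors become the input scalings of the copies.\<close>
  obtain \<Psi> where \<Psi>: "\<Psi> \<in> networks" "param_count \<Psi> \<le> M\<^sup>2 * param_count \<Phi>" "realizes_on a \<Psi> d"
    "\<And>x. x \<in> Rn d \<Longrightarrow> realization a \<Psi> x = (\<Sum>m<M. ?R (\<lambda>i\<in>{..<d}. x i * geo \<alpha> \<beta> T (ys m i))) / M"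
    by (rule average_network [OF N M, of "\<lambda>m i. geo \<alpha> \<beta> T (ys m i)"]) (use that in blast)
  have Gint: "integrable ?P (\<lambda>y. geo_norm \<alpha> \<beta> T d y ^ j)" for j by (rule geo_norm_moment(1) [OF d])
  have fl: "b * \<rho> * (1 + norm_Rn d (geo_flow \<alpha> \<beta> d T x y) powr c) \<le> 2 * (b * \<rho>) * geo_norm \<alpha> \<beta> T d y ^ ?n"
    if "x \<in> unit_cube d" "\<rho> \<ge> 0" for x y \<rho>
  proof -
    let ?N = "norm_Rn d (geo_flow \<alpha> \<beta> d T x y)"
    have "b * \<rho> * (1 + ?N powr c) \<le> b * \<rho> * (2 * (1 + ?N) ^ ?n)"
      by (intro mult_left_mono one_plus_powr_le_power c mult_nonneg_nonneg b that) simp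
    also have "\<dots> \<le> b * \<rho> * (2 * geo_norm \<alpha> \<beta> T d y ^ ?n)"
      by (intro mult_left_mono power_mono norm_geo_flow_le that mult_nonneg_nonneg b) simp_all
    finally show ?thesis by (simp only: mult_ac)
  qed
  \<comment> \<open>Used with \<open>\<rho> = 1\<close> for the network and with
    \<open>\<rho> = \<delta>\<close> for its difference to \<phi>.\<close>
  have int: "integrable ?P (\<lambda>y. f (geo_flow \<alpha> \<beta> d T x y))"
    if "continuous_on (Rn d) f" "x \<in> unit_cube d" "\<And>x. x \<in> Rn d \<Longrightarrow> \<bar>f x\<bar> \<le> b * \<rho> * (1 + norm_Rn d x powr c)" "\<rho> \<ge> 0"
    for f :: "(nat \<Rightarrow> real) \<Rightarrow> real" and x \<rho>
  proof (rule Bochner_Integration.integrable_bound [OF integrable_mult_right [OF Gint [of ?n], of "2 * (b * \<rho>)"] geo_flow_measurable [OF that(1)]])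
    show "AE y in ?P. norm (f (geo_flow \<alpha> \<beta> d T x y)) \<le> norm (2 * (b * \<rho>) * geo_norm \<alpha> \<beta> T d y ^ ?n)"
    proof (intro AE_I2)
      fix y show "norm (f (geo_flow \<alpha> \<beta> d T x y)) \<le> norm (2 * (b * \<rho>) * geo_norm \<alpha> \<beta> T d y ^ ?n)"
        using that(3) [OF geo_flow_in_Rn, of \<alpha> \<beta> T x y] fl [OF that(2,4), of y] unfolding real_norm_def by linarith
    qed
  qed
  have bias: "\<bar>feynman_kac \<alpha> \<beta> T d \<phi> (0, x) - (\<integral>y. ?R (geo_flow \<alpha> \<beta> d T x y) \<partial>?P)\<bar> \<le> \<delta> * L" if x: "x \<in> unit_cube d" for x
  proof -
    let ?f = "geo_flow \<alpha> \<beta> d T x"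
    have Ri: "integrable ?P (\<lambda>y. ?R (?f y))" by (rule int [OF R x, of 1]) (use Rb in simp_all)
    have Di: "integrable ?P (\<lambda>y. \<phi> (?f y) - ?R (?f y))"
      by (rule int [OF continuous_on_diff [OF \<phi> R] x diff less_imp_le [OF \<delta>]])
    from Bochner_Integration.integrable_add [OF Di Ri] have Pi: "integrable ?P (\<lambda>y. \<phi> (?f y))" by simp
    have e: "feynman_kac \<alpha> \<beta> T d \<phi> (0, x) - (\<integral>y. ?R (?f y) \<partial>?P) = (\<integral>y. \<phi> (?f y) - ?R (?f y) \<partial>?P)"
      unfolding feynman_kac_def by (simp add: Bochner_Integration.integral_diff [OF Pi Ri])
    have "\<bar>feynman_kac \<alpha> \<beta> T d \<phi> (0, x) - (\<integral>y. ?R (?f y) \<partial>?P)\<bar> \<le> (\<integral>y. \<bar>\<phi> (?f y) - ?R (?f y)\<bar> \<partial>?P)"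
      unfolding e by (rule integral_abs_bound)
    also have "\<dots> \<le> (\<integral>y. 2 * (b * \<delta>) * geo_norm \<alpha> \<beta> T d y ^ ?n \<partial>?P)"
      by (rule integral_mono [OF integrable_abs [OF Di] integrable_mult_right [OF Gint]])
        (rule order_trans [OF diff [OF geo_flow_in_Rn] fl [OF x less_imp_le [OF \<delta>]]])
    also have "\<dots> = 2 * (b * \<delta>) * (\<integral>y. geo_norm \<alpha> \<beta> T d y ^ ?n \<partial>?P)" by (rule integral_mult_right_zero)
    also have "\<dots> \<le> 2 * (b * \<delta>) * (geo_moment_const \<alpha> \<beta> T ?n * real d ^ (?n + 1))"
      using b \<delta> by (intro mult_left_mono geo_norm_moment(2) [OF d]) simp
    also have "\<dots> = \<delta> * (2 * b * (geo_moment_const \<alpha> \<beta> T ?n * real d ^ (?n + 1)))" by (simp only: mult_ac)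
    also have "\<dots> \<le> \<delta> * L"
      using b \<delta> unfolding L_def mc_scale_def distrib_left [of "2 * b"] by (intro mult_left_mono) simp_all
    finally show ?thesis .
  qed
  have pt: "\<bar>feynman_kac \<alpha> \<beta> T d \<phi> (0, x) - realization a \<Psi> x\<bar> powr p \<le> (2 * (\<delta> * L)) powr p + 2 powr p * \<bar>?S x\<bar> powr p"
    if "x \<in> space ?Q" for x
  proof -
    have x: "x \<in> unit_cube d" using that by (simp only: space_unit_cube_measure)
    have "realization a \<Psi> x = (\<Sum>j<M. ?R (geo_flow \<alpha> \<beta> d T x (ys j))) / real M"
      unfolding \<Psi>(4) [OF unit_cube_in_Rn [OF x]] geo_flow_def ..
    then have "\<bar>feynman_kac \<alpha> \<beta> T d \<phi> (0, x) - realization a \<Psi> x\<bar> \<le> \<delta> * L + \<bar>?S x\<bar>"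
      using bias [OF x] by linarith
    then have "\<bar>feynman_kac \<alpha> \<beta> T d \<phi> (0, x) - realization a \<Psi> x\<bar> powr p \<le> (\<delta> * L + \<bar>?S x\<bar>) powr p"
      using p by (intro powr_mono2) simp_all
    also have "\<dots> \<le> (2 * (\<delta> * L)) powr p + 2 powr p * \<bar>?S x\<bar> powr p"
      by (rule powr_add_le [OF _ _ p(1)]) (use order_trans [OF abs_ge_zero bias [OF x]] in simp_all)
    finally show ?thesis .
  qed
  have ui: "integrable ?Q (\<lambda>x. (2 * (\<delta> * L)) powr p + 2 powr p * \<bar>?S x\<bar> powr p)"
    by (intro Bochner_Integration.integrable_add Q.integrable_const integrable_mult_right ys(1))
  \<comment> \<open>\<open>integral_mono'\<close> asks for integrability of the majorant alone, so
    the left integrand needs no separate argument.\<close>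
  have "(LINT x:unit_cube d|lebesgue_Rn d. \<bar>feynman_kac \<alpha> \<beta> T d \<phi> (0, x) - realization a \<Psi> x\<bar> powr p)
    \<le> (\<integral>x. (2 * (\<delta> * L)) powr p + 2 powr p * \<bar>?S x\<bar> powr p \<partial>?Q)"
    unfolding set_integral_unit_cube by (rule integral_mono' [OF ui pt]) simp_all
  also have "\<dots> = (2 * (\<delta> * L)) powr p + 2 powr p * (\<integral>x. \<bar>?S x\<bar> powr p \<partial>?Q)"
    by (subst Bochner_Integration.integral_add [OF Q.integrable_const integrable_mult_right [OF ys(1)]]) (simp add: Q.prob_space)
  also have "\<dots> \<le> (2 * (\<delta> * L)) powr p + 2 powr p * (\<theta> powr p + \<Lambda> / \<theta>\<^sup>2 * K / real M + K / \<Lambda>)"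
    by (intro add_left_mono mult_left_mono ys(2)) simp
  finally show thesis by (rule that [OF \<Psi>(1-3)])
qed

section \<open>Polynomial bounds in dimension and inverse accuracy\<close>

definition poly_dominated :: "(nat \<Rightarrow> real \<Rightarrow> real) \<Rightarrow> bool" where
  "poly_dominated f \<longleftrightarrow> (\<exists>C>0. \<forall>d\<ge>1. \<forall>\<epsilon>\<in>{0<..1}. f d \<epsilon> \<le> C * real d powr C * \<epsilon> powr (- C))"

text \<open>A single constant has to serve as factor and as both exponents; as
  \<open>d \<ge> 1\<close> and \<open>\<epsilon> \<le> 1\<close>, enlarging any of them only weakens
  the bound, so their sum will do.\<close>

lemma poly_dominatedI:
  assumes "C \<ge> 0" "A \<ge> 0" "E \<ge> 0" "\<And>d \<epsilon>. d \<ge> 1 \<Longrightarrow> \<epsilon> \<in> {0<..1} \<Longrightarrow> f d \<epsilon> \<le> C * real d powr A * \<epsilon> powr (- E)"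
  shows "poly_dominated f"
  unfolding poly_dominated_def
proof (intro exI [of _ "1 + C + A + E"] conjI allI impI ballI)
  fix d :: nat and \<epsilon> :: real assume d: "1 \<le> d" and \<epsilon>: "\<epsilon> \<in> {0<..1}"
  let ?D = "1 + C + A + E"
  have "\<epsilon> powr (- E) \<le> \<epsilon> powr (- ?D)" using \<epsilon> assms by (intro powr_mono') auto
  moreover have "real d powr A \<le> real d powr ?D" using d assms by (intro powr_mono) auto
  ultimately have "C * real d powr A * \<epsilon> powr (- E) \<le> ?D * real d powr ?D * \<epsilon> powr (- ?D)"
    using assms by (intro mult_mono) auto
  then show "f d \<epsilon> \<le> ?D * real d powr ?D * \<epsilon> powr (- ?D)" using assms(4) [OF d \<epsilon>] by linarith
qed (use assms in simp)

lemma poly_dominated_const: "poly_dominated (\<lambda>_ _. c)"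
  by (rule poly_dominatedI [of "\<bar>c\<bar>" 0 0]) auto

lemma poly_dominated_dim: "poly_dominated (\<lambda>d _. real d powr A)"
  by (rule poly_dominatedI [of 1 "\<bar>A\<bar>" 0]) (auto intro: powr_mono)

lemma poly_dominated_inverse_eps: "E \<ge> 0 \<Longrightarrow> poly_dominated (\<lambda>_ \<epsilon>. \<epsilon> powr (- E))"
  by (rule poly_dominatedI [of 1 0 E]) auto

lemma poly_dominated_add:
  assumes "poly_dominated f" "poly_dominated g" shows "poly_dominated (\<lambda>d \<epsilon>. f d \<epsilon> + g d \<epsilon>)"
proof -
  obtain C where C: "C > 0" "\<And>d \<epsilon>. d \<ge> 1 \<Longrightarrow> \<epsilon> \<in> {0<..1} \<Longrightarrow> f d \<epsilon> \<le> C * real d powr C * \<epsilon> powr (- C)"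
    using assms(1) unfolding poly_dominated_def by blast
  obtain C' where C': "C' > 0" "\<And>d \<epsilon>. d \<ge> 1 \<Longrightarrow> \<epsilon> \<in> {0<..1} \<Longrightarrow> g d \<epsilon> \<le> C' * real d powr C' * \<epsilon> powr (- C')"
    using assms(2) unfolding poly_dominated_def by blast
  show ?thesis
  proof (rule poly_dominatedI [of "C + C'" "C + C'" "C + C'"])
    fix d :: nat and \<epsilon> :: real assume d: "1 \<le> d" and \<epsilon>: "\<epsilon> \<in> {0<..1}"
    have 1: "real d powr C \<le> real d powr (C + C')" "real d powr C' \<le> real d powr (C + C')"
      using d C(1) C'(1) by (simp_all add: powr_mono)
    have 2: "\<epsilon> powr (- C) \<le> \<epsilon> powr (- (C + C'))" "\<epsilon> powr (- C') \<le> \<epsilon> powr (- (C + C'))"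
      using \<epsilon> C(1) C'(1) by (simp_all add: powr_mono')
    have "C * real d powr C * \<epsilon> powr (- C) \<le> C * real d powr (C + C') * \<epsilon> powr (- (C + C'))"
      "C' * real d powr C' * \<epsilon> powr (- C') \<le> C' * real d powr (C + C') * \<epsilon> powr (- (C + C'))"
      using C(1) C'(1) by (intro mult_mono 1 2; simp)+
    then show "f d \<epsilon> + g d \<epsilon> \<le> (C + C') * real d powr (C + C') * \<epsilon> powr (- (C + C'))"
      using C(2) [OF d \<epsilon>] C'(2) [OF d \<epsilon>] unfolding distrib_right by linarith
  qed (use C C' in simp_all)
qed

lemma poly_dominated_mult:
  assumes "poly_dominated f" "poly_dominated g"
    and nonneg: "\<And>d \<epsilon>. d \<ge> 1 \<Longrightarrow> \<epsilon> \<in> {0<..1} \<Longrightarrow> 0 \<le> f d \<epsilon>" "\<And>d \<epsilon>. d \<ge> 1 \<Longrightarrow> \<epsilon> \<in> {0<..1} \<Longrightarrow> 0 \<le> g d \<epsilon>"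
  shows "poly_dominated (\<lambda>d \<epsilon>. f d \<epsilon> * g d \<epsilon>)"
proof -
  obtain C where C: "C > 0" "\<And>d \<epsilon>. d \<ge> 1 \<Longrightarrow> \<epsilon> \<in> {0<..1} \<Longrightarrow> f d \<epsilon> \<le> C * real d powr C * \<epsilon> powr (- C)"
    using assms(1) unfolding poly_dominated_def by blast
  obtain C' where C': "C' > 0" "\<And>d \<epsilon>. d \<ge> 1 \<Longrightarrow> \<epsilon> \<in> {0<..1} \<Longrightarrow> g d \<epsilon> \<le> C' * real d powr C' * \<epsilon> powr (- C')"
    using assms(2) unfolding poly_dominated_def by blast
  show ?thesis
  proof (rule poly_dominatedI [of "C * C'" "C + C'" "C + C'"])
    fix d :: nat and \<epsilon> :: real assume d: "1 \<le> d" and \<epsilon>: "\<epsilon> \<in> {0<..1}"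
    have "f d \<epsilon> * g d \<epsilon> \<le> (C * real d powr C * \<epsilon> powr (- C)) * (C' * real d powr C' * \<epsilon> powr (- C'))"
      by (rule mult_mono [OF C(2) [OF d \<epsilon>] C'(2) [OF d \<epsilon>] _ nonneg(2) [OF d \<epsilon>]]) (use C(1) in simp)
    also have "\<dots> = (C * C') * real d powr (C + C') * \<epsilon> powr (- (C + C'))"
      by (simp only: powr_add minus_add_distrib mult_ac)
    finally show "f d \<epsilon> * g d \<epsilon> \<le> (C * C') * real d powr (C + C') * \<epsilon> powr (- (C + C'))" .
  qed (use C C' in simp_all)
qed

lemma poly_dominated_power:
  assumes "poly_dominated f" "\<And>d \<epsilon>. d \<ge> 1 \<Longrightarrow> \<epsilon> \<in> {0<..1} \<Longrightarrow> 0 \<le> f d \<epsilon>"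
  shows "poly_dominated (\<lambda>d \<epsilon>. f d \<epsilon> ^ n)"
proof (induction n)
  case (Suc n)
  show ?case unfolding power_Suc by (intro poly_dominated_mult assms(1) Suc zero_le_power assms(2))
qed (simp add: poly_dominated_const)

lemma poly_dominated_powr:
  assumes "poly_dominated f" and nonneg: "\<And>d \<epsilon>. d \<ge> 1 \<Longrightarrow> \<epsilon> \<in> {0<..1} \<Longrightarrow> 0 \<le> f d \<epsilon>" and q: "q \<ge> 0"
  shows "poly_dominated (\<lambda>d \<epsilon>. f d \<epsilon> powr q)"
proof -
  obtain C where C: "C > 0" "\<And>d \<epsilon>. d \<ge> 1 \<Longrightarrow> \<epsilon> \<in> {0<..1} \<Longrightarrow> f d \<epsilon> \<le> C * real d powr C * \<epsilon> powr (- C)"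
    using assms(1) unfolding poly_dominated_def by blast
  show ?thesis
  proof (rule poly_dominatedI [of "C powr q" "C * q" "C * q"])
    fix d :: nat and \<epsilon> :: real assume d: "1 \<le> d" and \<epsilon>: "\<epsilon> \<in> {0<..1}"
    have "f d \<epsilon> powr q \<le> (C * real d powr C * \<epsilon> powr (- C)) powr q"
      by (rule powr_mono2 [OF q nonneg [OF d \<epsilon>] C(2) [OF d \<epsilon>]])
    also have "\<dots> = C powr q * real d powr (C * q) * \<epsilon> powr (- (C * q))"
      using C(1) by (simp add: powr_mult powr_powr)
    finally show "f d \<epsilon> powr q \<le> C powr q * real d powr (C * q) * \<epsilon> powr (- (C * q))" .
  qed (use C(1) q in simp_all)
qed

section \<open>Approximation without the curse of dimensionality\<close>

lemma poly_dominated_dim_power: "poly_dominated (\<lambda>d _. real d ^ j)"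
  by (rule poly_dominatedI [of 1 "real j" 0]) (simp_all add: powr_realpow)

lemma mc_scale_ge_1: "b \<ge> 0 \<Longrightarrow> mc_scale \<alpha> \<beta> T b n d \<ge> 1"
  using geo_moment_const(2) [of \<alpha> \<beta> T n] unfolding mc_scale_def by simp

lemma mc_moment_ge_1:
  assumes "b \<ge> 0" "d \<ge> 1" shows "mc_moment \<alpha> \<beta> T b n k d \<ge> 1"
proof -
  have "1 \<le> mc_scale \<alpha> \<beta> T b n d ^ (2 * k)" by (intro one_le_power mc_scale_ge_1 assms)
  moreover have "1 \<le> real d ^ (n * (2 * k) + 1)" using assms(2) by (intro one_le_power) simp
  ultimately have "1 * (1 * 1) \<le> mc_moment \<alpha> \<beta> T b n k d"
    unfolding mc_moment_def using geo_moment_const(2) [of \<alpha> \<beta> T "n * (2 * k)"] by (intro mult_mono) simp_all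
  then show ?thesis by simp
qed

lemma poly_dominated_mc_scale:
  assumes "c \<ge> 0" shows "poly_dominated (\<lambda>d _. mc_scale \<alpha> \<beta> T (c * real d powr c) n d)"
proof -
  have m: "geo_moment_const \<alpha> \<beta> T n \<ge> 0" using geo_moment_const(2) [of \<alpha> \<beta> T n] by linarith
  show ?thesis unfolding mc_scale_def
    by (intro poly_dominated_add poly_dominated_mult poly_dominated_const poly_dominated_dim poly_dominated_dim_power
      mult_nonneg_nonneg add_nonneg_nonneg m assms powr_ge_zero zero_le_power of_nat_0_le_iff) simp_all
qed

lemma poly_dominated_mc_moment:
  assumes "c \<ge> 0" shows "poly_dominated (\<lambda>d _. mc_moment \<alpha> \<beta> T (c * real d powr c) n k d)"
proof -
  have m: "geo_moment_const \<alpha> \<beta> T j \<ge> 0" for j using geo_moment_const(2) [of \<alpha> \<beta> T j] by linarith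
  have L: "0 \<le> mc_scale \<alpha> \<beta> T (c * real d powr c) n d" for d
    using mc_scale_ge_1 [of "c * real d powr c" \<alpha> \<beta> T n d] assms by simp
  show ?thesis unfolding mc_moment_def
    by (intro poly_dominated_mult poly_dominated_power poly_dominated_const poly_dominated_dim_power poly_dominated_mc_scale
      mult_nonneg_nonneg m L assms zero_le_power of_nat_0_le_iff)
qed

theorem theorem1p1:
  fixes T \<cc> p \<alpha> \<beta> :: real
    and a :: "real \<Rightarrow> real"
    and \<phi> :: "nat \<Rightarrow> (nat \<Rightarrow> real) \<Rightarrow> real"
    and \<Phi> :: "nat \<Rightarrow> real \<Rightarrow> network"
  assumes "T > 0" and "\<cc> > 0" and "p > 0"
    and "continuous_on UNIV a"
    and "\<And>d. d \<ge> 1 \<Longrightarrow> continuous_on (Rn d) (\<phi> d)"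
    and "\<And>d \<delta>. d \<ge> 1 \<Longrightarrow> \<delta> \<in> {0<..1} \<Longrightarrow> \<Phi> d \<delta> \<in> networks"
    and "\<And>d \<delta>. d \<ge> 1 \<Longrightarrow> \<delta> \<in> {0<..1} \<Longrightarrow>
           real (param_count (\<Phi> d \<delta>)) \<le> \<cc> * real d powr \<cc> * \<delta> powr (- \<cc>)"
    and "\<And>d \<delta>. d \<ge> 1 \<Longrightarrow> \<delta> \<in> {0<..1} \<Longrightarrow> realizes_on a (\<Phi> d \<delta>) d"
    and "\<And>d \<delta> x. d \<ge> 1 \<Longrightarrow> \<delta> \<in> {0<..1} \<Longrightarrow> x \<in> Rn d \<Longrightarrow>
           \<bar>realization a (\<Phi> d \<delta>) x\<bar> \<le> \<cc> * real d powr \<cc> * (1 + norm_Rn d x powr \<cc>)"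
    and "\<And>d \<delta> x. d \<ge> 1 \<Longrightarrow> \<delta> \<in> {0<..1} \<Longrightarrow> x \<in> Rn d \<Longrightarrow>
           \<bar>\<phi> d x - realization a (\<Phi> d \<delta>) x\<bar>
             \<le> \<cc> * real d powr \<cc> * \<delta> * (1 + norm_Rn d x powr \<cc>)"
  shows "(\<exists>!u. solution_family T \<alpha> \<beta> \<phi> u) \<and>
    (\<forall>u. solution_family T \<alpha> \<beta> \<phi> u \<longrightarrow>
      (\<exists>\<CC>>0. \<exists>\<psi> :: nat \<Rightarrow> real \<Rightarrow> network. \<forall>d\<ge>1. \<forall>\<epsilon>\<in>{0<..1}.
         \<psi> d \<epsilon> \<in> networks \<and>
         real (param_count (\<psi> d \<epsilon>)) \<le> \<CC> * real d powr \<CC> * \<epsilon> powr (- \<CC>) \<and>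
         realizes_on a (\<psi> d \<epsilon>) d \<and>
         (LINT x:unit_cube d|lebesgue_Rn d.
            \<bar>u d (0, x) - realization a (\<psi> d \<epsilon>) x\<bar> powr p) powr (1 / p) \<le> \<epsilon>))"
proof -
  note T = assms(1) and c = assms(2) and p = assms(3) and cont = assms(5) and net = assms(6) and params = assms(7)
    and realizes = assms(8) and growth = assms(9) and error = assms(10)
  let ?N = "nat \<lceil>\<cc>\<rceil>"
  \<comment> \<open>The network for \<delta> = 1 controls \<phi>: growth plus error give a factor 2,
    the passage to integer powers another 2.\<close>
  have bound: "\<bar>\<phi> d x\<bar> \<le> (4 * (\<cc> * real d powr \<cc>)) * (1 + norm_Rn d x) ^ ?N" if d: "d \<ge> 1" and x: "x \<in> Rn d" for d x
  proof -
    let ?b = "\<cc> * real d powr \<cc>"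
    have one: "(1::real) \<in> {0<..1}" by simp
    have "\<bar>\<phi> d x\<bar> \<le> 2 * (?b * (1 + norm_Rn d x powr \<cc>))"
      using growth [OF d one x] error [OF d one x] by simp
    also have "\<dots> \<le> 2 * (?b * (2 * (1 + norm_Rn d x) ^ ?N))"
      using c by (intro mult_left_mono one_plus_powr_le_power) simp_all
    finally show ?thesis by simp
  qed
  let ?U = "\<lambda>d\<in>{1..}. \<lambda>z\<in>{0..T} \<times> Rn d. feynman_kac \<alpha> \<beta> T d (\<phi> d) z"
  have iff: "solution_family T \<alpha> \<beta> \<phi> u \<longleftrightarrow> u = ?U" for u
    by (rule solution_family_iff [OF T cont bound])
  define k where "k = nat \<lceil>p\<rceil>"
  have k: "k \<ge> 1" "p \<le> real k" using p by (auto simp: k_def real_nat_ceiling_ge Suc_le_eq)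
  define b where "b d = \<cc> * real d powr \<cc>" for d :: nat
  define L where "L d = mc_scale \<alpha> \<beta> T (b d) ?N d" for d
  define K where "K d = mc_moment \<alpha> \<beta> T (b d) ?N k d" for d
  have b0: "b d \<ge> 0" for d using c by (simp add: b_def)
  have L1: "L d \<ge> 1" for d unfolding L_def by (rule mc_scale_ge_1 [OF b0])
  have K1: "K d \<ge> 1" if "d \<ge> 1" for d unfolding K_def by (rule mc_moment_ge_1 [OF b0 that])
  \<comment> \<open>The p-th power of the error consists of four terms: bias, truncation level,
    square term and high moment. Each gets a quarter of \<open>\<epsilon> powr p\<close>, and
    \<kappa> is tuned for the first two through
    \<open>(2 * \<kappa>) powr p = 1 / 4\<close>.\<close>
  define \<kappa> :: real where "\<kappa> = (1 / 4) powr (1 / p) / 2"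
  have \<kappa>: "\<kappa> > 0" "\<kappa> \<le> 1" "(2 * \<kappa>) powr p = 1 / 4"
  proof -
    show "\<kappa> > 0" by (simp add: \<kappa>_def)
    have "(1 / 4 :: real) powr (1 / p) \<le> 1 powr (1 / p)" using p by (intro powr_mono2) simp_all
    then show "\<kappa> \<le> 1" by (simp add: \<kappa>_def)
    show "(2 * \<kappa>) powr p = 1 / 4" using p by (simp add: \<kappa>_def powr_powr)
  qed
  \<comment> \<open>Makes the high-moment term exactly a quarter.\<close>
  define \<Lambda> where "\<Lambda> d \<epsilon> = 4 * 2 powr p * K d * \<epsilon> powr (- p)" for d and \<epsilon> :: real
  \<comment> \<open>The real number of samples that makes the square term a quarter: \<epsilon>^(-2)
    comes from the truncation level \<open>\<kappa> * \<epsilon>\<close>, \<epsilon>^(-p) from the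
    target.\<close>
  define X where "X d \<epsilon> = (4 * 2 powr p / \<kappa>\<^sup>2) * (\<Lambda> d \<epsilon> * K d * \<epsilon> powr (- (2 + p)))" for d and \<epsilon> :: real
  \<comment> \<open>Size bound: \<open>X d \<epsilon> + 1\<close> is at least the sample number,
    squared by averaging; the rest is the size of the given network with 1/\<delta> written
    out.\<close>
  define F where "F d \<epsilon> = (X d \<epsilon> + 1)\<^sup>2 * (b d * ((1 / \<kappa>) * L d * \<epsilon> powr (- 1)) powr \<cc>)" for d and \<epsilon> :: real
  define good where "good d \<epsilon> \<Psi> \<longleftrightarrow> \<Psi> \<in> networks \<and> real (param_count \<Psi>) \<le> F d \<epsilon> \<and> realizes_on a \<Psi> d \<and>
    (LINT x:unit_cube d|lebesgue_Rn d. \<bar>feynman_kac \<alpha> \<beta> T d (\<phi> d) (0, x) - realization a \<Psi> x\<bar> powr p) powr (1 / p) \<le> \<epsilon>" for d \<epsilon> \<Psi>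
  have good_ex: "\<exists>\<Psi>. good d \<epsilon> \<Psi>" if d: "d \<ge> 1" and \<epsilon>: "\<epsilon> \<in> {0<..1}" for d \<epsilon>
  proof -
    \<comment> \<open>Makes the bias \<open>\<delta> * L d\<close> equal to
      \<open>\<kappa> * \<epsilon>\<close>; it is at most 1 since \<open>L d\<close> is at least
      1.\<close>
    define \<delta> where "\<delta> = \<kappa> * \<epsilon> / L d"
    have \<delta>: "\<delta> > 0" "\<delta> \<in> {0<..1}"
    proof -
      show "\<delta> > 0" using \<kappa> \<epsilon> L1 [of d] by (simp add: \<delta>_def)
      have "\<kappa> * \<epsilon> \<le> 1 * 1" using \<kappa> \<epsilon> by (intro mult_mono) simp_all
      then have "\<delta> \<le> 1" using L1 [of d] by (simp add: \<delta>_def)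
      then show "\<delta> \<in> {0<..1}" using \<open>\<delta> > 0\<close> by simp
    qed
    have \<theta>: "0 < \<kappa> * \<epsilon>" using \<kappa> \<epsilon> by simp
    have e1: "1 \<le> \<epsilon> powr (- p)" using \<epsilon> p powr_mono' [of "- p" 0 \<epsilon>] by simp
    have \<Lambda>1: "\<Lambda> d \<epsilon> \<ge> 1"
    proof -
      have "1 * 1 * 1 * 1 \<le> 4 * 2 powr p * K d * \<epsilon> powr (- p)"
        using p e1 K1 [OF d] by (intro mult_mono) (simp_all add: ge_one_powr_ge_zero)
      then show ?thesis by (simp add: \<Lambda>_def)
    qed
    have X0: "X d \<epsilon> > 0" using \<Lambda>1 K1 [OF d] \<kappa> \<epsilon> by (simp add: X_def)
    define M where "M = nat \<lceil>X d \<epsilon>\<rceil>"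
    have M: "M \<ge> 1" "X d \<epsilon> \<le> real M" "real M \<le> X d \<epsilon> + 1"
    proof -
      have e: "real M = real_of_int \<lceil>X d \<epsilon>\<rceil>" using X0 by (simp add: M_def)
      show "X d \<epsilon> \<le> real M" unfolding e by (rule le_of_int_ceiling)
      then show "M \<ge> 1" using X0 by (cases M) simp_all
      show "real M \<le> X d \<epsilon> + 1" unfolding e by (rule of_int_ceiling_le_add_one)
    qed
    obtain \<Psi> where \<Psi>: "\<Psi> \<in> networks" "param_count \<Psi> \<le> M\<^sup>2 * param_count (\<Phi> d \<delta>)" "realizes_on a \<Psi> d"
      "(LINT x:unit_cube d|lebesgue_Rn d. \<bar>feynman_kac \<alpha> \<beta> T d (\<phi> d) (0, x) - realization a \<Psi> x\<bar> powr p)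
      \<le> (2 * (\<delta> * L d)) powr p + 2 powr p * ((\<kappa> * \<epsilon>) powr p + \<Lambda> d \<epsilon> / (\<kappa> * \<epsilon>)\<^sup>2 * K d / real M + K d / \<Lambda> d \<epsilon>)"
      unfolding L_def K_def
    proof (rule network_approximation [OF T d b0 less_imp_le [OF c] p k(2,1) cont [OF d] net [OF d \<delta>(2)] realizes [OF d \<delta>(2)] _ _ \<delta>(1) \<theta> \<Lambda>1 M(1)])
      show "\<And>x. x \<in> Rn d \<Longrightarrow> \<bar>realization a (\<Phi> d \<delta>) x\<bar> \<le> b d * (1 + norm_Rn d x powr \<cc>)"
        unfolding b_def by (rule growth [OF d \<delta>(2)])
      show "\<And>x. x \<in> Rn d \<Longrightarrow> \<bar>\<phi> d x - realization a (\<Phi> d \<delta>) x\<bar> \<le> b d * \<delta> * (1 + norm_Rn d x powr \<cc>)"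
        unfolding b_def by (rule error [OF d \<delta>(2)])
    qed (use that in blast)
    have s1: "(2 * (\<delta> * L d)) powr p = \<epsilon> powr p / 4"
    proof -
      have "2 * (\<delta> * L d) = (2 * \<kappa>) * \<epsilon>" using L1 [of d] by (simp add: \<delta>_def)
      then have "(2 * (\<delta> * L d)) powr p = (2 * \<kappa>) powr p * \<epsilon> powr p"
        using \<kappa>(1) \<epsilon> by (simp only: powr_mult [of "2 * \<kappa>" \<epsilon>])
      then show ?thesis unfolding \<kappa>(3) by simp
    qed
    have s2: "2 powr p * (\<kappa> * \<epsilon>) powr p = \<epsilon> powr p / 4"
    proof -
      have "2 powr p * (\<kappa> * \<epsilon>) powr p = (2 * \<kappa>) powr p * \<epsilon> powr p" using \<kappa> \<epsilon> by (simp add: powr_mult)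
      then show ?thesis by (simp add: \<kappa>)
    qed
    have s3: "2 powr p * (\<Lambda> d \<epsilon> / (\<kappa> * \<epsilon>)\<^sup>2 * K d / real M) \<le> \<epsilon> powr p / 4"
    proof -
      have e2: "\<epsilon> powr (- (2 + p)) * \<epsilon> powr p = 1 / \<epsilon>\<^sup>2"
      proof -
        have "\<epsilon> powr (- (2 + p)) * \<epsilon> powr p = \<epsilon> powr (- 2)" by (simp add: powr_add [symmetric])
        also have "\<dots> = 1 / \<epsilon>\<^sup>2" using \<epsilon> by (simp add: powr_minus_divide)
        finally show ?thesis .
      qed
      have quarter: "z \<le> e / 4 * m \<longleftrightarrow> 4 * z \<le> m * e" for z e m :: real by (simp add: field_simps)
      have "4 * (2 powr p * (\<Lambda> d \<epsilon> / (\<kappa> * \<epsilon>)\<^sup>2 * K d)) = (4 * 2 powr p / \<kappa>\<^sup>2) * (\<Lambda> d \<epsilon> * K d * (1 / \<epsilon>\<^sup>2))"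
        by (simp add: power_mult_distrib)
      also have "\<dots> = X d \<epsilon> * \<epsilon> powr p" unfolding X_def e2 [symmetric] by (simp only: mult_ac)
      also have "\<dots> \<le> real M * \<epsilon> powr p" by (intro mult_right_mono M) simp
      finally have "2 powr p * (\<Lambda> d \<epsilon> / (\<kappa> * \<epsilon>)\<^sup>2 * K d) \<le> \<epsilon> powr p / 4 * real M" by (simp only: quarter)
      then have "2 powr p * (\<Lambda> d \<epsilon> / (\<kappa> * \<epsilon>)\<^sup>2 * K d) / real M \<le> \<epsilon> powr p / 4"
        using M(1) by (subst pos_divide_le_eq) simp_all
      then show ?thesis by (simp only: times_divide_eq_right)
    qed
    have s4: "2 powr p * (K d / \<Lambda> d \<epsilon>) = \<epsilon> powr p / 4"
      using K1 [OF d] \<epsilon> by (simp add: \<Lambda>_def powr_minus field_simps)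
    have "(LINT x:unit_cube d|lebesgue_Rn d. \<bar>feynman_kac \<alpha> \<beta> T d (\<phi> d) (0, x) - realization a \<Psi> x\<bar> powr p) \<le> \<epsilon> powr p"
      using \<Psi>(4) s1 s2 s3 s4 unfolding distrib_left by linarith
    then have "(LINT x:unit_cube d|lebesgue_Rn d. \<bar>feynman_kac \<alpha> \<beta> T d (\<phi> d) (0, x) - realization a \<Psi> x\<bar> powr p) powr (1 / p) \<le> (\<epsilon> powr p) powr (1 / p)"
      using p by (intro powr_mono2) (auto simp: set_integral_unit_cube intro!: Bochner_Integration.integral_nonneg)
    also have "\<dots> = \<epsilon>" using p \<epsilon> by (simp add: powr_powr)
    finally have E: "(LINT x:unit_cube d|lebesgue_Rn d. \<bar>feynman_kac \<alpha> \<beta> T d (\<phi> d) (0, x) - realization a \<Psi> x\<bar> powr p) powr (1 / p) \<le> \<epsilon>" .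
    have "real (param_count \<Psi>) \<le> real (M\<^sup>2 * param_count (\<Phi> d \<delta>))" using \<Psi>(2) by (simp only: of_nat_le_iff)
    also have "\<dots> = (real M)\<^sup>2 * real (param_count (\<Phi> d \<delta>))" by simp
    also have "\<dots> \<le> (X d \<epsilon> + 1)\<^sup>2 * (b d * \<delta> powr (- \<cc>))"
      unfolding b_def by (intro mult_mono power_mono M params [OF d \<delta>(2)]) simp_all
    also have "\<delta> powr (- \<cc>) = ((1 / \<kappa>) * L d * \<epsilon> powr (- 1)) powr \<cc>"
    proof -
      have "(1 / \<kappa>) * L d * \<epsilon> powr (- 1) = inverse \<delta>" using \<epsilon> by (simp add: \<delta>_def powr_minus field_simps)
      then show ?thesis using \<delta>(1) by (simp add: powr_minus inverse_powr)
    qed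
    finally have "real (param_count \<Psi>) \<le> F d \<epsilon>" by (simp only: F_def)
    with \<Psi>(1,3) E show ?thesis unfolding good_def by blast
  qed
  \<comment> \<open>The exponent is not computed; closure of the polynomially dominated functions
    suffices.\<close>
  have "poly_dominated F"
  proof -
    have c0: "\<cc> \<ge> 0" using c by simp
    have K0: "0 \<le> K d" if "d \<ge> 1" for d using K1 [OF that] by linarith
    have L0: "0 \<le> L d" for d using L1 [of d] by linarith
    have dK: "poly_dominated (\<lambda>d _. K d)" unfolding K_def b_def by (rule poly_dominated_mc_moment [OF c0])
    have dL: "poly_dominated (\<lambda>d _. L d)" unfolding L_def b_def by (rule poly_dominated_mc_scale [OF c0])
    have db: "poly_dominated (\<lambda>d _. b d)" unfolding b_def
      by (intro poly_dominated_mult poly_dominated_const poly_dominated_dim) (use c in simp_all)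
    have de: "poly_dominated (\<lambda>_ \<epsilon>. \<epsilon> powr (- q))" if "q \<ge> 0" for q using that by (rule poly_dominated_inverse_eps)
    have \<Lambda>0: "0 \<le> \<Lambda> d \<epsilon>" if "d \<ge> 1" for d \<epsilon> using K0 [OF that] by (simp add: \<Lambda>_def)
    have d\<Lambda>: "poly_dominated \<Lambda>"
      unfolding \<Lambda>_def [abs_def]
      by (rule poly_dominated_mult [OF poly_dominated_mult [OF poly_dominated_const dK] de]) (use K0 p in simp_all)
    have dX: "poly_dominated X"
      unfolding X_def [abs_def]
      by (rule poly_dominated_mult [OF poly_dominated_const poly_dominated_mult [OF poly_dominated_mult [OF d\<Lambda> dK] de]])
        (use K0 \<Lambda>0 p in simp_all)
    have X0: "0 \<le> X d \<epsilon>" if "d \<ge> 1" for d \<epsilon> using K0 [OF that] \<Lambda>0 [OF that] by (simp add: X_def)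
    have dB: "poly_dominated (\<lambda>d \<epsilon>. (1 / \<kappa>) * L d * \<epsilon> powr (- 1))"
      by (rule poly_dominated_mult [OF poly_dominated_mult [OF poly_dominated_const dL] de]) (use L0 \<kappa> in simp_all)
    have B0: "0 \<le> (1 / \<kappa>) * L d * \<epsilon> powr (- 1)" for d \<epsilon> using L0 [of d] \<kappa>(1) by simp
    show ?thesis
      unfolding F_def [abs_def]
      by (rule poly_dominated_mult [OF poly_dominated_power [OF poly_dominated_add [OF dX poly_dominated_const]]
          poly_dominated_mult [OF db poly_dominated_powr [OF dB B0 c0]]])
        (use X0 b0 in \<open>simp_all add: add_nonneg_nonneg\<close>)
  qed
  then obtain C where C: "C > 0" "\<And>d \<epsilon>. d \<ge> 1 \<Longrightarrow> \<epsilon> \<in> {0<..1} \<Longrightarrow> F d \<epsilon> \<le> C * real d powr C * \<epsilon> powr (- C)"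
    unfolding poly_dominated_def by blast
  have "\<exists>\<CC>>0. \<exists>\<psi> :: nat \<Rightarrow> real \<Rightarrow> network. \<forall>d\<ge>1. \<forall>\<epsilon>\<in>{0<..1}.
         \<psi> d \<epsilon> \<in> networks \<and>
         real (param_count (\<psi> d \<epsilon>)) \<le> \<CC> * real d powr \<CC> * \<epsilon> powr (- \<CC>) \<and>
         realizes_on a (\<psi> d \<epsilon>) d \<and>
         (LINT x:unit_cube d|lebesgue_Rn d.
            \<bar>u d (0, x) - realization a (\<psi> d \<epsilon>) x\<bar> powr p) powr (1 / p) \<le> \<epsilon>" if u: "u = ?U" for u
  proof (intro exI [of _ C] exI [of _ "\<lambda>d \<epsilon>. SOME \<Psi>. good d \<epsilon> \<Psi>"] conjI C(1) allI impI ballI)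
    fix d :: nat and \<epsilon> :: real assume d: "1 \<le> d" and \<epsilon>: "\<epsilon> \<in> {0<..1}"
    let ?\<psi> = "SOME \<Psi>. good d \<epsilon> \<Psi>"
    \<comment> \<open>Networks are chosen for each dimension and accuracy separately; the constant
      \<open>C\<close> is common to all.\<close>
    have g: "good d \<epsilon> ?\<psi>" by (rule someI_ex [OF good_ex [OF d \<epsilon>]])
    show "?\<psi> \<in> networks" "realizes_on a ?\<psi> d" using g unfolding good_def by blast+
    show "real (param_count ?\<psi>) \<le> C * real d powr C * \<epsilon> powr (- C)"
      using g C(2) [OF d \<epsilon>] unfolding good_def by linarith
    have "u d (0, x) = feynman_kac \<alpha> \<beta> T d (\<phi> d) (0, x)" if "x \<in> unit_cube d" for x
    proof -
      have "(0, x) \<in> {0..T} \<times> Rn d" using unit_cube_in_Rn [OF that] T by simp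
      then show ?thesis using d by (simp add: u)
    qed
    then have "(LINT x:unit_cube d|lebesgue_Rn d. \<bar>u d (0, x) - realization a ?\<psi> x\<bar> powr p)
        = (LINT x:unit_cube d|lebesgue_Rn d. \<bar>feynman_kac \<alpha> \<beta> T d (\<phi> d) (0, x) - realization a ?\<psi> x\<bar> powr p)"
      unfolding set_integral_unit_cube
      by (intro Bochner_Integration.integral_cong refl) (simp add: space_unit_cube_measure)
    then show "(LINT x:unit_cube d|lebesgue_Rn d. \<bar>u d (0, x) - realization a ?\<psi> x\<bar> powr p) powr (1 / p) \<le> \<epsilon>"
      using g unfolding good_def by simp
  qed
  then show ?thesis unfolding iff by blast
qed

end
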